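(* Let $(M,\langle\,,\rangle)$ be a complete, non-compact, connected Riemannian manifold of dimension $m\ge2$, let $D\in C^2(M)$ be positive, and let $\varphi\in C^0([0,+\infty))\cap C^1((0,+\infty))$ be non-negative with $\varphi(0)=0$ and $\varphi(t)\le At^\delta$ on $(0,+\infty)$ for some $A,\delta>0$. Let $f\in C^0([0,+\infty))$; let $\ell\in C^0([0,+\infty))$ satisfy $\ell(t)\ge Ct^\chi$ on $(0,+\infty)$ for some $C>0$, $\chi\ge0$; let $b\in C^0(M)$ satisfy $b>0$ on $M$ and $b(x)\ge C\,r(x)^{-\mu}$ for $r(x)$ sufficiently large, for some $C>0$, $\mu\in\mathbb R$. Given $\sigma\ge0$, let $\eta=\mu-(1+\delta-\chi)(1-\sigma)$ and suppose that $$\sigma\ge\eta,\qquad 0\le\chi<\delta.$$ Let $u$ be a non-constant entire classical weak solution of $$L_{D,\varphi}u\ge b(x)f(u)\ell(|\nabla u|),$$ and suppose that either (a) $\sigma>0$, $\liminf_{t\to+\infty}f(t)>0$, and $u_+(x)=\max\{u(x),0\}=o(r(x)^\sigma)$ as $r(x)\to+\infty$; or (b) $\sigma=0$ and $u^*=\sup_Mu<+\infty$. Assume further that either $$\liminf_{R\to+\infty}\frac{\log\int_{B_R}D\,dV}{R^{\sigma-\eta}}<+\infty\quad\text{if }\sigma-\eta>0,$$ or $$\liminf_{R\to+\infty}\frac{\log\int_{B_R}D\,dV}{\log R}<+\infty\quad\text{if }\sigma-\eta=0.$$ Then $u^*=\sup_Mu<+\infty$ and $f(u^* )\le0$. In particular,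 if we also assume that $f(t)>0$ for $t>0$ and that $u(x_o)>0$ for some $x_o\in M$, then $u$ is constant on $M$; and if in addition $f(0)=0$ and $\ell(0)>0$, then $u\equiv0$ on $M$.
   Context: $r(x)=\mathrm{dist}(x,o)$ is the Riemannian distance from a fixed origin $o\in M$; $B_R$ is the geodesic ball of radius $R$ centered at $o$; $dV$ is the Riemannian volume element. The diffusion-type operator is $L_{D,\varphi}u=\frac1D\mathrm{div}\bigl(D|\nabla u|^{-1}\varphi(|\nabla u|)\nabla u\bigr)$. An entire classical weak solution of $L_{D,\varphi}u\ge b(x)f(u)\ell(|\nabla u|)$ is a $C^1$ function $u$ on $M$ satisfying the inequality in the sense of distributions, namely $-\int_M|\nabla u|^{-1}\varphi(|\nabla u|)\langle\nabla u,\nabla\psi\rangle D\,dV\ge\int_Mb(x)f(u)\ell(|\nabla u|)\psi D\,dV$ for every non-negative $\psi\in C_c^\infty(M)$. The letter $C$ denotes a positive constant which may differ at each occurrence. *)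

theory Defs
  imports "HOL-Analysis.Analysis" "HOL-Library.Landau_Symbols"
begin

section \<open>$C^k$ maps on open subsets of Euclidean space\<close>

text \<open>Only used for open \<open>S\<close>.\<close>

fun Ck_on :: "nat \<Rightarrow> (real^'n) set \<Rightarrow> (real^'n \<Rightarrow> 'b::real_normed_vector) \<Rightarrow> bool" where
  "Ck_on 0 S f \<longleftrightarrow> continuous_on S f"
| "Ck_on (Suc k) S f \<longleftrightarrow>
     (\<forall>x\<in>S. f differentiable (at x)) \<and>
     (\<forall>i. Ck_on k S (\<lambda>x. frechet_derivative f (at x) (axis i 1)))"

definition smooth_on :: "(real^'n) set \<Rightarrow> (real^'n \<Rightarrow> 'b::real_normed_vector) \<Rightarrow> bool" where
  "smooth_on S f \<longleftrightarrow> (\<forall>k. Ck_on k S f)"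


section \<open>Smooth manifolds\<close>

text \<open>The manifold is the whole type \<open>'a\<close>, and its dimension is \<open>CARD('n)\<close>. A chart is a pair
  of its domain and its coordinate map, whose values outside the domain are irrelevant.\<close>

type_synonym ('a, 'n) chart = "'a set \<times> ('a \<Rightarrow> (real, 'n) vec)"

definition inv_chart :: "('a, 'n) chart \<Rightarrow> real^'n \<Rightarrow> 'a" where
  "inv_chart c = inv_into (fst c) (snd c)"

definition chart_image :: "('a, 'n) chart \<Rightarrow> (real^'n) set" where
  "chart_image c = snd c ` fst c"

text \<open>The atlas need not be maximal.\<close>

locale smooth_manifold =
  fixes charts :: "('a::{t2_space, second_countable_topology}, 'n::finite) chart set"
  assumes charts_cover: "(\<Union>c\<in>charts. fst c) = UNIV"
    and chart_open: "c \<in> charts \<Longrightarrow> open (fst c) \<and> open (chart_image c)"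
    and chart_homeomorphism:
      "c \<in> charts \<Longrightarrow> homeomorphism (fst c) (chart_image c) (snd c) (inv_chart c)"
    and charts_compatible:
      "c \<in> charts \<Longrightarrow> c' \<in> charts \<Longrightarrow>
        smooth_on (snd c ` (fst c \<inter> fst c')) (snd c' \<circ> inv_chart c)"

definition Ck_function :: "nat \<Rightarrow> ('a, 'n::finite) chart set \<Rightarrow> ('a \<Rightarrow> real) \<Rightarrow> bool" where
  "Ck_function k charts u \<longleftrightarrow> (\<forall>c\<in>charts. Ck_on k (chart_image c) (u \<circ> inv_chart c))"

definition test_function ::
  "('a::topological_space, 'n::finite) chart set \<Rightarrow> ('a \<Rightarrow> real) \<Rightarrow> bool" where
  "test_function charts \<psi> \<longleftrightarrow>
     (\<forall>k. Ck_function k charts \<psi>) \<and> compact (closure {x. \<psi> x \<noteq> 0})"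


section \<open>Riemannian metrics\<close>

text \<open>The metric is given by its Gram matrix \<open>g c p\<close> in the coordinates of each chart \<open>c\<close> at each
  point \<open>p\<close> of the domain of \<open>c\<close>; \<open>metric_transform\<close> says that these matrices are the components
  of one covariant 2-tensor.\<close>

definition coord_jacobian :: "('a, 'n::finite) chart \<Rightarrow> ('a, 'n) chart \<Rightarrow> 'a \<Rightarrow> real^'n^'n" where
  "coord_jacobian c c' p = matrix (frechet_derivative (snd c' \<circ> inv_chart c) (at (snd c p)))"

type_synonym ('a, 'n) gram = "('a, 'n) chart \<Rightarrow> 'a \<Rightarrow> ((real, 'n) vec, 'n) vec"

locale riemannian_manifold = smooth_manifold charts
  for charts :: "('a::{t2_space, second_countable_topology}, 'n::finite) chart set" +
  fixes g :: "('a, 'n) gram"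
  assumes metric_smooth: "c \<in> charts \<Longrightarrow> smooth_on (chart_image c) (g c \<circ> inv_chart c)"
    and metric_symmetric: "c \<in> charts \<Longrightarrow> p \<in> fst c \<Longrightarrow> transpose (g c p) = g c p"
    and metric_positive:
      "c \<in> charts \<Longrightarrow> p \<in> fst c \<Longrightarrow> v \<noteq> 0 \<Longrightarrow> v \<bullet> (g c p *v v) > 0"
    and metric_transform:
      "c \<in> charts \<Longrightarrow> c' \<in> charts \<Longrightarrow> p \<in> fst c \<Longrightarrow> p \<in> fst c' \<Longrightarrow>
        g c p = transpose (coord_jacobian c c' p) ** g c' p ** coord_jacobian c c' p"

text \<open>Pointwise quantities are computed in an arbitrary chart around the point; on a Riemannian
  manifold the results below do not depend on this choice.\<close>

definition chart_at :: "('a, 'n) chart set \<Rightarrow> 'a \<Rightarrow> ('a, 'n) chart" where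
  "chart_at charts p = (SOME c. c \<in> charts \<and> p \<in> fst c)"

definition coord_grad :: "('a, 'n::finite) gram \<Rightarrow> ('a, 'n) chart \<Rightarrow> ('a \<Rightarrow> real) \<Rightarrow> 'a \<Rightarrow> real^'n" where
  "coord_grad g c u p =
     matrix_inv (g c p) *v
       (\<chi> i. frechet_derivative (u \<circ> inv_chart c) (at (snd c p)) (axis i 1))"

definition grad_inner ::
  "('a, 'n::finite) chart set \<Rightarrow> ('a, 'n) gram \<Rightarrow> ('a \<Rightarrow> real) \<Rightarrow> ('a \<Rightarrow> real) \<Rightarrow> 'a \<Rightarrow> real" where
  "grad_inner charts g u v p =
     (let c = chart_at charts p in coord_grad g c u p \<bullet> (g c p *v coord_grad g c v p))"

definition grad_norm ::
  "('a, 'n::finite) chart set \<Rightarrow> ('a, 'n) gram \<Rightarrow> ('a \<Rightarrow> real) \<Rightarrow> 'a \<Rightarrow> real" where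
  "grad_norm charts g u p = sqrt (grad_inner charts g u u p)"


subsection \<open>Riemannian distance\<close>

definition C1_curve_on ::
  "('a::topological_space, 'n::finite) chart set \<Rightarrow> real set \<Rightarrow> (real \<Rightarrow> 'a) \<Rightarrow> bool" where
  "C1_curve_on charts I \<gamma> \<longleftrightarrow> continuous_on I \<gamma> \<and>
     (\<forall>c\<in>charts. \<exists>v. continuous_on {t\<in>I. \<gamma> t \<in> fst c} v \<and>
        (\<forall>t\<in>I. \<gamma> t \<in> fst c \<longrightarrow> ((snd c \<circ> \<gamma>) has_vector_derivative v t) (at t within I)))"

text \<open>\<open>C1_curve_on\<close> on each closed subinterval between consecutive points of \<open>S\<close> includes
  one-sided derivatives at the break points.\<close>

definition piecewise_C1_curve ::
  "('a::topological_space, 'n::finite) chart set \<Rightarrow> (real \<Rightarrow> 'a) \<Rightarrow> bool" where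
  "piecewise_C1_curve charts \<gamma> \<longleftrightarrow>
     (\<exists>S. finite S \<and> {0, 1} \<subseteq> S \<and> S \<subseteq> {0..1} \<and>
        (\<forall>a\<in>S. \<forall>b\<in>S. a < b \<and> {a<..<b} \<inter> S = {} \<longrightarrow> C1_curve_on charts {a..b} \<gamma>))"

definition speed ::
  "('a, 'n::finite) chart set \<Rightarrow> ('a, 'n) gram \<Rightarrow> (real \<Rightarrow> 'a) \<Rightarrow> real \<Rightarrow> real" where
  "speed charts g \<gamma> t =
     (let c = chart_at charts (\<gamma> t); v = vector_derivative (snd c \<circ> \<gamma>) (at t within {0..1})
      in sqrt (v \<bullet> (g c (\<gamma> t) *v v)))"

definition curve_length ::
  "('a, 'n::finite) chart set \<Rightarrow> ('a, 'n) gram \<Rightarrow> (real \<Rightarrow> 'a) \<Rightarrow> real" where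
  "curve_length charts g \<gamma> = integral {0..1} (speed charts g \<gamma>)"

definition riem_dist ::
  "('a::topological_space, 'n::finite) chart set \<Rightarrow> ('a, 'n) gram \<Rightarrow> 'a \<Rightarrow> 'a \<Rightarrow> real" where
  "riem_dist charts g p q =
     Inf {curve_length charts g \<gamma> | \<gamma>. piecewise_C1_curve charts \<gamma> \<and> \<gamma> 0 = p \<and> \<gamma> 1 = q}"

definition riem_ball ::
  "('a::topological_space, 'n::finite) chart set \<Rightarrow> ('a, 'n) gram \<Rightarrow> 'a \<Rightarrow> real \<Rightarrow> 'a set" where
  "riem_ball charts g p R = {q. riem_dist charts g p q < R}"

definition riem_complete ::
  "('a::topological_space, 'n::finite) chart set \<Rightarrow> ('a, 'n) gram \<Rightarrow> bool" where
  "riem_complete charts g \<longleftrightarrow> Metric_space.mcomplete UNIV (riem_dist charts g)"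


subsection \<open>Riemannian volume\<close>

text \<open>In local coordinates the volume element is \<open>sqrt (det g) dx\<close>. Since the manifold is second
  countable, this determines the Borel measure \<open>dV\<close> uniquely.\<close>

definition riemannian_volume ::
  "('a::topological_space, 'n::finite) chart set \<Rightarrow> ('a, 'n) gram \<Rightarrow> 'a measure \<Rightarrow> bool" where
  "riemannian_volume charts g dV \<longleftrightarrow> sets dV = sets borel \<and>
     (\<forall>c\<in>charts. \<forall>E\<in>sets borel. E \<subseteq> fst c \<longrightarrow>
        emeasure dV E = (\<integral>\<^sup>+y\<in>snd c ` E. ennreal (sqrt (det (g c (inv_chart c y)))) \<partial>lborel))"


section \<open>Weak solutions of the differential inequality\<close>

text \<open>At critical points of \<open>u\<close> the vector field \<open>\<phi>(|\<nabla>u|) \<nabla>u / |\<nabla>u|\<close> is \<open>0\<close>, which agrees with its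
  continuous extension when \<open>\<phi>\<close> is continuous and \<open>\<phi> 0 = 0\<close>.\<close>

definition entire_classical_weak_solution ::
  "('a::topological_space, 'n::finite) chart set \<Rightarrow> ('a, 'n) gram \<Rightarrow> 'a measure \<Rightarrow>
   ('a \<Rightarrow> real) \<Rightarrow> (real \<Rightarrow> real) \<Rightarrow> ('a \<Rightarrow> real) \<Rightarrow> (real \<Rightarrow> real) \<Rightarrow> (real \<Rightarrow> real) \<Rightarrow>
   ('a \<Rightarrow> real) \<Rightarrow> bool" where
  "entire_classical_weak_solution charts g dV D \<phi> b f l u \<longleftrightarrow>
     Ck_function 1 charts u \<and>
     (\<forall>\<psi>. test_function charts \<psi> \<and> (\<forall>x. \<psi> x \<ge> 0) \<longrightarrow>
        - (\<integral>x. inverse (grad_norm charts g u x) * \<phi> (grad_norm charts g u x)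
              * grad_inner charts g u \<psi> x * D x \<partial>dV)
        \<ge> (\<integral>x. b x * f (u x) * l (grad_norm charts g u x) * \<psi> x * D x \<partial>dV))"

end

theory Submission
  imports Defs
begin

text \<open>
Suppose that \<open>u\<close> is not constant and that it is unbounded or \<open>f\<close> is positive at its supremum. Then there
is a level \<open>\<gamma>\<close>, exceeded by \<open>u\<close>, such that \<open>f\<close> is at least a positive constant on the values of \<open>u\<close> above
\<open>\<gamma>\<close>, while \<open>u - \<gamma> \<le> e * R powr \<sigma>\<close> on all large balls, where \<open>e\<close> is as small as desired
(\<open>bounded_positive_levels\<close>, \<open>unbounded_positive_levels\<close>). As the manifold is connected, the gradient norm
\<open>G\<close> of \<open>u\<close> is positive at some point above this level (\<open>gradient_above_level\<close>).

The differential inequality is tested with \<open>\<psi> ^ n\<close> times the square of the positive part of \<open>u - \<gamma>\<close> times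
\<open>exp (q * (u - \<gamma>))\<close>, where \<open>\<psi>\<close> is one on the ball of radius \<open>R / 2\<close>, vanishes outside the ball of radius
\<open>R\<close> and has a gradient of order \<open>1 / R\<close>. The exponential contributes \<open>q * \<phi> G * G\<close>, and the right-hand side
contributes at least a multiple of \<open>b * G powr chi\<close>. Because of \<open>\<phi> t \<le> A * t powr \<delta>\<close> and \<open>chi < \<delta>\<close>, the sum of
the two dominates \<open>H * \<phi> G\<close>, where \<open>H\<close> is a constant times \<open>q powr \<theta> * b powr (1 - \<theta>)\<close>
(\<open>flux_le_bulk\<close>). The only term without a sign, in which the cutoff is differentiated, is the test
function times \<open>n / (R * \<psi>) * \<phi> G\<close> up to constants. If \<open>n\<close> is at most a small multiple of \<open>H * R\<close>, it is absorbed where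
\<open>\<psi> \<ge> 1/2\<close> and contributes a factor \<open>2 powr (- n)\<close> elsewhere. Thus the weighted energy \<open>J\<close> satisfies
\<open>J (R / 2) \<le> 2 * (1/2) ^ n * J R\<close> (\<open>decay_step\<close>).

For \<open>q = \<kappa> * R powr (- \<eta>)\<close> the product \<open>H * R\<close> is a constant times \<open>\<kappa> powr \<theta> * R powr (\<sigma> - \<eta>)\<close>
(\<open>scaling\<close>), and \<open>q * (u - \<gamma>) \<le> R powr (\<sigma> - \<eta>)\<close> if \<open>e\<close> is small compared to \<open>1 / \<kappa>\<close>. A Caccioppoli
estimate with the same test function then bounds \<open>J R\<close> by a power of \<open>R\<close> times \<open>exp (R powr (\<sigma> - \<eta>))\<close> times
the volume of the ball of radius \<open>2 * R\<close> (\<open>volume_bound\<close>). If \<open>\<sigma> > \<eta>\<close>, a large \<open>\<kappa>\<close> lets \<open>2 powr (- n)\<close>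
beat this bound along the radii on which the volume is controlled (\<open>no_exponential_growth\<close>). If
\<open>\<sigma> = \<eta>\<close>, then \<open>n\<close> is a fixed number that grows with \<open>\<kappa>\<close>, and iterating over dyadic radii yields decay
faster than any given power, against a volume bound of polynomial order (\<open>no_polynomial_growth\<close>). In both
cases the energy on a fixed ball is zero, although \<open>G\<close> is positive somewhere above the level.

Consequently \<open>f \<le> 0\<close> at the supremum, which excludes non-constant solutions that are positive somewhere
if \<open>f > 0\<close> on the positive numbers. A positive constant \<open>a\<close> is not a solution if \<open>f a * l 0 > 0\<close>
(\<open>constant_solution\<close>).

These test functions are only \<open>C1\<close>; that the inequality extends to them is shown by mollification in
charts (\<open>admissible_C1\<close>). The cutoffs are built from \<open>C1\<close> approximations of the distance that are glued
from mollifications in charts (\<open>smoothable_compact\<close>), and they have compact support by the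
Hopf--Rinow theorem (\<open>compact_rdist_le\<close>), which rests on the fact that the distance is a length metric.
\<close>


section \<open>Calculus of $C^k$ maps on open sets\<close>

abbreviation partial :: "'n \<Rightarrow> (real^'n \<Rightarrow> 'b::real_normed_vector) \<Rightarrow> real^'n \<Rightarrow> 'b" where
  "partial i f x \<equiv> frechet_derivative f (at x) (axis i 1)"

lemma Ck_on_subset: "Ck_on k S f \<Longrightarrow> T \<subseteq> S \<Longrightarrow> Ck_on k T f"
  by (induction k arbitrary: f) (auto intro: continuous_on_subset)

lemma Ck_on_Un:
  "open S \<Longrightarrow> open T \<Longrightarrow> Ck_on k S f \<Longrightarrow> Ck_on k T f \<Longrightarrow> Ck_on k (S \<union> T) f"
  by (induction k arbitrary: f) (auto intro: continuous_on_open_Un)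

lemma Ck_on_cong:
  assumes "open S" "\<And>x. x \<in> S \<Longrightarrow> f x = h x" "Ck_on k S f"
  shows "Ck_on k S h"
  using assms(2,3)
proof (induction k arbitrary: f h)
  case 0
  then show ?case by (auto cong: continuous_on_cong)
next
  case (Suc k)
  have eq: "frechet_derivative f (at x) = frechet_derivative h (at x)"
    and "h differentiable (at x)" if "x \<in> S" for x
  proof -
    from Suc.prems that have d: "f differentiable (at x)" by auto
    show "frechet_derivative f (at x) = frechet_derivative h (at x)"
      by (rule frechet_derivative_transform_within_open[OF d assms(1) that Suc.prems(1)])
    show "h differentiable (at x)"
      using d assms(1) that Suc.prems(1) unfolding differentiable_def
      by (meson has_derivative_transform_within_open)
  qed
  moreover have "Ck_on k S (partial i h)" for i
    by (rule Suc.IH[where f = "partial i f"]) (use Suc.prems eq in auto)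
  ultimately show ?case by auto
qed

lemma Ck_on_continuous:
  assumes "Ck_on k S f" "open S" shows "continuous_on S f"
proof (cases k)
  case (Suc m)
  then show ?thesis using assms
    by (auto intro!: continuous_at_imp_continuous_on differentiable_imp_continuous_within)
qed (use assms in auto)

lemma Ck_on_SucD: "Ck_on (Suc k) S f \<Longrightarrow> Ck_on k S f"
  by (induction k arbitrary: f)
     (auto intro!: continuous_at_imp_continuous_on differentiable_imp_continuous_within)

lemma Ck_on_SucI:
  assumes "open S" "\<And>x. x \<in> S \<Longrightarrow> (f has_derivative f' x) (at x)"
    and "\<And>i. Ck_on k S (\<lambda>x. f' x (axis i 1))"
  shows "Ck_on (Suc k) S f"
proof -
  have eq: "frechet_derivative f (at x) = f' x" if "x \<in> S" for x
    using frechet_derivative_at[OF assms(2)[OF that]] by simp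
  have "Ck_on k S (partial i f)" for i
    by (rule Ck_on_cong[OF assms(1) _ assms(3)[of i]]) (simp add: eq)
  then show ?thesis using assms(2) by (auto simp: differentiable_def)
qed

lemma Ck_on_has_derivative:
  "Ck_on (Suc k) S f \<Longrightarrow> x \<in> S \<Longrightarrow> (f has_derivative frechet_derivative f (at x)) (at x)"
  by (simp add: frechet_derivative_works)

lemma Ck_on_const: "Ck_on k S (\<lambda>x. c)"
  by (induction k arbitrary: c) auto

lemma Ck_on_add:
  assumes "open S" "Ck_on k S f" "Ck_on k S h" shows "Ck_on k S (\<lambda>x. f x + h x)"
  using assms(2,3)
proof (induction k arbitrary: f h)
  case (Suc k)
  show ?case
    by (rule Ck_on_SucI[OF assms(1) has_derivative_add[OF Ck_on_has_derivative[OF Suc.prems(1)]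
            Ck_on_has_derivative[OF Suc.prems(2)]]])
       (use Suc in auto)
qed (auto intro: continuous_intros)

lemma Ck_on_bounded_linear:
  assumes "open S" "bounded_linear B" "Ck_on k S f" shows "Ck_on k S (\<lambda>x. B (f x))"
  using assms(3)
proof (induction k arbitrary: f)
  case 0
  then show ?case
    by (simp add: bounded_linear.continuous_on[OF assms(2)])
next
  case (Suc k)
  show ?case
    by (rule Ck_on_SucI[OF assms(1) bounded_linear.has_derivative[OF assms(2)
            Ck_on_has_derivative[OF Suc.prems]]])
       (use Suc in auto)
qed

lemma Ck_on_mult:
  fixes f h :: "real^'n \<Rightarrow> real"
  assumes "open S" "Ck_on k S f" "Ck_on k S h" shows "Ck_on k S (\<lambda>x. f x * h x)"
  using assms(2,3)
proof (induction k arbitrary: f h)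
  case (Suc k)
  show ?case
  proof (rule Ck_on_SucI[OF assms(1) has_derivative_mult[OF Ck_on_has_derivative[OF Suc.prems(1)]
            Ck_on_has_derivative[OF Suc.prems(2)]]])
    fix i
    show "Ck_on k S (\<lambda>x. f x * partial i h x + partial i f x * h x)"
      by (intro Ck_on_add[OF assms(1)] Suc.IH) (use Suc.prems Ck_on_SucD in auto)
  qed
qed (auto intro: continuous_intros)

lemma Ck_on_sum:
  assumes "open S" "\<And>i. i \<in> I \<Longrightarrow> Ck_on k S (f i)" shows "Ck_on k S (\<lambda>x. \<Sum>i\<in>I. f i x)"
  using assms(2)
  by (induction I rule: infinite_finite_induct) (auto intro!: Ck_on_const Ck_on_add assms(1))

lemma Ck_on_prod:
  fixes f :: "'i \<Rightarrow> real^'n \<Rightarrow> real"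
  assumes "open S" "\<And>i. i \<in> I \<Longrightarrow> Ck_on k S (f i)" shows "Ck_on k S (\<lambda>x. \<Prod>i\<in>I. f i x)"
  using assms(2)
  by (induction I rule: infinite_finite_induct) (auto intro!: Ck_on_const Ck_on_mult assms(1))

lemma linear_axis_sum:
  fixes L :: "real^'n \<Rightarrow> 'b::real_normed_vector"
  assumes "linear L" shows "L v = (\<Sum>j\<in>UNIV. v $ j *\<^sub>R L (axis j 1))"
proof -
  have "v = (\<Sum>j\<in>UNIV. v $ j *\<^sub>R axis j 1)"
    using basis_expansion[of v] unfolding scalar_mult_eq_scaleR by (rule sym)
  then have "L v = L (\<Sum>j\<in>UNIV. v $ j *\<^sub>R axis j 1)" by (rule arg_cong)
  also have "\<dots> = (\<Sum>j\<in>UNIV. L (v $ j *\<^sub>R axis j 1))" by (rule linear_sum[OF assms])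
  also have "\<dots> = (\<Sum>j\<in>UNIV. v $ j *\<^sub>R L (axis j 1))" by (rule sum.cong[OF refl], rule linear_scale[OF assms])
  finally show ?thesis .
qed

lemma Ck_on_compose:
  fixes f :: "real^'m \<Rightarrow> real" and h :: "real^'n \<Rightarrow> real^'m"
  assumes "open S" "open T" "h ` S \<subseteq> T" "Ck_on k T f" "Ck_on k S h"
  shows "Ck_on k S (f \<circ> h)"
  using assms(4,5)
proof (induction k arbitrary: f)
  case 0
  then have "continuous_on S h" "continuous_on (h ` S) f"
    using assms(3) continuous_on_subset by auto
  then show ?case using continuous_on_compose by auto
next
  case (Suc k)
  show ?case
  proof (rule Ck_on_SucI[OF assms(1)])
    fix x assume "x \<in> S"
    show "(f \<circ> h has_derivative frechet_derivative f (at (h x)) \<circ> frechet_derivative h (at x)) (at x)"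
      using \<open>x \<in> S\<close> assms(3) Suc.prems by (intro diff_chain_at Ck_on_has_derivative) auto
  next
    fix i
    have *: "Ck_on k S (\<lambda>x. \<Sum>j\<in>UNIV. (partial i h x $ j) * (partial j f \<circ> h) x)"
    proof (intro Ck_on_sum Ck_on_mult assms(1))
      fix j
      have "Ck_on k S (partial i h)" using Suc.prems(2) by simp
      then show "Ck_on k S (\<lambda>x. partial i h x $ j)"
        by (rule Ck_on_bounded_linear[OF assms(1) bounded_linear_vec_nth])
      have "Ck_on k T (partial j f)" using Suc.prems(1) by simp
      then show "Ck_on k S (partial j f \<circ> h)"
        by (rule Suc.IH) (rule Ck_on_SucD[OF Suc.prems(2)])
    qed
    show "Ck_on k S (\<lambda>x. (frechet_derivative f (at (h x)) \<circ> frechet_derivative h (at x)) (axis i 1))"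
    proof (rule Ck_on_cong[OF assms(1) _ *])
      fix x assume "x \<in> S"
      then have "linear (frechet_derivative f (at (h x)))"
        using Suc.prems assms(3) by (auto intro!: linear_frechet_derivative)
      from linear_axis_sum[OF this, of "partial i h x"]
      show "(\<Sum>j\<in>UNIV. (partial i h x $ j) * (partial j f \<circ> h) x) =
          (frechet_derivative f (at (h x)) \<circ> frechet_derivative h (at x)) (axis i 1)" by simp
    qed
  qed
qed

lemma C1_on_real_compose:
  fixes v :: "real^'n \<Rightarrow> real" and h :: "real \<Rightarrow> real"
  assumes "open S" "Ck_on 1 S v" "\<And>t. (h has_real_derivative h' t) (at t)" "continuous_on UNIV h'"
  shows "Ck_on 1 S (\<lambda>x. h (v x))"
proof -
  have v: "Ck_on (Suc 0) S v" using assms(2) by simp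
  have "Ck_on (Suc 0) S (\<lambda>x. h (v x))"
  proof (rule Ck_on_SucI[OF assms(1)])
    fix x assume "x \<in> S"
    show "((\<lambda>x. h (v x)) has_derivative (\<lambda>w. h' (v x) * frechet_derivative v (at x) w)) (at x)"
      using has_derivative_compose[OF Ck_on_has_derivative[OF v \<open>x \<in> S\<close>]
          assms(3)[unfolded has_field_derivative_def]] by simp
  next
    fix i
    show "Ck_on 0 S (\<lambda>x. h' (v x) * partial i v x)"
      using v Ck_on_continuous[OF v assms(1)]
      by (auto intro!: continuous_intros continuous_on_compose2[OF assms(4)])
  qed
  then show ?thesis by simp
qed


section \<open>Smooth bump functions and mollification\<close>

text \<open>The functions $t^{-n}e^{-1/t}$ form a family that is closed under differentiation up to linear
  combinations, so one induction shows that all of them are smooth.\<close>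

definition flat :: "nat \<Rightarrow> real \<Rightarrow> real" where
  "flat n t = (if t \<le> 0 then 0 else exp (- inverse t) * inverse t ^ n)"

lemma flat_tendsto_0: "(flat n \<longlongrightarrow> 0) (at_right 0)"
proof -
  have "((\<lambda>s::real. s ^ n / exp s) \<longlongrightarrow> 0) at_top" by (rule tendsto_power_div_exp_0)
  then have "((\<lambda>t::real. inverse t ^ n / exp (inverse t)) \<longlongrightarrow> 0) (at_right 0)"
    by (rule filterlim_compose[OF _ filterlim_inverse_at_top_right])
  then show ?thesis
    by (rule Lim_transform_eventually)
       (auto simp: eventually_at_right_less flat_def exp_minus field_simps
             intro!: eventually_mono[OF eventually_at_right_less[of 0]])
qed

lemma has_real_derivative_flat:
  "(flat n has_real_derivative (flat (n+2) t - real n * flat (Suc n) t)) (at t)"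
proof -
  consider "t < 0" | "t = 0" | "t > 0" by linarith
  then show ?thesis
  proof cases
    case 1
    have "((\<lambda>t. 0) has_real_derivative 0) (at t)" by simp
    then have "(flat n has_real_derivative 0) (at t)"
      by (rule has_field_derivative_transform_within_open[where S = "{..<0}"])
         (use 1 in \<open>auto simp: flat_def\<close>)
    then show ?thesis using 1 by (simp add: flat_def)
  next
    case 3
    have i: "(inverse has_real_derivative - (inverse t ^ 2)) (at t)"
      using DERIV_inverse[of t] 3 by (simp add: numeral_2_eq_2)
    have p: "((\<lambda>t. inverse t ^ n) has_real_derivative - real n * inverse t ^ Suc n) (at t)"
      by (rule DERIV_cong[OF DERIV_power[OF i]]) (cases n, simp_all add: power2_eq_square algebra_simps)
    have e: "((\<lambda>t. exp (- inverse t)) has_real_derivative exp (- inverse t) * inverse t ^ 2) (at t)"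
      using DERIV_fun_exp[OF DERIV_minus[OF i]] by simp
    have "((\<lambda>t. exp (- inverse t) * inverse t ^ n) has_real_derivative
        (flat (n+2) t - real n * flat (Suc n) t)) (at t)"
      using DERIV_mult[OF e p] 3
      by (simp add: flat_def power_add power2_eq_square algebra_simps)
    then show ?thesis
      by (rule has_field_derivative_transform_within_open[where S = "{0<..}"])
         (use 3 in \<open>auto simp: flat_def\<close>)
  next
    case 2
    have "((\<lambda>h. flat n h / h) \<longlongrightarrow> 0) (at_right 0)"
      by (rule Lim_transform_eventually[OF flat_tendsto_0[of "Suc n"]])
         (auto simp: flat_def field_simps intro!: eventually_mono[OF eventually_at_right_less[of 0]])
    moreover have "((\<lambda>h. flat n h / h) \<longlongrightarrow> 0) (at_left 0)"
      by (rule Lim_transform_eventually[OF tendsto_const])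
         (auto simp: flat_def eventually_at_left_field intro!: exI[of _ "-1"])
    ultimately have "((\<lambda>h. flat n h / h) \<longlongrightarrow> 0) (at 0)"
      by (simp add: filterlim_split_at)
    then show ?thesis using 2 by (simp add: DERIV_def flat_def)
  qed
qed

lemma Ck_on_flat_coordinate: "Ck_on k UNIV (\<lambda>x::real^'n. flat n (c + s * x $ i))"
proof (induction k arbitrary: n)
  case 0
  have "continuous_on UNIV (flat n)"
    using has_real_derivative_flat DERIV_isCont by (blast intro: continuous_at_imp_continuous_on)
  then show ?case
    by (auto intro!: continuous_on_compose2[of UNIV "flat n"] continuous_intros)
next
  case (Suc k)
  define d where "d n t = flat (n+2) t - real n * flat (Suc n) t" for n t
  show ?case
  proof (rule Ck_on_SucI)
    fix x :: "real^'n"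
    have "((\<lambda>x::real^'n. c + s * x $ i) has_derivative (\<lambda>v. s * v $ i)) (at x)"
      by (auto intro!: derivative_eq_intros bounded_linear_imp_has_derivative bounded_linear_vec_nth)
    from has_derivative_compose[OF this has_real_derivative_flat[unfolded has_field_derivative_def]]
    show "((\<lambda>x::real^'n. flat n (c + s * x $ i)) has_derivative
        (\<lambda>v. d n (c + s * x $ i) * (s * v $ i))) (at x)" by (simp add: d_def)
  next
    fix j
    have "Ck_on k UNIV (\<lambda>x::real^'n. (flat (n+2) (c + s * x $ i) +
        (- real n) * flat (Suc n) (c + s * x $ i)) * (s * axis j 1 $ i))"
      by (intro Ck_on_mult Ck_on_add Ck_on_const Suc.IH open_UNIV)
    then show "Ck_on k UNIV (\<lambda>x::real^'n. d n (c + s * x $ i) * (s * axis j 1 $ i))"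
      by (simp add: d_def algebra_simps)
  qed simp
qed

text \<open>The kernel is a product of bumps in the coordinates. Their width is \<open>d\<close> divided by the dimension, which
  puts the support into the ball of radius \<open>d\<close>.\<close>

lemma mollifier_kernel:
  fixes d :: real
  assumes "d > 0"
  obtains \<eta> :: "real^'n \<Rightarrow> real" where "\<And>k. Ck_on k UNIV \<eta>" "\<And>x. \<eta> x \<ge> 0"
    "\<And>x. norm x \<ge> d \<Longrightarrow> \<eta> x = 0" "(\<eta> has_integral 1) (cbox (vec (-d)) (vec d))"
proof -
  define e where "e = d / real CARD('n)"
  have "e > 0" using assms by (simp add: e_def)
  define \<beta> :: "real^'n \<Rightarrow> real"
    where "\<beta> x = (\<Prod>i\<in>UNIV. flat 0 (e + 1 * x $ i) * flat 0 (e + (-1) * x $ i))" for x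
  define B :: "(real^'n) set" where "B = cbox (vec (-d)) (vec d)"
  have smooth: "Ck_on k UNIV \<beta>" for k
    unfolding \<beta>_def by (intro Ck_on_prod Ck_on_mult Ck_on_flat_coordinate open_UNIV)
  have nonneg: "\<beta> x \<ge> 0" for x
    unfolding \<beta>_def by (intro prod_nonneg mult_nonneg_nonneg ballI) (auto simp: flat_def)
  have zero: "\<beta> x = 0" if "norm x \<ge> d" for x
  proof (rule ccontr)
    assume "\<beta> x \<noteq> 0"
    then have "flat 0 (e + x $ i) \<noteq> 0 \<and> flat 0 (e - x $ i) \<noteq> 0" for i
      by (simp add: \<beta>_def)
    then have "0 < e + x $ i \<and> 0 < e - x $ i" for i
      unfolding flat_def by (metis not_le)
    then have "\<bar>x $ i\<bar> < e" for i by (smt (verit))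
    then have "(\<Sum>i\<in>UNIV. \<bar>x $ i\<bar>) < (\<Sum>i\<in>(UNIV::'n set). e)"
      by (intro sum_strict_mono) auto
    then show False using norm_le_l1_cart[of x] that by (simp add: e_def)
  qed
  have cont: "continuous_on B \<beta>"
    using Ck_on_continuous[OF smooth[of 0]] continuous_on_subset by blast
  then have int: "\<beta> integrable_on B" unfolding B_def by (rule integrable_continuous)
  have pos: "integral B \<beta> > 0"
  proof (rule ccontr)
    assume "\<not> ?thesis"
    then have "integral B \<beta> = 0" using integral_nonneg[OF int] nonneg by force
    then have hi: "(\<beta> has_integral 0) (cbox (vec (-d)) (vec d))"
      using int by (simp add: has_integral_iff B_def)
    have z: "(0::real^'n) \<in> cbox (vec (-d)) (vec d)" using assms by (simp add: mem_box_cart)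
    have ne: "box (vec (-d)) (vec d) \<noteq> ({}::(real^'n) set)"
      using assms by (auto simp: mem_box_cart ex_in_conv[symmetric] intro!: exI[of _ 0])
    have "\<beta> 0 = 0"
      by (rule has_integral_0_cbox_imp_0[OF _ _ hi _ z]) (use cont nonneg ne in \<open>auto simp: B_def\<close>)
    then show False using \<open>e > 0\<close> by (simp add: \<beta>_def flat_def)
  qed
  define \<eta> where "\<eta> x = inverse (integral B \<beta>) * \<beta> x" for x
  have "(\<eta> has_integral (inverse (integral B \<beta>) * integral B \<beta>)) B"
    unfolding \<eta>_def using int by (intro has_integral_mult_right) (simp add: has_integral_integral)
  then have one: "(\<eta> has_integral 1) B" using pos by simp
  show ?thesis
  proof (rule that[of \<eta>])
    show "Ck_on k UNIV \<eta>" for k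
      unfolding \<eta>_def by (intro Ck_on_mult Ck_on_const smooth open_UNIV)
    show "\<eta> x \<ge> 0" for x unfolding \<eta>_def using nonneg[of x] pos by simp
    show "\<eta> x = 0" if "norm x \<ge> d" for x unfolding \<eta>_def using zero[OF that] by simp
    show "(\<eta> has_integral 1) (cbox (vec (-d)) (vec d))" using one unfolding B_def .
  qed
qed

lemma convolution_has_derivative:
  fixes w K :: "real^'n \<Rightarrow> real"
  assumes w: "continuous_on (cbox a b) w" and K: "Ck_on (Suc 0) UNIV K"
  shows "((\<lambda>y. integral (cbox a b) (\<lambda>z. w z * K (y - z))) has_derivative
     (\<lambda>v. integral (cbox a b) (\<lambda>z. w z * frechet_derivative K (at (y - z)) v))) (at y)"
proof -
  define DK where "DK x = frechet_derivative K (at x)" for x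
  have D: "(K has_derivative DK x) (at x)" for x
    unfolding DK_def by (rule Ck_on_has_derivative[OF K]) simp
  have bl: "bounded_linear (DK x)" for x using D has_derivative_bounded_linear by blast
  have contK: "continuous_on UNIV K" using Ck_on_continuous[OF K] by simp
  have contD: "continuous_on UNIV (\<lambda>x. DK x v)" for v
  proof -
    have "continuous_on UNIV (\<lambda>x. \<Sum>j\<in>UNIV. v $ j *\<^sub>R DK x (axis j 1))"
      using K by (intro continuous_intros) (simp add: DK_def)
    moreover have "DK x v = (\<Sum>j\<in>UNIV. v $ j *\<^sub>R DK x (axis j 1))" for x
      by (rule linear_axis_sum) (use bl bounded_linear.linear in blast)
    ultimately show ?thesis by presburger
  qed
  define fx where "fx y z = w z *\<^sub>R Blinfun (DK (y - z))" for y z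
  have fx: "blinfun_apply (fx y z) v = w z * DK (y - z) v" for y z v
    by (simp add: fx_def scaleR_blinfun.rep_eq bounded_linear_Blinfun_apply[OF bl])
  have cfx: "continuous_on (UNIV \<times> cbox a b) (\<lambda>(y, z). fx y z)"
  proof (rule continuous_on_blinfun_componentwise)
    fix i :: "real^'n"
    show "continuous_on (UNIV \<times> cbox a b) (\<lambda>x. blinfun_apply (case x of (y, z) \<Rightarrow> fx y z) i)"
      unfolding split_def fx
      by (intro continuous_intros continuous_on_compose2[OF w] continuous_on_compose2[OF contD]) auto
  qed
  have "((\<lambda>y. integral (cbox a b) (\<lambda>z. w z * K (y - z))) has_derivative
      blinfun_apply (integral (cbox a b) (fx y))) (at y within UNIV)"
  proof (rule leibniz_rule[OF _ _ cfx])
    fix y z :: "real^'n"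
    have "((\<lambda>y. y - z) has_derivative (\<lambda>v. v)) (at y)" by (auto intro!: derivative_eq_intros)
    from has_derivative_compose[of "\<lambda>y. y - z", OF this D]
    have "((\<lambda>y. w z * K (y - z)) has_derivative (\<lambda>v. w z * DK (y - z) v)) (at y)"
      by (rule has_derivative_mult_right)
    then show "((\<lambda>y. w z * K (y - z)) has_derivative blinfun_apply (fx y z)) (at y within UNIV)"
      using fx by presburger
  next
    fix y
    show "(\<lambda>z. w z * K (y - z)) integrable_on cbox a b"
      by (intro integrable_continuous continuous_intros w continuous_on_compose2[OF contK]) auto
  qed auto
  moreover have "blinfun_apply (integral (cbox a b) (fx y)) =
      (\<lambda>v. integral (cbox a b) (\<lambda>z. w z * DK (y - z) v))"
  proof
    fix v
    have "continuous_on (cbox a b) (fx y)"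
      using continuous_on_compose2[OF cfx, of "cbox a b" "\<lambda>z. (y, z)"]
      by (simp add: continuous_on_Pair image_subset_iff)
    then have "fx y integrable_on cbox a b" by (rule integrable_continuous)
    from blinfun_apply_integral[OF this, of v]
    show "blinfun_apply (integral (cbox a b) (fx y)) v = integral (cbox a b) (\<lambda>z. w z * DK (y - z) v)"
      by (simp add: fx)
  qed
  ultimately show ?thesis by (simp add: DK_def)
qed

lemma Ck_on_convolution:
  fixes w K :: "real^'n \<Rightarrow> real"
  assumes w: "continuous_on (cbox a b) w" and K: "\<And>k. Ck_on k UNIV K"
  shows "Ck_on k UNIV (\<lambda>y. integral (cbox a b) (\<lambda>z. w z * K (y - z)))"
  using K
proof (induction k arbitrary: K)
  case 0
  show ?case
    using convolution_has_derivative[OF w 0[of "Suc 0"]]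
    by (auto intro!: continuous_at_imp_continuous_on has_derivative_continuous)
next
  case (Suc k)
  show ?case
  proof (rule Ck_on_SucI[OF open_UNIV convolution_has_derivative[OF w Suc.prems]])
    fix i
    show "Ck_on k UNIV (\<lambda>y. integral (cbox a b) (\<lambda>z. w z * partial i K (y - z)))"
      by (rule Suc.IH) (use Suc.prems[of "Suc _"] in simp)
  qed
qed

lemma convolution_commute:
  fixes f h :: "real^'n \<Rightarrow> real"
  assumes f: "continuous_on UNIV f" "\<And>x. x \<notin> cbox a b \<Longrightarrow> f x = 0"
    and h: "continuous_on UNIV h" "\<And>x. x \<notin> cbox c d \<Longrightarrow> h x = 0"
  shows "integral (cbox a b) (\<lambda>z. f z * h (y - z)) = integral (cbox c d) (\<lambda>z. h z * f (y - z))"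
proof -
  define g where "g z = f z * h (y - z)" for z
  have cg: "continuous_on S g" for S
    unfolding g_def by (intro continuous_intros continuous_on_compose2[OF f(1)]
        continuous_on_compose2[OF h(1)]) auto
  have "(g has_integral (integral (cbox a b) g)) (cbox a b)"
    by (intro integrable_integral integrable_continuous cg)
  from has_integral_affinity[OF this, of "-1" y]
  have 1: "((\<lambda>z. g (y - z)) has_integral integral (cbox a b) g) ((\<lambda>z. y - z) ` cbox a b)"
    by simp
  have A: "((\<lambda>z. g (y - z)) has_integral integral (cbox a b) g) UNIV"
  proof (rule has_integral_on_superset[OF 1])
    fix z assume "z \<notin> (\<lambda>z. y - z) ` cbox a b"
    then have "y - z \<notin> cbox a b" by (metis diff_diff_eq2 add_diff_cancel_left' image_eqI)
    then show "g (y - z) = 0" using f(2) by (simp add: g_def)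
  qed simp
  have 2: "((\<lambda>z. g (y - z)) has_integral integral (cbox c d) (\<lambda>z. g (y - z))) (cbox c d)"
    by (intro integrable_integral integrable_continuous continuous_on_compose2[OF cg]
        continuous_intros) auto
  have B: "((\<lambda>z. g (y - z)) has_integral integral (cbox c d) (\<lambda>z. g (y - z))) UNIV"
    by (rule has_integral_on_superset[OF 2]) (use h(2) in \<open>auto simp: g_def\<close>)
  have "integral (cbox a b) g = integral (cbox c d) (\<lambda>z. g (y - z))"
    using has_integral_unique[OF A B] .
  also have "(\<lambda>z. g (y - z)) = (\<lambda>z. h z * f (y - z))" by (auto simp: g_def)
  finally show ?thesis by (simp add: g_def)
qed

lemma kernel_average_bound:
  fixes \<eta> h :: "real^'n \<Rightarrow> real"
  assumes "continuous_on UNIV \<eta>" "\<And>x. \<eta> x \<ge> 0" "\<And>x. norm x \<ge> d \<Longrightarrow> \<eta> x = 0"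
    "(\<eta> has_integral 1) (cbox a b)" and h: "continuous_on UNIV h"
    and *: "\<And>z. norm z < d \<Longrightarrow> \<bar>h z - c\<bar> \<le> e"
  shows "\<bar>integral (cbox a b) (\<lambda>z. \<eta> z * h z) - c\<bar> \<le> e"
proof -
  have c: "continuous_on S \<eta>" "continuous_on S h" for S
    using assms(1) h continuous_on_subset by blast+
  have i1: "(\<lambda>z. \<eta> z * h z) integrable_on cbox a b" "(\<lambda>z. \<eta> z * (h z - c)) integrable_on cbox a b"
    by (intro integrable_continuous continuous_intros c)+
  have "((\<lambda>z. \<eta> z * h z - \<eta> z * c) has_integral (integral (cbox a b) (\<lambda>z. \<eta> z * h z) - 1 * c)) (cbox a b)"
    by (intro has_integral_diff integrable_integral i1 has_integral_mult_left assms(4))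
  then have eq: "integral (cbox a b) (\<lambda>z. \<eta> z * h z) - c = integral (cbox a b) (\<lambda>z. \<eta> z * (h z - c))"
    by (simp add: algebra_simps integral_unique)
  have "norm (integral (cbox a b) (\<lambda>z. \<eta> z * (h z - c))) \<le> integral (cbox a b) (\<lambda>z. \<eta> z * e)"
  proof (rule integral_norm_bound_integral[OF i1(2)])
    show "(\<lambda>z. \<eta> z * e) integrable_on cbox a b" by (intro integrable_continuous continuous_intros c)
    fix z
    show "norm (\<eta> z * (h z - c)) \<le> \<eta> z * e"
      using *[of z] assms(2,3)[of z]
      by (cases "norm z < d") (auto simp: abs_mult intro!: mult_left_mono)
  qed
  also have "\<dots> = e" using integral_unique[OF has_integral_mult_left[OF assms(4), of e]] by simp
  finally show ?thesis by (simp add: eq)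
qed

text \<open>A mollification is a local average. Everything needed about it follows from the principle
  that whatever holds for all translates of \<open>f\<close> by less than \<open>d\<close> holds for the average.\<close>

lemma mollification:
  fixes f :: "real^'n \<Rightarrow> real"
  assumes f: "continuous_on UNIV f" and supp: "\<And>x. x \<notin> cbox a b \<Longrightarrow> f x = 0" and "d > 0"
  obtains m where "\<And>k. Ck_on k UNIV m"
    and "\<And>y c e. \<forall>z. norm z < d \<longrightarrow> \<bar>f (y - z) - c\<bar> \<le> e \<Longrightarrow> \<bar>m y - c\<bar> \<le> e"
    and "\<And>y y' e. \<forall>z. norm z < d \<longrightarrow> \<bar>f (y' - z) - f (y - z)\<bar> \<le> e \<Longrightarrow> \<bar>m y' - m y\<bar> \<le> e"
    and "\<And>x. \<forall>x. f x \<ge> 0 \<Longrightarrow> m x \<ge> 0"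
    and "\<And>i y c e. Ck_on (Suc 0) UNIV f \<Longrightarrow>
           \<forall>z. norm z < d \<longrightarrow> \<bar>partial i f (y - z) - c\<bar> \<le> e \<Longrightarrow> \<bar>partial i m y - c\<bar> \<le> e"
proof -
  obtain \<eta> :: "real^'n \<Rightarrow> real" where \<eta>: "\<And>k. Ck_on k UNIV \<eta>" "\<And>x. \<eta> x \<ge> 0"
    "\<And>x. norm x \<ge> d \<Longrightarrow> \<eta> x = 0" "(\<eta> has_integral 1) (cbox (vec (-d)) (vec d))"
    using mollifier_kernel[OF \<open>d > 0\<close>] by metis
  have c\<eta>: "continuous_on UNIV \<eta>" using \<eta>(1)[of 0] by simp
  define B :: "(real^'n) set" where "B = cbox (vec (-d)) (vec d)"
  define m where "m y = integral B (\<lambda>z. \<eta> z * f (y - z))" for y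
  have \<eta>0: "\<eta> x = 0" if x: "x \<notin> B" for x
  proof (rule \<eta>(3), rule ccontr)
    assume "\<not> d \<le> norm x"
    then have "\<bar>x $ i\<bar> \<le> d" for i using component_le_norm_cart[of x i] by linarith
    then have "x \<in> B" unfolding B_def mem_box_cart by (simp add: abs_le_iff minus_le_iff)
    then show False using x by simp
  qed
  have m_eq: "m y = integral (cbox a b) (\<lambda>z. f z * \<eta> (y - z))" for y
    unfolding m_def B_def
    by (rule convolution_commute[symmetric, OF f supp c\<eta>]) (use \<eta>0 in \<open>auto simp: B_def\<close>)
  have m1: "Ck_on k UNIV m" for k
    unfolding m_eq by (rule Ck_on_convolution[OF continuous_on_subset[OF f] \<eta>(1)]) simp
  have tr: "continuous_on UNIV (\<lambda>z. f (y - z))" for y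
    by (intro continuous_on_compose2[OF f] continuous_intros) auto
  have m2: "\<bar>m y - c\<bar> \<le> e" if "\<forall>z. norm z < d \<longrightarrow> \<bar>f (y - z) - c\<bar> \<le> e" for y c e
    unfolding m_def B_def by (rule kernel_average_bound[OF c\<eta> \<eta>(2,3,4) tr]) (use that in auto)
  have m3: "\<bar>m y' - m y\<bar> \<le> e"
    if "\<forall>z. norm z < d \<longrightarrow> \<bar>f (y' - z) - f (y - z)\<bar> \<le> e" for y y' e
  proof -
    have i: "(\<lambda>z. \<eta> z * f (y - z)) integrable_on B" for y
      unfolding B_def
      by (intro integrable_continuous continuous_intros continuous_on_subset[OF c\<eta>]
          continuous_on_subset[OF tr]) auto
    have "m y' - m y = integral B (\<lambda>z. \<eta> z * (f (y' - z) - f (y - z)))"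
      unfolding m_def by (subst integral_diff[symmetric, OF i i]) (simp add: algebra_simps)
    moreover have "\<bar>integral B (\<lambda>z. \<eta> z * (f (y' - z) - f (y - z))) - 0\<bar> \<le> e"
      unfolding B_def by (rule kernel_average_bound[OF c\<eta> \<eta>(2,3,4)])
        (use that in \<open>auto intro!: continuous_intros tr\<close>)
    ultimately show ?thesis by simp
  qed
  have m4: "m x \<ge> 0" if "\<forall>x. f x \<ge> 0" for x
    unfolding m_def B_def
    by (intro integral_nonneg integrable_continuous continuous_intros continuous_on_subset[OF c\<eta>]
          continuous_on_subset[OF tr]) (auto intro!: mult_nonneg_nonneg \<eta>(2) that[rule_format])
  have m5: "\<bar>partial i m y - c\<bar> \<le> e" if C: "Ck_on (Suc 0) UNIV f"
    and *: "\<forall>z. norm z < d \<longrightarrow> \<bar>partial i f (y - z) - c\<bar> \<le> e" for i y c e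
  proof -
    have "(m has_derivative
      (\<lambda>v. integral B (\<lambda>z. \<eta> z * frechet_derivative f (at (y - z)) v))) (at y)"
      unfolding m_def B_def
      by (rule convolution_has_derivative[OF continuous_on_subset[OF c\<eta>] C]) simp
    from frechet_derivative_at[OF this, symmetric]
    have "partial i m y = integral B (\<lambda>z. \<eta> z * partial i f (y - z))" by simp
    moreover have ct: "continuous_on UNIV (\<lambda>z. partial i f (y - z))"
      by (rule continuous_on_compose2[of UNIV "partial i f"]) (use C in \<open>auto intro: continuous_intros\<close>)
    have "\<bar>integral (cbox (vec (- d)) (vec d)) (\<lambda>z. \<eta> z * partial i f (y - z)) - c\<bar> \<le> e"
      by (rule kernel_average_bound[OF c\<eta> \<eta>(2,3,4) ct *[rule_format]])
    ultimately show ?thesis by (simp only: B_def)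
  qed
  show ?thesis by (rule that[OF m1 m2 m3 m4 m5])
qed


section \<open>Real cutoff functions\<close>

text \<open>Unlike the positive part itself, its square is \<open>C1\<close>.\<close>

definition pos2 :: "real \<Rightarrow> real" where "pos2 t = (max 0 t)\<^sup>2"

lemma has_real_derivative_pos2: "(pos2 has_real_derivative 2 * max 0 t) (at t)"
proof -
  consider "t < 0" | "t = 0" | "t > 0" by linarith
  then show ?thesis
  proof cases
    case 1
    have "((\<lambda>t. 0) has_real_derivative 0) (at t)" by simp
    then have "(pos2 has_real_derivative 0) (at t)"
      by (rule has_field_derivative_transform_within_open[where S = "{..<0}"])
         (use 1 in \<open>auto simp: pos2_def max_def\<close>)
    then show ?thesis using 1 by simp
  next
    case 3
    have "((\<lambda>t. t\<^sup>2) has_real_derivative 2 * t) (at t)" by (auto intro!: derivative_eq_intros)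
    then have "(pos2 has_real_derivative 2 * t) (at t)"
      by (rule has_field_derivative_transform_within_open[where S = "{0<..}"])
         (use 3 in \<open>auto simp: pos2_def max_def\<close>)
    then show ?thesis using 3 by simp
  next
    case 2
    have "(pos2 has_real_derivative 0) (at 0)"
      unfolding DERIV_def
    proof (rule Lim_null_comparison)
      show "\<forall>\<^sub>F h in at 0. norm ((pos2 (0 + h) - pos2 0) / h) \<le> \<bar>h\<bar>"
        by (rule always_eventually)
           (auto simp: pos2_def max_def power2_eq_square divide_simps)
      show "((\<lambda>h. \<bar>h\<bar>) \<longlongrightarrow> 0) (at (0::real))" by (auto intro!: tendsto_eq_intros)
    qed
    then show ?thesis using 2 by simp
  qed
qed

lemma pos2_nonneg: "pos2 t \<ge> 0" by (simp add: pos2_def)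

lemma pos2_pos_iff: "pos2 t > 0 \<longleftrightarrow> t > 0"
  by (auto simp: pos2_def max_def)

lemma pos2_eq_0: "t \<le> 0 \<Longrightarrow> pos2 t = 0" by (simp add: pos2_def max_def)

text \<open>The step from one to zero on \<open>[a, b]\<close> is \<open>C1\<close> because both occurrences of \<open>pos2\<close> are.\<close>

definition cutoff :: "real \<Rightarrow> real \<Rightarrow> real \<Rightarrow> real" where
  "cutoff a b s = pos2 (1 - pos2 (s - a) / (b - a)\<^sup>2)"

definition cutoff' :: "real \<Rightarrow> real \<Rightarrow> real \<Rightarrow> real" where
  "cutoff' a b s =
     2 * max 0 (1 - pos2 (s - a) / (b - a)\<^sup>2) * (- (2 * max 0 (s - a) / (b - a)\<^sup>2))"

lemma has_real_derivative_cutoff: "(cutoff a b has_real_derivative cutoff' a b s) (at s)"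
proof -
  have 1: "((\<lambda>s. pos2 (s - a)) has_real_derivative 2 * max 0 (s - a)) (at s)"
    using DERIV_chain2[OF has_real_derivative_pos2 DERIV_diff[OF DERIV_ident DERIV_const]] by simp
  have "((\<lambda>s. 1 - pos2 (s - a) / (b - a)\<^sup>2) has_real_derivative
      - (2 * max 0 (s - a) / (b - a)\<^sup>2)) (at s)"
    using DERIV_diff[OF DERIV_const DERIV_cdivide[OF 1], of 1 "(b - a)\<^sup>2"] by simp
  from DERIV_chain2[OF has_real_derivative_pos2 this]
  show ?thesis unfolding cutoff_def[abs_def] cutoff'_def .
qed

lemma continuous_on_pos2 [continuous_intros]:
  "continuous_on S f \<Longrightarrow> continuous_on S (\<lambda>x. pos2 (f x))"
  unfolding pos2_def by (intro continuous_intros)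

lemma continuous_on_cutoff': "a < b \<Longrightarrow> continuous_on UNIV (cutoff' a b)"
  unfolding cutoff'_def[abs_def] by (intro continuous_intros) auto

lemma cutoff_le: "s \<le> a \<Longrightarrow> cutoff a b s = 1"
  by (simp add: cutoff_def pos2_def max_def)

lemma cutoff_ge: "a < b \<Longrightarrow> b \<le> s \<Longrightarrow> cutoff a b s = 0"
  unfolding cutoff_def
  by (rule pos2_eq_0) (auto simp: pos2_def max_def divide_simps intro!: power_mono)

lemma cutoff_bounds: "0 \<le> cutoff a b s" "cutoff a b s \<le> 1"
proof -
  have "max 0 (1 - pos2 (s - a) / (b - a)\<^sup>2) \<le> 1" by (simp add: pos2_nonneg)
  then have "(max 0 (1 - pos2 (s - a) / (b - a)\<^sup>2))\<^sup>2 \<le> 1"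
    using power_mono[of _ 1 2] by fastforce
  then show "cutoff a b s \<le> 1" by (simp add: cutoff_def pos2_def)
qed (simp add: cutoff_def pos2_nonneg)

lemma cutoff'_bound:
  assumes "a < b" shows "\<bar>cutoff' a b s\<bar> \<le> 4 / (b - a)"
proof (cases "a < s \<and> s < b")
  case True
  have nn: "0 \<le> 1 - pos2 (s - a) / (b - a)\<^sup>2"
    using True by (auto simp: pos2_def divide_simps intro!: power_mono)
  have "1 - pos2 (s - a) / (b - a)\<^sup>2 \<le> 1" by (simp add: pos2_nonneg)
  moreover have "2 * (s - a) / (b - a)\<^sup>2 \<le> 2 * (b - a) / (b - a)\<^sup>2"
    using True by (intro divide_right_mono) auto
  moreover have "2 * (b - a) / (b - a)\<^sup>2 = 2 / (b - a)" using assms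
    by (simp add: power2_eq_square divide_simps)
  ultimately have "2 * (1 - pos2 (s - a) / (b - a)\<^sup>2) * (2 * (s - a) / (b - a)\<^sup>2) \<le> 2 * 1 * (2 / (b - a))"
    using True nn by (intro mult_mono) auto
  moreover have "cutoff' a b s = - (2 * (1 - pos2 (s - a) / (b - a)\<^sup>2) * (2 * (s - a) / (b - a)\<^sup>2))"
    using True nn by (simp add: cutoff'_def max_def)
  moreover have "0 \<le> 2 * (1 - pos2 (s - a) / (b - a)\<^sup>2) * (2 * (s - a) / (b - a)\<^sup>2)"
    using True nn by (intro mult_nonneg_nonneg) auto
  ultimately show ?thesis by simp
next
  case False
  then have "cutoff' a b s = 0"
  proof (cases "s \<le> a")
    case False
    then have "s \<ge> b" using \<open>\<not> (a < s \<and> s < b)\<close> by auto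
    then have "1 - pos2 (s - a) / (b - a)\<^sup>2 \<le> 0"
      using assms by (auto simp: pos2_def max_def divide_simps intro!: power_mono)
    then show ?thesis by (simp add: cutoff'_def)
  qed (simp add: cutoff'_def)
  then show ?thesis using assms by simp
qed


section \<open>Smooth manifolds\<close>

definition chart_deriv :: "('a, 'n::finite) chart \<Rightarrow> ('a \<Rightarrow> real) \<Rightarrow> 'a \<Rightarrow> real^'n \<Rightarrow> real" where
  "chart_deriv c u p = frechet_derivative (u \<circ> inv_chart c) (at (snd c p))"

text \<open>A function on coordinate space that is supported in the image of a chart, transplanted to the
  manifold.\<close>

definition pull :: "('a, 'n::finite) chart \<Rightarrow> (real^'n \<Rightarrow> real) \<Rightarrow> 'a \<Rightarrow> real" where
  "pull c F p = (if p \<in> fst c then F (snd c p) else 0)"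

context smooth_manifold begin

abbreviation C1 :: "('a \<Rightarrow> real) \<Rightarrow> bool" where "C1 \<equiv> Ck_function (Suc 0) charts"

lemma open_chart: "c \<in> charts \<Longrightarrow> open (fst c)" "c \<in> charts \<Longrightarrow> open (chart_image c)"
  using chart_open by auto

lemma inv_chart_chart: "c \<in> charts \<Longrightarrow> p \<in> fst c \<Longrightarrow> inv_chart c (snd c p) = p"
  using homeomorphism_apply1[OF chart_homeomorphism] .

lemma chart_inv_chart: "c \<in> charts \<Longrightarrow> y \<in> chart_image c \<Longrightarrow> snd c (inv_chart c y) = y"
  using homeomorphism_apply2[OF chart_homeomorphism] .

lemma inv_chart_in: "c \<in> charts \<Longrightarrow> y \<in> chart_image c \<Longrightarrow> inv_chart c y \<in> fst c"
  using homeomorphism_image2[OF chart_homeomorphism] by blast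

lemma chart_in: "p \<in> fst c \<Longrightarrow> snd c p \<in> chart_image c"
  by (simp add: chart_image_def)

lemma continuous_chart: "c \<in> charts \<Longrightarrow> continuous_on (fst c) (snd c)"
  "c \<in> charts \<Longrightarrow> continuous_on (chart_image c) (inv_chart c)"
  using chart_homeomorphism homeomorphism_def by blast+

lemma chart_image_eq:
  assumes "c \<in> charts" "U \<subseteq> fst c"
  shows "snd c ` U = {y \<in> chart_image c. inv_chart c y \<in> U}"
proof (intro equalityI subsetI)
  fix y assume "y \<in> snd c ` U"
  then obtain p where "p \<in> U" "y = snd c p" by blast
  then show "y \<in> {y \<in> chart_image c. inv_chart c y \<in> U}"
    using assms by (auto simp: inv_chart_chart chart_in subset_iff)
next
  fix y assume "y \<in> {y \<in> chart_image c. inv_chart c y \<in> U}"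
  then show "y \<in> snd c ` U" using chart_inv_chart[OF assms(1), of y] by (auto intro: rev_image_eqI)
qed

lemma open_chart_image:
  assumes "c \<in> charts" "open U"
  shows "open {y \<in> chart_image c. inv_chart c y \<in> U}"
proof -
  have "open (inv_chart c -` U \<inter> chart_image c)"
    using continuous_chart(2)[OF assms(1)] open_chart(2)[OF assms(1)] assms(2)
    by (simp add: continuous_on_open_vimage)
  then show ?thesis by (simp add: vimage_def Collect_conj_eq Int_commute)
qed

lemma open_inv_chart_image:
  assumes "c \<in> charts" "open V" "V \<subseteq> chart_image c"
  shows "open (inv_chart c ` V)"
proof -
  have "inv_chart c ` V = snd c -` V \<inter> fst c"
  proof (intro equalityI subsetI)
    fix p assume "p \<in> inv_chart c ` V"
    then show "p \<in> snd c -` V \<inter> fst c"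
      using assms(3) by (auto simp: chart_inv_chart[OF assms(1)] inv_chart_in[OF assms(1)] subset_iff)
  next
    fix p assume "p \<in> snd c -` V \<inter> fst c"
    then show "p \<in> inv_chart c ` V"
      using inv_chart_chart[OF assms(1), of p] by (auto intro: rev_image_eqI)
  qed
  then show ?thesis
    using continuous_chart(1)[OF assms(1)] open_chart(1)[OF assms(1)] assms(2)
    by (simp add: continuous_on_open_vimage)
qed

lemma chart_at_in: "chart_at charts p \<in> charts" "p \<in> fst (chart_at charts p)"
proof -
  have "\<exists>c. c \<in> charts \<and> p \<in> fst c" using charts_cover by blast
  from someI_ex[OF this] show "chart_at charts p \<in> charts" "p \<in> fst (chart_at charts p)"
    unfolding chart_at_def by auto
qed

lemma Ck_function_const: "Ck_function k charts (\<lambda>p. a)"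
  by (simp add: Ck_function_def comp_def Ck_on_const)

lemma Ck_function_add:
  "Ck_function k charts u \<Longrightarrow> Ck_function k charts v \<Longrightarrow> Ck_function k charts (\<lambda>p. u p + v p)"
  unfolding Ck_function_def comp_def by (auto intro: Ck_on_add open_chart)

lemma Ck_function_mult:
  "Ck_function k charts u \<Longrightarrow> Ck_function k charts v \<Longrightarrow> Ck_function k charts (\<lambda>p. u p * v p)"
  unfolding Ck_function_def comp_def by (auto intro: Ck_on_mult open_chart)

lemma Ck_function_diff:
  assumes "Ck_function k charts u" "Ck_function k charts v"
  shows "Ck_function k charts (\<lambda>p. u p - v p)"
  using Ck_function_add[OF assms(1) Ck_function_mult[OF Ck_function_const[of k "-1"] assms(2)]] by simp

lemma Ck_function_power: "Ck_function k charts u \<Longrightarrow> Ck_function k charts (\<lambda>p. u p ^ n)"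
  by (induction n) (auto intro: Ck_function_const Ck_function_mult)

lemma C1_compose:
  assumes "C1 u" "\<And>t. (h has_real_derivative h' t) (at t)" "continuous_on UNIV h'"
  shows "C1 (\<lambda>p. h (u p))"
  using assms(1) C1_on_real_compose[OF open_chart(2) _ assms(2,3)]
  unfolding Ck_function_def comp_def by simp

lemma Ck_function_continuous:
  assumes "Ck_function k charts u" shows "continuous_on UNIV u"
proof -
  have "continuous_on (fst c) u" if c: "c \<in> charts" for c
  proof -
    have "continuous_on (chart_image c) (u \<circ> inv_chart c)"
      using assms c Ck_on_continuous open_chart unfolding Ck_function_def by blast
    then have "continuous_on (snd c ` fst c) (u \<circ> inv_chart c)" by (simp only: chart_image_def)
    then have "continuous_on (fst c) ((u \<circ> inv_chart c) \<circ> snd c)"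
      by (rule continuous_on_compose[OF continuous_chart(1)[OF c]])
    then show ?thesis by (rule continuous_on_eq) (simp add: inv_chart_chart c)
  qed
  then have "continuous_on (\<Union>c\<in>charts. fst c) u"
    by (intro continuous_on_open_UN) (auto simp: open_chart)
  then show ?thesis by (simp add: charts_cover)
qed

lemma C1_chart_deriv:
  assumes "C1 u" "c \<in> charts" "p \<in> fst c"
  shows "((u \<circ> inv_chart c) has_derivative chart_deriv c u p) (at (snd c p))"
  using assms unfolding chart_deriv_def Ck_function_def
  by (intro Ck_on_has_derivative[of 0 "chart_image c"]) (auto simp: chart_in)

lemma chart_derivI:
  assumes "((u \<circ> inv_chart c) has_derivative L) (at (snd c p))"
  shows "chart_deriv c u p = L"
  using frechet_derivative_at[OF assms] by (simp add: chart_deriv_def)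

lemma chart_deriv_linear:
  assumes "C1 u" "c \<in> charts" "p \<in> fst c" shows "linear (chart_deriv c u p)"
  using has_derivative_linear[OF C1_chart_deriv[OF assms]] .

lemma chart_deriv_const: "chart_deriv c (\<lambda>p. a) p v = 0"
  by (simp add: chart_deriv_def comp_def)

lemma chart_deriv_add:
  assumes "C1 u" "C1 v" "c \<in> charts" "p \<in> fst c"
  shows "chart_deriv c (\<lambda>p. u p + v p) p w = chart_deriv c u p w + chart_deriv c v p w"
  by (subst chart_derivI[where L = "\<lambda>w. chart_deriv c u p w + chart_deriv c v p w"])
     (use has_derivative_add[OF C1_chart_deriv C1_chart_deriv] assms in \<open>auto simp: comp_def\<close>)

lemma chart_deriv_mult:
  assumes "C1 u" "C1 v" "c \<in> charts" "p \<in> fst c"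
  shows "chart_deriv c (\<lambda>p. u p * v p) p w = u p * chart_deriv c v p w + v p * chart_deriv c u p w"
proof -
  have "((\<lambda>x. (u \<circ> inv_chart c) x * (v \<circ> inv_chart c) x) has_derivative
     (\<lambda>w. (u \<circ> inv_chart c) (snd c p) * chart_deriv c v p w + chart_deriv c u p w * (v \<circ> inv_chart c) (snd c p)))
     (at (snd c p))"
    by (intro has_derivative_mult C1_chart_deriv assms)
  then have "(((\<lambda>p. u p * v p) \<circ> inv_chart c) has_derivative
     (\<lambda>w. u p * chart_deriv c v p w + v p * chart_deriv c u p w)) (at (snd c p))"
    using assms by (simp add: comp_def inv_chart_chart mult.commute)
  from chart_derivI[OF this] show ?thesis by simp
qed

lemma chart_deriv_compose:
  assumes "C1 u" "(h has_real_derivative d) (at (u p))" "c \<in> charts" "p \<in> fst c"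
  shows "chart_deriv c (\<lambda>p. h (u p)) p w = d * chart_deriv c u p w"
proof -
  have "((\<lambda>x. h ((u \<circ> inv_chart c) x)) has_derivative (\<lambda>w. d * chart_deriv c u p w)) (at (snd c p))"
    using has_derivative_compose[OF C1_chart_deriv[OF assms(1,3,4)], of h "(*) d"] assms
    by (simp add: has_field_derivative_def inv_chart_chart)
  then have "(((\<lambda>p. h (u p)) \<circ> inv_chart c) has_derivative (\<lambda>w. d * chart_deriv c u p w)) (at (snd c p))"
    by (simp add: comp_def)
  from chart_derivI[OF this] show ?thesis by simp
qed

lemma chart_deriv_local:
  assumes "C1 u" "open U" "p \<in> U" "\<And>q. q \<in> U \<Longrightarrow> u q = v q" "c \<in> charts" "p \<in> fst c"
  shows "chart_deriv c u p = chart_deriv c v p"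
proof -
  define Y where "Y = {y \<in> chart_image c. inv_chart c y \<in> U}"
  have "((v \<circ> inv_chart c) has_derivative chart_deriv c u p) (at (snd c p))"
  proof (rule has_derivative_transform_within_open[OF C1_chart_deriv[OF assms(1,5,6)]])
    show "open Y" unfolding Y_def by (rule open_chart_image[OF assms(5,2)])
    show "snd c p \<in> Y" using assms(3,5,6) by (simp add: Y_def chart_in inv_chart_chart)
  qed (simp add: Y_def assms(4))
  from chart_derivI[OF this] show ?thesis by simp
qed

lemma transition_derivative:
  assumes "c \<in> charts" "c' \<in> charts" "p \<in> fst c" "p \<in> fst c'"
  shows "((snd c' \<circ> inv_chart c) has_derivative (*v) (coord_jacobian c c' p)) (at (snd c p))"
proof -
  have "Ck_on (Suc 0) (snd c ` (fst c \<inter> fst c')) (snd c' \<circ> inv_chart c)"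
    using charts_compatible[OF assms(1,2)] by (simp add: smooth_on_def del: Ck_on.simps)
  then have d: "((snd c' \<circ> inv_chart c) has_derivative
      frechet_derivative (snd c' \<circ> inv_chart c) (at (snd c p))) (at (snd c p))"
    by (rule Ck_on_has_derivative) (use assms in blast)
  have "(*v) (coord_jacobian c c' p) = frechet_derivative (snd c' \<circ> inv_chart c) (at (snd c p))"
    unfolding coord_jacobian_def
    by (rule matrix_vector_mul(2)[OF has_derivative_linear[OF d]])
  then show ?thesis using d by simp
qed

lemma chart_deriv_change:
  assumes "C1 u" "c \<in> charts" "c' \<in> charts" "p \<in> fst c" "p \<in> fst c'"
  shows "chart_deriv c u p w = chart_deriv c' u p (coord_jacobian c c' p *v w)"
proof -
  define Y where "Y = {y \<in> chart_image c. inv_chart c y \<in> fst c'}"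
  have "(u \<circ> inv_chart c' has_derivative chart_deriv c' u p) (at ((snd c' \<circ> inv_chart c) (snd c p)))"
    using C1_chart_deriv[OF assms(1,3,5)] assms by (simp add: inv_chart_chart)
  from diff_chain_at[OF transition_derivative[OF assms(2-5)] this]
  have "((u \<circ> inv_chart c' \<circ> (snd c' \<circ> inv_chart c)) has_derivative
     (chart_deriv c' u p \<circ> (*v) (coord_jacobian c c' p))) (at (snd c p))" .
  then have "(u \<circ> inv_chart c has_derivative
     (chart_deriv c' u p \<circ> (*v) (coord_jacobian c c' p))) (at (snd c p))"
  proof (rule has_derivative_transform_within_open)
    show "open Y" unfolding Y_def by (rule open_chart_image[OF assms(2) open_chart(1)[OF assms(3)]])
    show "snd c p \<in> Y" using assms by (simp add: Y_def chart_in inv_chart_chart)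
  qed (simp add: Y_def assms(3) inv_chart_chart)
  from chart_derivI[OF this] show ?thesis by simp
qed

lemma compact_inv_chart:
  assumes "c \<in> charts" "compact K" "K \<subseteq> chart_image c"
  shows "compact (inv_chart c ` K)"
  using compact_continuous_image continuous_on_subset[OF continuous_chart(2)] assms by blast

lemma pull_support:
  assumes "c \<in> charts" "K \<subseteq> chart_image c" "\<And>y. y \<notin> K \<Longrightarrow> F y = 0"
  shows "{p. pull c F p \<noteq> 0} \<subseteq> inv_chart c ` K" "\<And>p. p \<notin> inv_chart c ` K \<Longrightarrow> pull c F p = 0"
proof -
  show *: "pull c F p = 0" if "p \<notin> inv_chart c ` K" for p
  proof (cases "p \<in> fst c")
    case True
    then have "snd c p \<notin> K" using that inv_chart_chart[OF assms(1) True] by force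
    then show ?thesis by (simp add: pull_def assms(3))
  qed (simp add: pull_def)
  then show "{p. pull c F p \<noteq> 0} \<subseteq> inv_chart c ` K" by blast
qed

lemma Ck_function_pull:
  assumes c: "c \<in> charts" and K: "compact K" "K \<subseteq> chart_image c" "\<And>y. y \<notin> K \<Longrightarrow> F y = 0"
    and F: "Ck_on k UNIV F"
  shows "Ck_function k charts (pull c F)"
  unfolding Ck_function_def
proof
  fix c' assume c': "c' \<in> charts"
  define A where "A = {y \<in> chart_image c'. inv_chart c' y \<in> fst c}"
  define B where "B = {y \<in> chart_image c'. inv_chart c' y \<in> - (inv_chart c ` K)}"
  have oA: "open A" unfolding A_def by (intro open_chart_image c' open_chart c)
  have oB: "open B" unfolding B_def
    by (intro open_chart_image c' open_Compl compact_imp_closed compact_inv_chart c K(1,2))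
  have un: "chart_image c' = A \<union> B"
    using inv_chart_in[OF c] K(2) by (auto simp: A_def B_def)
  have A_eq: "A = snd c' ` (fst c' \<inter> fst c)"
    unfolding A_def by (subst chart_image_eq[OF c']) (use inv_chart_in[OF c'] in auto)
  have "Ck_on k A (snd c \<circ> inv_chart c')"
    using charts_compatible[OF c' c] by (simp add: smooth_on_def A_eq)
  from Ck_on_compose[OF oA open_UNIV _ F this]
  have "Ck_on k A (F \<circ> (snd c \<circ> inv_chart c'))" by simp
  then have 1: "Ck_on k A (pull c F \<circ> inv_chart c')"
    by (rule Ck_on_cong[OF oA, rotated]) (auto simp: A_def pull_def)
  have 2: "Ck_on k B (pull c F \<circ> inv_chart c')"
    by (rule Ck_on_cong[OF oB _ Ck_on_const[of k B 0]])
       (simp add: B_def pull_support(2)[OF c K(2,3)])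
  show "Ck_on k (chart_image c') (pull c F \<circ> inv_chart c')"
    unfolding un by (rule Ck_on_Un[OF oA oB 1 2])
qed

lemma compact_pull_support:
  assumes "c \<in> charts" "compact K" "K \<subseteq> chart_image c" "\<And>y. y \<notin> K \<Longrightarrow> F y = 0"
  shows "compact (closure {p. pull c F p \<noteq> 0})"
proof -
  have C: "compact (inv_chart c ` K)" by (rule compact_inv_chart[OF assms(1-3)])
  have "closure {p. pull c F p \<noteq> 0} \<subseteq> inv_chart c ` K"
    using pull_support(1)[where F = F, OF assms(1,3,4)] compact_imp_closed[OF C]
    by (rule closure_minimal)
  then have "inv_chart c ` K \<inter> closure {p. pull c F p \<noteq> 0} = closure {p. pull c F p \<noteq> 0}" by blast
  with compact_Int_closed[OF C closed_closure, of "{p. pull c F p \<noteq> 0}"]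
  show ?thesis by simp
qed

lemma pull_comp_inv_chart:
  "c \<in> charts \<Longrightarrow> y \<in> chart_image c \<Longrightarrow> pull c F (inv_chart c y) = F y"
  by (simp add: pull_def inv_chart_in chart_inv_chart)

lemma coordinate_bump:
  fixes y :: "real^'n"
  assumes "0 < s" "s < t"
  defines "F \<equiv> \<lambda>x. cutoff (s\<^sup>2) (t\<^sup>2) ((x - y) \<bullet> (x - y))"
  shows "Ck_on (Suc 0) UNIV F" "\<And>x. 0 \<le> F x" "\<And>x. F x \<le> 1"
    "\<And>x. dist y x \<le> s \<Longrightarrow> F x = 1" "\<And>x. x \<notin> cball y t \<Longrightarrow> F x = 0"
proof -
  have eq: "(x - y) \<bullet> (x - y) = (dist y x)\<^sup>2" for x
    by (simp add: dist_norm norm_minus_commute power2_norm_eq_inner)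
  have lt: "s\<^sup>2 < t\<^sup>2" using assms by (simp add: power_strict_mono)
  have d: "((\<lambda>x. (x - y) \<bullet> (x - y)) has_derivative (\<lambda>v. 2 * ((x - y) \<bullet> v))) (at x)" for x
    by (rule has_derivative_eq_rhs) (auto intro!: derivative_eq_intros simp: inner_commute)
  have "Ck_on (Suc 0) UNIV (\<lambda>x. (x - y) \<bullet> (x - y))"
    by (rule Ck_on_SucI[OF open_UNIV d]) (auto intro!: continuous_intros)
  then show "Ck_on (Suc 0) UNIV F"
    unfolding F_def
    by (rule C1_on_real_compose[OF open_UNIV _ has_real_derivative_cutoff continuous_on_cutoff'[OF lt],
          unfolded One_nat_def])
  show "0 \<le> F x" "F x \<le> 1" for x by (simp_all add: F_def cutoff_bounds)
  show "F x = 1" if "dist y x \<le> s" for x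
    using that power_mono[of "dist y x" s 2] by (simp add: F_def eq cutoff_le)
  show "F x = 0" if "x \<notin> cball y t" for x
    using that power_mono[of t "dist y x" 2] assms(1,2) lt by (simp add: F_def eq cutoff_ge)
qed

lemma chart_ball:
  assumes "c \<in> charts" "p \<in> fst c" "open U" "p \<in> U"
  obtains t where "t > 0" "cball (snd c p) t \<subseteq> chart_image c" "inv_chart c ` cball (snd c p) t \<subseteq> U"
proof -
  let ?Y = "{y \<in> chart_image c. inv_chart c y \<in> U}"
  have "snd c p \<in> ?Y" using assms by (simp add: chart_in inv_chart_chart)
  with open_contains_cball[THEN iffD1, OF open_chart_image[OF assms(1,3)]]
  obtain t where t: "t > 0" "cball (snd c p) t \<subseteq> ?Y" by blast
  show ?thesis
  proof (rule that[OF t(1)])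
    show "cball (snd c p) t \<subseteq> chart_image c" using t(2) by (rule subset_trans) simp
    show "inv_chart c ` cball (snd c p) t \<subseteq> U" using t(2) by (auto simp only: image_subset_iff)
  qed
qed

end


section \<open>Positive definite matrices\<close>

abbreviation quad :: "real^'n^'n \<Rightarrow> real^'n \<Rightarrow> real^'n \<Rightarrow> real" where
  "quad A v w \<equiv> v \<bullet> (A *v w)"

definition posdef :: "real^'n^'n \<Rightarrow> bool" where
  "posdef A \<longleftrightarrow> transpose A = A \<and> (\<forall>v. v \<noteq> 0 \<longrightarrow> quad A v v > 0)"

lemma quad_sym: "posdef A \<Longrightarrow> quad A v w = quad A w v"
  unfolding posdef_def by (metis dot_lmul_matrix inner_commute transpose_matrix_vector)

lemma quad_nonneg: "posdef A \<Longrightarrow> quad A v v \<ge> 0"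
  unfolding posdef_def by (metis inner_zero_left less_eq_real_def)

lemma quad_Cauchy_Schwarz:
  assumes "posdef A" shows "\<bar>quad A v w\<bar> \<le> sqrt (quad A v v) * sqrt (quad A w w)"
proof (cases "w = 0")
  case False
  define t where "t = quad A v w / quad A w w"
  have pos: "quad A w w > 0" using assms False by (simp add: posdef_def)
  have "0 \<le> quad A (v - t *\<^sub>R w) (v - t *\<^sub>R w)" by (rule quad_nonneg[OF assms])
  also have "\<dots> = quad A v v - 2 * t * quad A v w + t\<^sup>2 * quad A w w"
    using quad_sym[OF assms, of w v]
    by (simp add: matrix_vector_mult_diff_distrib matrix_vector_mult_scaleR inner_diff_left
        inner_diff_right power2_eq_square algebra_simps)
  also have "\<dots> = quad A v v - (quad A v w)\<^sup>2 / quad A w w"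
    using pos by (simp add: t_def power2_eq_square field_simps)
  finally have "(quad A v w)\<^sup>2 \<le> quad A v v * quad A w w"
    using pos by (simp add: divide_simps mult.commute)
  then have "sqrt ((quad A v w)\<^sup>2) \<le> sqrt (quad A v v * quad A w w)" by (rule real_sqrt_le_mono)
  then show ?thesis by (simp add: real_sqrt_mult)
qed simp

lemma posdef_inj: "posdef A \<Longrightarrow> A *v v = 0 \<Longrightarrow> v = 0"
  unfolding posdef_def by force

lemma posdef_invertible: "posdef A \<Longrightarrow> invertible A"
  using posdef_inj by (metis matrix_left_invertible_ker invertible_left_inverse)

lemma posdef_det_nonzero: "posdef A \<Longrightarrow> det A \<noteq> 0"
  using posdef_invertible invertible_det_nz by blast

lemma posdef_matrix_inv:
  assumes "posdef A" shows "A *v (matrix_inv A *v v) = v"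
proof -
  have "A ** matrix_inv A = mat 1"
    using someI_ex[OF posdef_invertible[OF assms, unfolded invertible_def]]
    unfolding matrix_inv_def by blast
  then show ?thesis by (simp add: matrix_vector_mul_assoc)
qed

lemma continuous_on_det:
  fixes f :: "'b::topological_space \<Rightarrow> real^'n^'n"
  assumes "\<And>i j. continuous_on S (\<lambda>x. f x $ i $ j)"
  shows "continuous_on S (\<lambda>x. det (f x))"
  unfolding det_def by (intro continuous_intros assms)

lemma posdef_convex:
  assumes "posdef A" "posdef B" "0 \<le> t" "t \<le> 1"
  shows "posdef ((1 - t) *\<^sub>R A + t *\<^sub>R B)"
proof -
  have eq: "quad ((1 - t) *\<^sub>R A + t *\<^sub>R B) v v = (1 - t) * quad A v v + t * quad B v v" for v
    by (simp add: matrix_vector_mult_add_rdistrib scaleR_matrix_vector_assoc[symmetric] inner_add_right)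
  have "transpose ((1 - t) *\<^sub>R A + t *\<^sub>R B) = (1 - t) *\<^sub>R transpose A + t *\<^sub>R transpose B"
    by (simp add: transpose_def vec_eq_iff)
  moreover have "(1 - t) * quad A v v + t * quad B v v > 0" if "v \<noteq> 0" for v
  proof (cases "t = 0")
    case False
    then have "t * quad B v v > 0" using assms that by (simp add: posdef_def)
    moreover have "(1 - t) * quad A v v \<ge> 0" using assms(4) quad_nonneg[OF assms(1)] by simp
    ultimately show ?thesis by simp
  qed (use assms that in \<open>simp add: posdef_def\<close>)
  ultimately show ?thesis using assms(1,2) by (simp add: posdef_def eq)
qed

text \<open>The segment from the identity to \<open>A\<close> stays among the positive definite matrices, on which the
  determinant does not vanish and hence keeps its sign.\<close>

lemma posdef_det_pos:
  fixes A :: "real^'n^'n"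
  assumes "posdef A" shows "det A > 0"
proof (rule ccontr)
  assume "\<not> det A > 0"
  have I: "posdef (mat 1 :: real^'n^'n)" by (simp add: posdef_def transpose_mat)
  define M where "M t = (1 - t) *\<^sub>R (mat 1 :: real^'n^'n) + t *\<^sub>R A" for t
  have "continuous_on {0..1} (\<lambda>t. det (M t))"
    unfolding M_def by (rule continuous_on_det) (auto intro!: continuous_intros)
  moreover have "det (M 1) \<le> 0" "0 \<le> det (M 0)"
    using \<open>\<not> det A > 0\<close> by (simp_all add: M_def)
  ultimately obtain t where "0 \<le> t" "t \<le> 1" "det (M t) = 0"
    using IVT2'[of "\<lambda>t. det (M t)" 1 0 0] by auto
  then show False
    using posdef_det_nonzero[OF posdef_convex[OF I assms]] by (simp add: M_def)
qed


section \<open>Gradients on Riemannian manifolds\<close>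

context riemannian_manifold begin

lemma posdef_metric: "c \<in> charts \<Longrightarrow> p \<in> fst c \<Longrightarrow> posdef (g c p)"
  unfolding posdef_def using metric_symmetric metric_positive by blast

lemma metric_entry_continuous:
  assumes "c \<in> charts" shows "continuous_on (chart_image c) (\<lambda>y. g c (inv_chart c y) $ i $ j)"
proof -
  have "continuous_on (chart_image c) (g c \<circ> inv_chart c)"
    using metric_smooth[OF assms] Ck_on.simps(1) unfolding smooth_on_def by blast
  then show ?thesis by (auto simp: comp_def intro!: continuous_intros)
qed

lemma quad_change:
  assumes "c \<in> charts" "c' \<in> charts" "p \<in> fst c" "p \<in> fst c'"
  shows "quad (g c p) v w = quad (g c' p) (coord_jacobian c c' p *v v) (coord_jacobian c c' p *v w)"
proof -
  define J where "J = coord_jacobian c c' p"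
  have "quad (g c p) v w = v \<bullet> (transpose J *v (g c' p *v (J *v w)))"
    using metric_transform[OF assms] by (simp add: J_def matrix_vector_mul_assoc matrix_mul_assoc)
  also have "\<dots> = (J *v v) \<bullet> (g c' p *v (J *v w))"
    by (metis dot_lmul_matrix transpose_matrix_vector transpose_transpose)
  finally show ?thesis by (simp add: J_def)
qed

lemma coord_grad_eq:
  assumes "C1 u" "c \<in> charts" "p \<in> fst c"
  shows "quad (g c p) v (coord_grad g c u p) = chart_deriv c u p v"
proof -
  have "g c p *v coord_grad g c u p = (\<chi> i. chart_deriv c u p (axis i 1))"
    unfolding coord_grad_def chart_deriv_def by (rule posdef_matrix_inv[OF posdef_metric[OF assms(2,3)]])
  then have "quad (g c p) v (coord_grad g c u p) = (\<Sum>i\<in>UNIV. v $ i * chart_deriv c u p (axis i 1))"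
    by (simp add: inner_vec_def)
  also have "\<dots> = chart_deriv c u p v"
    using linear_axis_sum[OF chart_deriv_linear[OF assms], of v] by simp
  finally show ?thesis .
qed

lemma jacobian_surj:
  assumes "c \<in> charts" "c' \<in> charts" "p \<in> fst c" "p \<in> fst c'"
  obtains w where "coord_jacobian c c' p *v w = v"
proof -
  have "w = 0" if "coord_jacobian c c' p *v w = 0" for w
    using quad_change[OF assms, of w w] that posdef_metric[OF assms(1,3)]
    unfolding posdef_def by auto
  then have "inj ((*v) (coord_jacobian c c' p))"
    by (simp add: linear_injective_0)
  then have "surj ((*v) (coord_jacobian c c' p))"
    by (simp add: linear_injective_imp_surjective)
  then show ?thesis using that by (metis surjD)
qed

text \<open>A gradient is determined by its inner products with all vectors, and these are directional
  derivatives, which transform correctly.\<close>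

lemma coord_grad_change:
  assumes u: "C1 u" and cc: "c \<in> charts" "c' \<in> charts" "p \<in> fst c" "p \<in> fst c'"
  shows "coord_jacobian c c' p *v coord_grad g c u p = coord_grad g c' u p"
proof -
  let ?J = "coord_jacobian c c' p"
  define d where "d = ?J *v coord_grad g c u p - coord_grad g c' u p"
  obtain w where w: "?J *v w = d" using jacobian_surj[OF cc] by blast
  have "quad (g c' p) d (?J *v coord_grad g c u p) = quad (g c p) w (coord_grad g c u p)"
    by (simp add: quad_change[OF cc] w)
  also have "\<dots> = quad (g c' p) d (coord_grad g c' u p)"
    by (simp add: coord_grad_eq u cc chart_deriv_change[OF u cc] w)
  finally have "quad (g c' p) d d = 0"
    by (simp add: d_def matrix_vector_mult_diff_distrib inner_diff_right)
  then have "d = 0" using posdef_metric[OF cc(2,4)] unfolding posdef_def by force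
  then show ?thesis by (simp add: d_def)
qed

lemma grad_inner_chart:
  assumes "C1 u" "C1 v" "c \<in> charts" "p \<in> fst c"
  shows "grad_inner charts g u v p = chart_deriv c v p (coord_grad g c u p)"
proof -
  let ?c = "chart_at charts p"
  have "grad_inner charts g u v p = quad (g ?c p) (coord_grad g ?c u p) (coord_grad g ?c v p)"
    by (simp add: grad_inner_def Let_def)
  also have "\<dots> = chart_deriv ?c v p (coord_grad g ?c u p)"
    by (rule coord_grad_eq[OF assms(2) chart_at_in])
  also have "\<dots> = chart_deriv c v p (coord_grad g c u p)"
    using chart_deriv_change[OF assms(2,3) chart_at_in(1) assms(4) chart_at_in(2)]
      coord_grad_change[OF assms(1,3) chart_at_in(1) assms(4) chart_at_in(2)] by simp
  finally show ?thesis .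
qed

lemma grad_inner_quad:
  assumes "C1 u" "C1 v" "c \<in> charts" "p \<in> fst c"
  shows "grad_inner charts g u v p = quad (g c p) (coord_grad g c u p) (coord_grad g c v p)"
  using grad_inner_chart[OF assms] coord_grad_eq[OF assms(2-4)] by simp

lemmas grad_inner_at = grad_inner_chart[OF _ _ chart_at_in]

lemma grad_norm_quad:
  assumes "C1 u" "c \<in> charts" "p \<in> fst c"
  shows "grad_norm charts g u p = sqrt (quad (g c p) (coord_grad g c u p) (coord_grad g c u p))"
  by (simp add: grad_norm_def grad_inner_quad[OF assms(1) assms])

lemma grad_norm_nonneg: "C1 u \<Longrightarrow> grad_norm charts g u p \<ge> 0"
  using grad_norm_quad[OF _ chart_at_in, of u p] quad_nonneg[OF posdef_metric[OF chart_at_in]] by simp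

lemma grad_norm_square: "C1 u \<Longrightarrow> (grad_norm charts g u p)\<^sup>2 = grad_inner charts g u u p"
  using grad_norm_quad[OF _ chart_at_in, of u p] quad_nonneg[OF posdef_metric[OF chart_at_in]]
    grad_inner_quad[OF _ _ chart_at_in, of u u p] by simp

lemma grad_inner_bound:
  assumes "C1 u" "C1 v"
  shows "\<bar>grad_inner charts g u v p\<bar> \<le> grad_norm charts g u p * grad_norm charts g v p"
  using quad_Cauchy_Schwarz[OF posdef_metric[OF chart_at_in], of _ p]
  by (simp add: grad_norm_quad[OF _ chart_at_in] grad_inner_quad[OF _ _ chart_at_in] assms)

lemma chart_deriv_bound:
  assumes "C1 u" "c \<in> charts" "p \<in> fst c"
  shows "\<bar>chart_deriv c u p v\<bar> \<le> grad_norm charts g u p * sqrt (quad (g c p) v v)"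
  using quad_Cauchy_Schwarz[OF posdef_metric[OF assms(2,3)], of v "coord_grad g c u p"]
  by (simp add: coord_grad_eq[OF assms] grad_norm_quad[OF assms] mult.commute)

text \<open>Testing with the gradient itself shows that such a bound characterises the gradient norm.\<close>

lemma grad_norm_leI:
  assumes "C1 u" "c \<in> charts" "p \<in> fst c" "L \<ge> 0"
    and "\<And>v. chart_deriv c u p v \<le> L * sqrt (quad (g c p) v v)"
  shows "grad_norm charts g u p \<le> L"
proof -
  have "(grad_norm charts g u p)\<^sup>2 = chart_deriv c u p (coord_grad g c u p)"
    using grad_norm_square[OF assms(1)] grad_inner_chart[OF assms(1,1,2,3)] by simp
  also have "\<dots> \<le> L * grad_norm charts g u p"
    using assms(5)[of "coord_grad g c u p"] by (simp add: grad_norm_quad[OF assms(1-3)])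
  finally show ?thesis
    using grad_norm_nonneg[OF assms(1), of p] assms(4)
    by (cases "grad_norm charts g u p = 0") (auto simp: power2_eq_square)
qed

lemma grad_inner_add:
  "C1 u \<Longrightarrow> C1 v \<Longrightarrow> C1 w \<Longrightarrow>
    grad_inner charts g u (\<lambda>p. v p + w p) p = grad_inner charts g u v p + grad_inner charts g u w p"
  by (simp add: grad_inner_at chart_deriv_add chart_at_in Ck_function_add)

lemma grad_inner_mult:
  "C1 u \<Longrightarrow> C1 v \<Longrightarrow> C1 w \<Longrightarrow> grad_inner charts g u (\<lambda>p. v p * w p) p =
    v p * grad_inner charts g u w p + w p * grad_inner charts g u v p"
  by (simp add: grad_inner_at chart_deriv_mult chart_at_in Ck_function_mult)

lemma grad_inner_compose:
  assumes "C1 u" "C1 v" "\<And>t. (h has_real_derivative h' t) (at t)" "continuous_on UNIV h'"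
  shows "grad_inner charts g u (\<lambda>p. h (v p)) p = h' (v p) * grad_inner charts g u v p"
  using chart_deriv_compose[OF assms(2,3) chart_at_in] C1_compose[OF assms(2-4)] assms(1,2)
  by (simp add: grad_inner_at)

lemma grad_inner_const: "C1 u \<Longrightarrow> grad_inner charts g u (\<lambda>p. a) p = 0"
  by (simp add: grad_inner_at chart_deriv_const Ck_function_const)

lemma grad_norm_local:
  assumes "C1 v" "C1 w" "open U" "p \<in> U" "\<And>q. q \<in> U \<Longrightarrow> v q = w q"
  shows "grad_norm charts g v p = grad_norm charts g w p"
proof -
  have "coord_grad g c v p = coord_grad g c w p" if "c \<in> charts" "p \<in> fst c" for c
    using chart_deriv_local[OF assms(1,3,4,5) that] by (simp add: coord_grad_def chart_deriv_def)
  then show ?thesis by (simp add: grad_norm_quad[OF _ chart_at_in] assms chart_at_in)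
qed

lemma grad_norm_compose:
  assumes "C1 v" "\<And>t. (h has_real_derivative h' t) (at t)" "continuous_on UNIV h'"
  shows "grad_norm charts g (\<lambda>p. h (v p)) p \<le> \<bar>h' (v p)\<bar> * grad_norm charts g v p"
proof (rule grad_norm_leI[OF C1_compose[OF assms] chart_at_in])
  fix x
  let ?c = "chart_at charts p"
  have "h' (v p) * chart_deriv ?c v p x \<le> \<bar>h' (v p)\<bar> * (grad_norm charts g v p * sqrt (quad (g ?c p) x x))"
    using mult_left_mono[OF chart_deriv_bound[OF assms(1) chart_at_in, of p x] abs_ge_zero[of "h' (v p)"]]
    by (metis abs_le_D1 abs_mult)
  then show "chart_deriv ?c (\<lambda>p. h (v p)) p x
    \<le> \<bar>h' (v p)\<bar> * grad_norm charts g v p * sqrt (quad (g ?c p) x x)"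
    by (simp add: chart_deriv_compose[OF assms(1,2) chart_at_in] mult.assoc)
qed (simp add: grad_norm_nonneg assms)

lemma coord_grad_continuous:
  assumes "C1 u" "c \<in> charts"
  shows "continuous_on (chart_image c) (\<lambda>y. coord_grad g c u (inv_chart c y) $ k)"
proof -
  define du where "du y = (\<chi> i. chart_deriv c u (inv_chart c y) (axis i 1))" for y
  define M where "M y = (\<chi> i j. if j = k then du y $ i else g c (inv_chart c y) $ i $ j)" for y
  have du: "continuous_on (chart_image c) (\<lambda>y. du y $ i)" for i
  proof -
    have "continuous_on (chart_image c) (partial i (u \<circ> inv_chart c))"
      using assms unfolding Ck_function_def by simp
    then show ?thesis
      by (rule continuous_on_eq) (simp add: du_def chart_deriv_def chart_inv_chart[OF assms(2)])
  qed
  have eq: "coord_grad g c u (inv_chart c y) $ k = det (M y) / det (g c (inv_chart c y))"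
    if "y \<in> chart_image c" for y
  proof -
    let ?p = "inv_chart c y"
    have pd: "posdef (g c ?p)" by (rule posdef_metric[OF assms(2) inv_chart_in[OF assms(2) that]])
    have "g c ?p *v coord_grad g c u ?p = du y"
      unfolding coord_grad_def du_def chart_deriv_def by (rule posdef_matrix_inv[OF pd])
    then show ?thesis
      using cramer[OF posdef_det_nonzero[OF pd]] by (simp add: M_def)
  qed
  have "continuous_on (chart_image c) (\<lambda>y. M y $ i $ j)" for i j
    by (cases "j = k") (simp_all add: M_def du metric_entry_continuous[OF assms(2)])
  then have "continuous_on (chart_image c) (\<lambda>y. det (M y) / det (g c (inv_chart c y)))"
    by (intro continuous_on_divide continuous_on_det metric_entry_continuous assms(2))
       (auto dest!: inv_chart_in[OF assms(2)] posdef_metric[OF assms(2)] posdef_det_nonzero)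
  then show ?thesis by (rule continuous_on_eq) (simp add: eq)
qed

lemma continuous_on_charts:
  fixes h :: "'a \<Rightarrow> real"
  assumes "\<And>c. c \<in> charts \<Longrightarrow> continuous_on (chart_image c) (\<lambda>y. h (inv_chart c y))"
  shows "continuous_on UNIV h"
proof -
  have "Ck_function 0 charts h" using assms by (simp add: Ck_function_def comp_def)
  then show ?thesis by (rule Ck_function_continuous)
qed

lemma grad_inner_continuous:
  assumes "C1 u" "C1 v" shows "continuous_on UNIV (grad_inner charts g u v)"
proof (rule continuous_on_charts)
  fix c assume c: "c \<in> charts"
  have "continuous_on (chart_image c) (\<lambda>y. \<Sum>i\<in>UNIV. coord_grad g c u (inv_chart c y) $ i * partial i (v \<circ> inv_chart c) y)"
    using assms(2) c unfolding Ck_function_def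
    by (intro continuous_intros coord_grad_continuous assms c) simp
  then show "continuous_on (chart_image c) (\<lambda>y. grad_inner charts g u v (inv_chart c y))"
  proof (rule continuous_on_eq)
    fix y assume y: "y \<in> chart_image c"
    show "(\<Sum>i\<in>UNIV. coord_grad g c u (inv_chart c y) $ i * partial i (v \<circ> inv_chart c) y)
       = grad_inner charts g u v (inv_chart c y)"
      unfolding grad_inner_chart[OF assms c inv_chart_in[OF c y]]
      by (subst linear_axis_sum[OF chart_deriv_linear[OF assms(2) c inv_chart_in[OF c y]]])
         (simp add: chart_deriv_def chart_inv_chart[OF c y])
  qed
qed

lemma grad_norm_continuous: "C1 u \<Longrightarrow> continuous_on UNIV (grad_norm charts g u)"
  unfolding grad_norm_def by (intro continuous_intros grad_inner_continuous)

lemma grad_norm_bounded: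
  assumes "C1 u" "compact K" "\<And>p. p \<notin> K \<Longrightarrow> u p = 0"
  obtains L where "L > 0" "\<And>p. grad_norm charts g u p \<le> L"
proof -
  have "compact (grad_norm charts g u ` K)"
    using compact_continuous_image continuous_on_subset[OF grad_norm_continuous[OF assms(1)]] assms(2) by blast
  then obtain L where L: "\<And>p. p \<in> K \<Longrightarrow> norm (grad_norm charts g u p) \<le> L"
    using compact_imp_bounded bounded_iff by (metis image_eqI)
  have "grad_norm charts g u p = 0" if "p \<notin> K" for p
  proof -
    have "grad_norm charts g u p = grad_norm charts g (\<lambda>p. 0) p"
      by (rule grad_norm_local[OF assms(1) Ck_function_const, of "- K"])
         (use assms(2,3) that compact_imp_closed in auto)
    then show ?thesis by (simp add: grad_norm_def grad_inner_const Ck_function_const)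
  qed
  then have "grad_norm charts g u p \<le> max L 1" for p
    using L[of p] by (cases "p \<in> K") auto
  then show ?thesis by (intro that[of "max L 1"]) auto
qed

end


section \<open>Curves and their lengths\<close>

text \<open>The derivative is taken within \<open>I\<close>, so that a piece of a curve has one-sided speeds at its ends.\<close>

definition pspeed ::
  "('a, 'n::finite) chart set \<Rightarrow> ('a, 'n) gram \<Rightarrow> real set \<Rightarrow> (real \<Rightarrow> 'a) \<Rightarrow> real \<Rightarrow> real" where
  "pspeed charts g I \<gamma> t =
     (let c = chart_at charts (\<gamma> t); v = vector_derivative (snd c \<circ> \<gamma>) (at t within I)
      in sqrt (v \<bullet> (g c (\<gamma> t) *v v)))"

text \<open>Curves parametrised on arbitrary intervals that are glued from \<open>C1\<close> pieces one after the
  other; the inductive form makes every statement about them an induction over the pieces.\<close>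

inductive chain :: "('a::topological_space, 'n::finite) chart set \<Rightarrow> (real \<Rightarrow> 'a) \<Rightarrow> real \<Rightarrow> real \<Rightarrow> bool"
  for charts \<gamma> where
  base: "a < b \<Longrightarrow> C1_curve_on charts {a..b} \<gamma> \<Longrightarrow> chain charts \<gamma> a b"
| step: "chain charts \<gamma> a b \<Longrightarrow> b < e \<Longrightarrow> C1_curve_on charts {b..e} \<gamma> \<Longrightarrow> chain charts \<gamma> a e"

lemma chain_less: "chain charts \<gamma> a b \<Longrightarrow> a < b"
  by (induction rule: chain.induct) auto

lemma chain_join: "chain charts \<gamma> b e \<Longrightarrow> chain charts \<gamma> a b \<Longrightarrow> chain charts \<gamma> a e"
  by (induction rule: chain.induct) (auto intro: chain.step)

lemma C1_curve_on_subset: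
  assumes "C1_curve_on charts I \<gamma>" "J \<subseteq> I" shows "C1_curve_on charts J \<gamma>"
  unfolding C1_curve_on_def
proof (intro conjI ballI)
  show "continuous_on J \<gamma>" using assms continuous_on_subset unfolding C1_curve_on_def by blast
  fix c assume "c \<in> charts"
  then obtain v where v: "continuous_on {t\<in>I. \<gamma> t \<in> fst c} v"
    "\<forall>t\<in>I. \<gamma> t \<in> fst c \<longrightarrow> ((snd c \<circ> \<gamma>) has_vector_derivative v t) (at t within I)"
    using assms(1) unfolding C1_curve_on_def by blast
  have "continuous_on {t\<in>J. \<gamma> t \<in> fst c} v" using v(1) assms(2) by (auto elim: continuous_on_subset)
  moreover have "\<forall>t\<in>J. \<gamma> t \<in> fst c \<longrightarrow> ((snd c \<circ> \<gamma>) has_vector_derivative v t) (at t within J)"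
    using v(2) assms(2) has_vector_derivative_within_subset by blast
  ultimately show "\<exists>v. continuous_on {t\<in>J. \<gamma> t \<in> fst c} v \<and>
      (\<forall>t\<in>J. \<gamma> t \<in> fst c \<longrightarrow> ((snd c \<circ> \<gamma>) has_vector_derivative v t) (at t within J))" by blast
qed

lemma C1_curve_on_cong:
  assumes "C1_curve_on charts I \<gamma>" "\<And>t. t \<in> I \<Longrightarrow> \<gamma> t = \<gamma>' t" shows "C1_curve_on charts I \<gamma>'"
  unfolding C1_curve_on_def
proof (intro conjI ballI)
  show "continuous_on I \<gamma>'" using assms unfolding C1_curve_on_def by (metis continuous_on_eq)
  fix c assume "c \<in> charts"
  then obtain v where v: "continuous_on {t\<in>I. \<gamma> t \<in> fst c} v"
    "\<forall>t\<in>I. \<gamma> t \<in> fst c \<longrightarrow> ((snd c \<circ> \<gamma>) has_vector_derivative v t) (at t within I)"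
    using assms(1) unfolding C1_curve_on_def by blast
  have "{t\<in>I. \<gamma>' t \<in> fst c} = {t\<in>I. \<gamma> t \<in> fst c}" using assms(2) by auto
  moreover have "((snd c \<circ> \<gamma>') has_vector_derivative v t) (at t within I)"
    if "t \<in> I" "\<gamma>' t \<in> fst c" for t
  proof (rule has_vector_derivative_transform[OF that(1)])
    show "((snd c \<circ> \<gamma>) has_vector_derivative v t) (at t within I)" using v(2) that assms(2) by simp
  qed (simp add: assms(2))
  ultimately show "\<exists>v. continuous_on {t\<in>I. \<gamma>' t \<in> fst c} v \<and>
      (\<forall>t\<in>I. \<gamma>' t \<in> fst c \<longrightarrow> ((snd c \<circ> \<gamma>') has_vector_derivative v t) (at t within I))"
    using v(1) by auto
qed

lemma chain_cong:
  "chain charts \<gamma> a b \<Longrightarrow> (\<And>t. t \<in> {a..b} \<Longrightarrow> \<gamma> t = \<gamma>' t) \<Longrightarrow> chain charts \<gamma>' a b"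
proof (induction rule: chain.induct)
  case (base a b)
  show ?case by (rule chain.base[OF base(1) C1_curve_on_cong[OF base(2,3)]])
next
  case (step a b e)
  have "a < b" using step.hyps(1) by (rule chain_less)
  show ?case
  proof (rule chain.step[of _ _ a b])
    show "chain charts \<gamma>' a b" by (rule step.IH) (use step in auto)
    show "C1_curve_on charts {b..e} \<gamma>'"
      by (rule C1_curve_on_cong[OF step.hyps(3)]) (use step \<open>a < b\<close> in auto)
  qed (rule step.hyps)
qed

lemma chain_sub:
  "chain charts \<gamma> a b \<Longrightarrow> a \<le> s \<Longrightarrow> s < t \<Longrightarrow> t \<le> b \<Longrightarrow> chain charts \<gamma> s t"
proof (induction arbitrary: s t rule: chain.induct)
  case (base a b)
  have "C1_curve_on charts {s..t} \<gamma>"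
    by (rule C1_curve_on_subset[OF base(2)]) (use base in auto)
  then show ?case using base(4) by (rule chain.base[rotated])
next
  case (step a b e)
  consider "t \<le> b" | "b \<le> s" | "s < b" "b < t" by linarith
  then show ?case
  proof cases
    case 2
    have "C1_curve_on charts {s..t} \<gamma>"
      by (rule C1_curve_on_subset[OF step.hyps(3)]) (use step.prems 2 in auto)
    then show ?thesis using step.prems(2) by (rule chain.base[rotated])
  next
    case 3
    have "C1_curve_on charts {b..t} \<gamma>"
      by (rule C1_curve_on_subset[OF step.hyps(3)]) (use step.prems 3 in auto)
    then show ?thesis using step.IH[of s b] step.prems 3 by (auto intro: chain.step)
  qed (use step in auto)
qed

lemma chain_continuous: "chain charts \<gamma> a b \<Longrightarrow> continuous_on {a..b} \<gamma>"
proof (induction rule: chain.induct)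
  case (step a b e)
  have "{a..e} = {a..b} \<union> {b..e}" using chain_less[OF step.hyps(1)] step.hyps(2) by auto
  then show ?case using step by (auto simp: C1_curve_on_def intro!: continuous_on_closed_Un)
qed (simp add: C1_curve_on_def)

lemma chain_imp_breakpoints:
  "chain charts \<gamma> a b \<Longrightarrow> \<exists>S. finite S \<and> {a, b} \<subseteq> S \<and> S \<subseteq> {a..b} \<and>
     (\<forall>x\<in>S. \<forall>y\<in>S. x < y \<and> {x<..<y} \<inter> S = {} \<longrightarrow> C1_curve_on charts {x..y} \<gamma>)"
proof (induction rule: chain.induct)
  case (base a b)
  then show ?case by (intro exI[of _ "{a, b}"]) auto
next
  case (step a b e)
  then obtain S where S: "finite S" "{a, b} \<subseteq> S" "S \<subseteq> {a..b}"
    "\<forall>x\<in>S. \<forall>y\<in>S. x < y \<and> {x<..<y} \<inter> S = {} \<longrightarrow> C1_curve_on charts {x..y} \<gamma>" by blast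
  have "C1_curve_on charts {x..y} \<gamma>"
    if "x \<in> insert e S" "y \<in> insert e S" "x < y" "{x<..<y} \<inter> insert e S = {}" for x y
  proof (cases "y = e")
    case True
    then have "x \<in> S" using that by auto
    moreover have "b \<notin> {x<..<y}" using that S by auto
    ultimately have "x = b" using S step.hyps(2) True by fastforce
    then show ?thesis using step.hyps(3) True by simp
  next
    case False
    then have "x \<in> S" "y \<in> S" using that S step.hyps(2) by fastforce+
    then show ?thesis using S(4) that by auto
  qed
  then show ?case
    using S step.hyps(2) chain_less[OF step.hyps(1)]
    by (intro exI[of _ "insert e S"]) auto
qed

lemma breakpoints_imp_chain:
  assumes "finite S" "a < b" "{a, b} \<subseteq> S" "S \<subseteq> {a..b}"
    "\<forall>x\<in>S. \<forall>y\<in>S. x < y \<and> {x<..<y} \<inter> S = {} \<longrightarrow> C1_curve_on charts {x..y} \<gamma>"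
  shows "chain charts \<gamma> a b"
  using assms
proof (induction "card S" arbitrary: S b rule: less_induct)
  case less
  define m where "m = Max (S - {b})"
  have fin: "finite (S - {b})" and ne: "S - {b} \<noteq> {}" using less.prems by auto
  have m: "m \<in> S" "m \<noteq> b" using Max_in[OF fin ne] by (auto simp: m_def)
  have le: "x \<le> m" if "x \<in> S" "x \<noteq> b" for x using Max_ge[OF fin] that by (auto simp: m_def)
  have mb: "m < b" using m less.prems(4) by force
  have "{m<..<b} \<inter> S = {}" using le by force
  then have C: "C1_curve_on charts {m..b} \<gamma>" using less.prems m mb by auto
  show ?case
  proof (cases "m = a")
    case True
    then show ?thesis using C mb by (auto intro: chain.base)
  next
    case False
    then have "a < m" using m less.prems(4) by force
    have "chain charts \<gamma> a m"
    proof (rule less.hyps[of "S - {b}"])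
      show "card (S - {b}) < card S" using less.prems by (intro card_Diff1_less) auto
      show "S - {b} \<subseteq> {a..m}" using le less.prems(4) by fastforce
      show "\<forall>x\<in>S - {b}. \<forall>y\<in>S - {b}. x < y \<and> {x<..<y} \<inter> (S - {b}) = {} \<longrightarrow> C1_curve_on charts {x..y} \<gamma>"
      proof (intro ballI impI)
        fix x y
        assume "x \<in> S - {b}" "y \<in> S - {b}" "x < y \<and> {x<..<y} \<inter> (S - {b}) = {}"
        note xy = this
        have "b \<notin> {x<..<y}" using xy(2) le[of y] mb by auto
        then have "{x<..<y} \<inter> S = {}" using xy(3) by blast
        then show "C1_curve_on charts {x..y} \<gamma>" using less.prems(5) xy by blast
      qed
    qed (use \<open>a < m\<close> m less.prems fin in auto)
    then show ?thesis using mb C by (rule chain.step)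
  qed
qed

lemma piecewise_C1_curve_iff_chain: "piecewise_C1_curve charts \<gamma> \<longleftrightarrow> chain charts \<gamma> 0 1"
proof
  assume "chain charts \<gamma> 0 1"
  from chain_imp_breakpoints[OF this] show "piecewise_C1_curve charts \<gamma>"
    unfolding piecewise_C1_curve_def .
next
  assume "piecewise_C1_curve charts \<gamma>"
  then obtain S where "finite S" "{0, 1} \<subseteq> S" "S \<subseteq> {0..1}"
    "\<forall>a\<in>S. \<forall>b\<in>S. a < b \<and> {a<..<b} \<inter> S = {} \<longrightarrow> C1_curve_on charts {a..b} \<gamma>"
    unfolding piecewise_C1_curve_def by (elim exE conjE)
  then show "chain charts \<gamma> 0 1" by (intro breakpoints_imp_chain[of S 0 1]) simp_all
qed

context riemannian_manifold begin

lemma velocity_change: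
  assumes v: "((snd c \<circ> \<gamma>) has_vector_derivative v) (at t within I)"
    and cont: "continuous (at t within I) \<gamma>" and "t \<in> I"
    and cc: "c \<in> charts" "c' \<in> charts" "\<gamma> t \<in> fst c" "\<gamma> t \<in> fst c'"
  shows "((snd c' \<circ> \<gamma>) has_vector_derivative (coord_jacobian c c' (\<gamma> t) *v v)) (at t within I)"
proof -
  have "((snd c' \<circ> inv_chart c) has_derivative (*v) (coord_jacobian c c' (\<gamma> t)))
      (at ((snd c \<circ> \<gamma>) t) within (snd c \<circ> \<gamma>) ` I)"
    using has_derivative_at_withinI[OF transition_derivative[OF cc]] by simp
  from vector_derivative_diff_chain_within[OF v this]
  have 1: "((snd c' \<circ> inv_chart c \<circ> (snd c \<circ> \<gamma>)) has_vector_derivative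
      (coord_jacobian c c' (\<gamma> t) *v v)) (at t within I)" .
  have "\<forall>\<^sub>F s in at t within I. \<gamma> s \<in> fst c"
    using topological_tendstoD[OF cont[unfolded continuous_within] open_chart(1)[OF cc(1)] cc(3)] .
  then have "\<forall>\<^sub>F s in at t within I. (snd c' \<circ> inv_chart c \<circ> (snd c \<circ> \<gamma>)) s = (snd c' \<circ> \<gamma>) s"
    by eventually_elim (simp add: inv_chart_chart cc(1))
  then show ?thesis
    using 1 assms(3) cc unfolding has_vector_derivative_def
    by (auto intro: has_derivative_transform_eventually simp: inv_chart_chart)
qed

lemma pspeed_eq:
  assumes v: "((snd c \<circ> \<gamma>) has_vector_derivative v) (at t within I)"
    and cont: "continuous (at t within I) \<gamma>" and "t \<in> I" "at t within I \<noteq> bot"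
    and cc: "c \<in> charts" "\<gamma> t \<in> fst c"
  shows "pspeed charts g I \<gamma> t = sqrt (quad (g c (\<gamma> t)) v v)"
proof -
  let ?c = "chart_at charts (\<gamma> t)"
  have "vector_derivative (snd ?c \<circ> \<gamma>) (at t within I) = coord_jacobian c ?c (\<gamma> t) *v v"
    by (rule vector_derivative_within[OF assms(4)
          velocity_change[OF v cont assms(3) cc(1) chart_at_in(1) cc(2) chart_at_in(2)]])
  then show ?thesis
    by (simp add: pspeed_def Let_def quad_change[OF cc(1) chart_at_in(1) cc(2) chart_at_in(2)])
qed

lemma C1_curve_velocity:
  assumes "C1_curve_on charts I \<gamma>" "c \<in> charts"
  obtains v where "continuous_on {t\<in>I. \<gamma> t \<in> fst c} v"
    "\<And>t. t \<in> I \<Longrightarrow> \<gamma> t \<in> fst c \<Longrightarrow> ((snd c \<circ> \<gamma>) has_vector_derivative v t) (at t within I)"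
  using assms unfolding C1_curve_on_def by meson

lemma C1_curve_velocity_at:
  assumes "C1_curve_on charts I \<gamma>" "c \<in> charts" "t \<in> I" "\<gamma> t \<in> fst c"
  obtains w where "((snd c \<circ> \<gamma>) has_vector_derivative w) (at t within I)"
  using assms unfolding C1_curve_on_def by blast

lemma pspeed_nonneg: "pspeed charts g I \<gamma> t \<ge> 0"
  by (simp add: pspeed_def Let_def quad_nonneg posdef_metric chart_at_in)

lemma within_Icc_nontrivial: "a < b \<Longrightarrow> t \<in> {a..b} \<Longrightarrow> at t within {a..b::real} \<noteq> bot"
  by (metis islimpt_Icc atLeastAtMost_iff trivial_limit_within)

lemma pspeed_interior: "t \<in> {a<..<b} \<Longrightarrow> pspeed charts g {a..b} \<gamma> t = pspeed charts g UNIV \<gamma> t"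
  by (simp add: pspeed_def at_within_Icc_at)

lemma pspeed_continuous:
  assumes C: "C1_curve_on charts {a..b} \<gamma>" and "a < b"
  shows "continuous_on {a..b} (pspeed charts g {a..b} \<gamma>)"
  unfolding continuous_on_eq_continuous_within
proof
  fix t assume t: "t \<in> {a..b}"
  let ?I = "{a..b}" and ?c = "chart_at charts (\<gamma> t)"
  let ?A = "{s\<in>?I. \<gamma> s \<in> fst ?c}"
  have c: "?c \<in> charts" "\<gamma> t \<in> fst ?c" by (rule chart_at_in)+
  have cont: "continuous_on ?I \<gamma>" using C by (simp add: C1_curve_on_def)
  obtain v where v: "continuous_on ?A v"
    "\<And>t. t \<in> ?I \<Longrightarrow> \<gamma> t \<in> fst ?c \<Longrightarrow> ((snd ?c \<circ> \<gamma>) has_vector_derivative v t) (at t within ?I)"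
    by (rule C1_curve_velocity[OF C c(1)]) (rule that)
  have eq: "sqrt (quad (g ?c (\<gamma> s)) (v s) (v s)) = pspeed charts g ?I \<gamma> s" if "s \<in> ?A" for s
    by (rule pspeed_eq[symmetric, OF v(2)])
       (use that cont c within_Icc_nontrivial[OF assms(2)] in \<open>auto simp: continuous_on_eq_continuous_within\<close>)
  have cA: "continuous_on ?A (\<lambda>s. snd ?c (\<gamma> s))"
    by (rule continuous_on_compose2[OF continuous_chart(1)[OF c(1)]])
       (rule continuous_on_subset[OF cont], blast+)
  have "continuous_on ?A (\<lambda>s. g ?c (inv_chart ?c (snd ?c (\<gamma> s))) $ i $ j)" for i j
    by (rule continuous_on_compose2[OF metric_entry_continuous[OF c(1)] cA])
       (simp add: image_subset_iff chart_in)
  then have ge: "continuous_on ?A (\<lambda>s. g ?c (\<gamma> s) $ i $ j)" for i j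
    by (rule continuous_on_eq) (simp add: inv_chart_chart c)
  have "continuous_on ?A (\<lambda>s. sqrt (\<Sum>i\<in>UNIV. v s $ i * (\<Sum>j\<in>UNIV. g ?c (\<gamma> s) $ i $ j * v s $ j)))"
    by (intro continuous_intros ge v(1))
  then have "continuous_on ?A (pspeed charts g ?I \<gamma>)"
    by (rule continuous_on_eq) (simp add: eq[symmetric] inner_vec_def matrix_vector_mult_def)
  then have pA: "continuous (at t within ?A) (pspeed charts g ?I \<gamma>)"
    unfolding continuous_on_eq_continuous_within by (rule bspec) (use t c in blast)
  have "\<exists>T. open T \<and> T \<inter> ?I = \<gamma> -` fst ?c \<inter> ?I"
    using cont open_chart(1)[OF c(1)] unfolding continuous_on_open_invariant by (elim allE impE)
  then obtain T where T: "open T" "T \<inter> ?I = \<gamma> -` fst ?c \<inter> ?I" by (elim exE conjE) (rule that)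
  have "?A = \<gamma> -` fst ?c \<inter> ?I" by blast
  then have A: "?A = T \<inter> ?I" by (rule trans[OF _ T(2)[symmetric]])
  have "t \<in> ?A" using t c by blast
  then have "t \<in> T" unfolding A by blast
  have "at t within ?A = at t within ?I"
    unfolding A by (rule at_within_nhd[OF \<open>t \<in> T\<close> T(1)]) blast
  with pA show "continuous (at t within ?I) (pspeed charts g ?I \<gamma>)" by (simp only:)
qed

lemma C1_curve_length:
  assumes C: "C1_curve_on charts {a..b} \<gamma>" and "a < b"
  shows "(pspeed charts g UNIV \<gamma> has_integral integral {a..b} (pspeed charts g {a..b} \<gamma>)) {a..b}"
proof (rule has_integral_spike_finite[of "{a, b}"])
  show "(pspeed charts g {a..b} \<gamma> has_integral integral {a..b} (pspeed charts g {a..b} \<gamma>)) {a..b}"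
    using pspeed_continuous[OF assms] by (intro integrable_integral integrable_continuous_interval)
qed (auto simp: pspeed_interior)

abbreviation len :: "(real \<Rightarrow> 'a) \<Rightarrow> real \<Rightarrow> real \<Rightarrow> real" where
  "len \<gamma> a b \<equiv> integral {a..b} (pspeed charts g UNIV \<gamma>)"

lemma chain_integrable: "chain charts \<gamma> a b \<Longrightarrow> pspeed charts g UNIV \<gamma> integrable_on {a..b}"
proof (induction rule: chain.induct)
  case (base a b)
  then show ?case using C1_curve_length by blast
next
  case (step a b e)
  then show ?case
    using C1_curve_length[of b e \<gamma>] chain_less[OF step.hyps(1)]
    by (intro Henstock_Kurzweil_Integration.integrable_combine[of a b e]) auto
qed

lemma len_combine:
  "chain charts \<gamma> a b \<Longrightarrow> a \<le> s \<Longrightarrow> s \<le> b \<Longrightarrow> len \<gamma> a s + len \<gamma> s b = len \<gamma> a b"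
  by (intro Henstock_Kurzweil_Integration.integral_combine chain_integrable) auto

lemma len_nonneg: "chain charts \<gamma> a b \<Longrightarrow> len \<gamma> a b \<ge> 0"
  by (intro integral_nonneg chain_integrable pspeed_nonneg)

lemma curve_length_eq: "curve_length charts g \<gamma> = len \<gamma> 0 1"
proof -
  have "speed charts g \<gamma> = pspeed charts g {0..1} \<gamma>" by (auto simp: speed_def pspeed_def)
  then show ?thesis unfolding curve_length_def
    by (intro integral_spike[of "{0, 1}"]) (auto simp: pspeed_interior)
qed

lemma C1_curve_affine:
  fixes k :: real
  assumes C: "C1_curve_on charts {a..b} \<gamma>" and "a < b" "a' < b'" "m \<noteq> 0"
    and im: "(\<lambda>t. m * t + k) ` {a'..b'} = {a..b}"
  defines "\<gamma>' \<equiv> \<lambda>t. \<gamma> (m * t + k)"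
  shows "C1_curve_on charts {a'..b'} \<gamma>'" "len \<gamma>' a' b' = len \<gamma> a b"
proof -
  have in_I: "m * t + k \<in> {a..b}" if "t \<in> {a'..b'}" for t using im that by blast
  have cont: "continuous_on {a..b} \<gamma>" using C by (simp add: C1_curve_on_def)
  have cont': "continuous_on {a'..b'} \<gamma>'"
    unfolding \<gamma>'_def by (rule continuous_on_compose2[OF cont]) (use in_I in \<open>auto intro!: continuous_intros\<close>)
  have aff: "((\<lambda>t. m * t + k) has_vector_derivative m) (at t within {a'..b'})" for t
    by (auto intro!: derivative_eq_intros)
  have deriv: "((snd c \<circ> \<gamma>') has_vector_derivative m *\<^sub>R w) (at t within {a'..b'})"
    if "t \<in> {a'..b'}" "((snd c \<circ> \<gamma>) has_vector_derivative w) (at (m * t + k) within {a..b})" for t w c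
  proof -
    have "((snd c \<circ> \<gamma>) has_vector_derivative w) (at (m * t + k) within (\<lambda>t. m * t + k) ` {a'..b'})"
      using that(2) by (simp only: im)
    from vector_diff_chain_within[OF aff this] show ?thesis by (simp add: \<gamma>'_def comp_def)
  qed
  show C': "C1_curve_on charts {a'..b'} \<gamma>'"
    unfolding C1_curve_on_def
  proof (intro conjI ballI cont')
    fix c assume c: "c \<in> charts"
    obtain v where v: "continuous_on {t\<in>{a..b}. \<gamma> t \<in> fst c} v"
      "\<And>t. t \<in> {a..b} \<Longrightarrow> \<gamma> t \<in> fst c \<Longrightarrow> ((snd c \<circ> \<gamma>) has_vector_derivative v t) (at t within {a..b})"
      by (rule C1_curve_velocity[OF C c]) (rule that)
    have "continuous_on {t\<in>{a'..b'}. \<gamma>' t \<in> fst c} (\<lambda>t. v (m * t + k))"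
      by (rule continuous_on_compose2[OF v(1)]) (use in_I in \<open>auto simp: \<gamma>'_def intro!: continuous_intros\<close>)
    then have "continuous_on {t\<in>{a'..b'}. \<gamma>' t \<in> fst c} (\<lambda>t. m *\<^sub>R v (m * t + k))"
      by (intro continuous_intros)
    moreover have "((snd c \<circ> \<gamma>') has_vector_derivative m *\<^sub>R v (m * t + k)) (at t within {a'..b'})"
      if "t \<in> {a'..b'}" "\<gamma>' t \<in> fst c" for t
      using that in_I by (intro deriv v(2)) (auto simp: \<gamma>'_def)
    ultimately show "\<exists>v. continuous_on {t\<in>{a'..b'}. \<gamma>' t \<in> fst c} v \<and>
       (\<forall>t\<in>{a'..b'}. \<gamma>' t \<in> fst c \<longrightarrow> (snd c \<circ> \<gamma>' has_vector_derivative v t) (at t within {a'..b'}))"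
      by blast
  qed
  have sp: "pspeed charts g {a'..b'} \<gamma>' t = \<bar>m\<bar> * pspeed charts g {a..b} \<gamma> (m * t + k)"
    if t: "t \<in> {a'..b'}" for t
  proof -
    let ?c = "chart_at charts (\<gamma>' t)"
    have c: "?c \<in> charts" "\<gamma>' t \<in> fst ?c" "\<gamma> (m * t + k) \<in> fst ?c"
      using chart_at_in by (auto simp: \<gamma>'_def)
    obtain w where w: "((snd ?c \<circ> \<gamma>) has_vector_derivative w) (at (m * t + k) within {a..b})"
      by (rule C1_curve_velocity_at[OF C c(1) in_I[OF t] c(3)])
    have "pspeed charts g {a..b} \<gamma> (m * t + k) = sqrt (quad (g ?c (\<gamma>' t)) w w)"
      using pspeed_eq[OF w _ in_I[OF t] within_Icc_nontrivial[OF assms(2) in_I[OF t]] c(1,3)]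
        cont in_I[OF t] by (simp add: continuous_on_eq_continuous_within \<gamma>'_def)
    moreover have "pspeed charts g {a'..b'} \<gamma>' t = sqrt (quad (g ?c (\<gamma>' t)) (m *\<^sub>R w) (m *\<^sub>R w))"
      using pspeed_eq[OF deriv[OF t w] _ t within_Icc_nontrivial[OF assms(3) t] c(1,2)]
        cont' t by (simp add: continuous_on_eq_continuous_within)
    ultimately show ?thesis
      by (simp add: matrix_vector_mult_scaleR real_sqrt_mult mult.assoc[symmetric] power2_eq_square[symmetric])
  qed
  have img: "(\<lambda>x. (1 / m) *\<^sub>R x + - ((1 / m) *\<^sub>R k)) ` cbox a b = {a'..b'}"
    unfolding cbox_interval im[symmetric] image_image using assms(4) by (simp add: field_simps)
  have "(pspeed charts g {a..b} \<gamma> has_integral integral {a..b} (pspeed charts g {a..b} \<gamma>)) (cbox a b)"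
    using pspeed_continuous[OF C assms(2)]
    by (auto intro!: integrable_integral integrable_continuous_interval)
  from has_integral_affinity[OF this assms(4), of k]
  have "((\<lambda>t. pspeed charts g {a..b} \<gamma> (m * t + k)) has_integral
      (1 / \<bar>m\<bar>) * integral {a..b} (pspeed charts g {a..b} \<gamma>)) {a'..b'}"
    by (simp only: img) simp
  from has_integral_mult_right[OF this, of "\<bar>m\<bar>"]
  have "((\<lambda>t. \<bar>m\<bar> * pspeed charts g {a..b} \<gamma> (m * t + k)) has_integral
      integral {a..b} (pspeed charts g {a..b} \<gamma>)) {a'..b'}" using assms(4) by simp
  then have "(pspeed charts g {a'..b'} \<gamma>' has_integral integral {a..b} (pspeed charts g {a..b} \<gamma>)) {a'..b'}"
    by (rule has_integral_eq[rotated]) (simp add: sp)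
  then show "len \<gamma>' a' b' = len \<gamma> a b"
    using C1_curve_length[OF C assms(2)] C1_curve_length[OF C' assms(3)]
    by (simp add: integral_unique)
qed

lemma chain_affine:
  fixes k :: real
  assumes "chain charts \<gamma> a b" "m > 0"
  defines "\<gamma>' \<equiv> \<lambda>t. \<gamma> (m * t + k)"
  shows "chain charts \<gamma>' ((a - k) / m) ((b - k) / m) \<and> len \<gamma>' ((a - k) / m) ((b - k) / m) = len \<gamma> a b"
  using assms(1)
proof (induction rule: chain.induct)
  have im: "(\<lambda>t. m * t + k) ` {(x - k) / m..(y - k) / m} = {x..y}" for x y
  proof (intro equalityI subsetI)
    fix s assume "s \<in> {x..y}"
    then show "s \<in> (\<lambda>t. m * t + k) ` {(x - k) / m..(y - k) / m}"
      using assms(2) by (intro image_eqI[of _ _ "(s - k) / m"]) (auto simp: divide_right_mono)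
  qed (use assms(2) in \<open>auto simp: field_simps\<close>)
  have lt: "(x - k) / m < (y - k) / m" if "x < y" for x y
    using that assms(2) by (simp add: divide_strict_right_mono)
  {
    case (base a b)
    show ?case
      using C1_curve_affine[OF base(2,1) lt[OF base(1)] _ im] assms(2) lt[OF base(1)]
      by (auto simp: \<gamma>'_def intro: chain.base)
  next
    case (step a b e)
    note C = C1_curve_affine[OF step(3,2) lt[OF step(2)] _ im]
    have ch: "chain charts \<gamma>' ((a - k) / m) ((e - k) / m)"
      by (rule chain.step[OF conjunct1[OF step.IH] lt[OF step(2)]]) (use C(1) assms(2) in \<open>simp add: \<gamma>'_def\<close>)
    have "len \<gamma>' ((a - k) / m) ((e - k) / m) = len \<gamma>' ((a - k) / m) ((b - k) / m) + len \<gamma>' ((b - k) / m) ((e - k) / m)"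
      using len_combine[OF ch, of "(b - k) / m"] lt[OF step(2)] lt[OF chain_less[OF step(1)]] by simp
    also have "\<dots> = len \<gamma> a b + len \<gamma> b e" using step.IH C(2) assms(2) by (simp add: \<gamma>'_def)
    also have "\<dots> = len \<gamma> a e"
      by (rule len_combine[OF chain.step[OF step(1,2,3)]]) (use step chain_less in force)+
    finally show ?case using ch by simp
  }
qed

lemma chain_reverse:
  assumes "chain charts \<gamma> a b"
  defines "\<gamma>' \<equiv> \<lambda>t. \<gamma> (- t)"
  shows "chain charts \<gamma>' (- b) (- a) \<and> len \<gamma>' (- b) (- a) = len \<gamma> a b"
  using assms(1)
proof (induction rule: chain.induct)
  have im: "(\<lambda>t. (-1) * t + 0) ` {- y..- x} = {x..y}" for x y :: real by simp
  {
    case (base a b)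
    show ?case
      using C1_curve_affine[OF base(2,1) _ _ im] base(1)
      by (auto simp: \<gamma>'_def intro: chain.base)
  next
    case (step a b e)
    note C = C1_curve_affine[OF step(3,2) _ _ im]
    have ch: "chain charts \<gamma>' (- e) (- a)"
      by (rule chain_join[OF conjunct1[OF step.IH]], rule chain.base)
         (use C(1) step(2) in \<open>simp_all add: \<gamma>'_def\<close>)
    have "len \<gamma>' (- e) (- a) = len \<gamma>' (- e) (- b) + len \<gamma>' (- b) (- a)"
      using len_combine[OF ch, of "- b"] step(2) chain_less[OF step(1)] by simp
    also have "\<dots> = len \<gamma> a b + len \<gamma> b e" using step.IH C(2) step(2) by (simp add: \<gamma>'_def)
    also have "\<dots> = len \<gamma> a e"
      by (rule len_combine[OF chain.step[OF step(1,2,3)]]) (use step chain_less in force)+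
    finally show ?case using ch by simp
  }
qed

lemma C1_curve_gradient_bound:
  assumes h: "C1 h" "\<And>p. grad_norm charts g h p \<le> L"
    and base: "a < b" "C1_curve_on charts {a..b} \<gamma>"
  shows "\<bar>h (\<gamma> b) - h (\<gamma> a)\<bar> \<le> L * len \<gamma> a b"
proof -
  have cont: "continuous_on {a..b} \<gamma>" using base by (simp add: C1_curve_on_def)
  have "\<exists>d. ((\<lambda>t. h (\<gamma> t)) has_vector_derivative d) (at t within {a..b}) \<and>
      \<bar>d\<bar> \<le> L * pspeed charts g {a..b} \<gamma> t" if t: "t \<in> {a..b}" for t
  proof -
    let ?c = "chart_at charts (\<gamma> t)"
    have c: "?c \<in> charts" "\<gamma> t \<in> fst ?c" by (rule chart_at_in)+
    obtain w where w: "((snd ?c \<circ> \<gamma>) has_vector_derivative w) (at t within {a..b})"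
      by (rule C1_curve_velocity_at[OF base(2) c(1) t c(2)])
    have ct: "continuous (at t within {a..b}) \<gamma>"
      using cont t by (simp add: continuous_on_eq_continuous_within)
    have sp: "pspeed charts g {a..b} \<gamma> t = sqrt (quad (g ?c (\<gamma> t)) w w)"
      by (rule pspeed_eq[OF w ct t within_Icc_nontrivial[OF base(1) t] c])
    have "((h \<circ> inv_chart ?c) has_derivative chart_deriv ?c h (\<gamma> t))
        (at ((snd ?c \<circ> \<gamma>) t) within (snd ?c \<circ> \<gamma>) ` {a..b})"
      using has_derivative_at_withinI[OF C1_chart_deriv[OF h(1) c]] by simp
    from vector_derivative_diff_chain_within[OF w this]
    have 1: "((h \<circ> inv_chart ?c \<circ> (snd ?c \<circ> \<gamma>)) has_vector_derivative
        chart_deriv ?c h (\<gamma> t) w) (at t within {a..b})" .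
    have "\<forall>\<^sub>F s in at t within {a..b}. \<gamma> s \<in> fst ?c"
      using ct c(2) open_chart(1)[OF c(1)] by (simp add: continuous_within topological_tendstoD)
    then have "\<forall>\<^sub>F s in at t within {a..b}. (h \<circ> inv_chart ?c \<circ> (snd ?c \<circ> \<gamma>)) s = h (\<gamma> s)"
      by eventually_elim (simp add: inv_chart_chart c(1))
    then have "((\<lambda>t. h (\<gamma> t)) has_vector_derivative chart_deriv ?c h (\<gamma> t) w) (at t within {a..b})"
      using 1 t c unfolding has_vector_derivative_def
      by (auto intro: has_derivative_transform_eventually simp: inv_chart_chart)
    moreover have "\<bar>chart_deriv ?c h (\<gamma> t) w\<bar> \<le> L * pspeed charts g {a..b} \<gamma> t"
      using chart_deriv_bound[OF h(1) c, of w] mult_right_mono[OF h(2)[of "\<gamma> t"], of "sqrt (quad (g ?c (\<gamma> t)) w w)"]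
      by (simp add: sp quad_nonneg posdef_metric c)
    ultimately show ?thesis by blast
  qed
  then obtain d where d: "\<And>t. t \<in> {a..b} \<Longrightarrow> ((\<lambda>t. h (\<gamma> t)) has_vector_derivative d t) (at t within {a..b})"
    "\<And>t. t \<in> {a..b} \<Longrightarrow> \<bar>d t\<bar> \<le> L * pspeed charts g {a..b} \<gamma> t" by metis
  have di: "(d has_integral (h (\<gamma> b) - h (\<gamma> a))) {a..b}"
    using base(1) by (intro fundamental_theorem_of_calculus d) auto
  have pi: "pspeed charts g {a..b} \<gamma> integrable_on {a..b}"
    by (intro integrable_continuous_interval pspeed_continuous base)
  have "norm (integral {a..b} d) \<le> integral {a..b} (\<lambda>t. L * pspeed charts g {a..b} \<gamma> t)"
    using di integrable_cmul[OF pi, of L] d(2) by (intro integral_norm_bound_integral) auto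
  then show ?thesis
    using di C1_curve_length[OF base(2,1)] by (simp add: integral_unique)
qed

text \<open>Along a curve, a function varies by at most its gradient bound times the length. This is
  what bounds the Riemannian distance from below.\<close>

lemma chain_gradient_bound:
  assumes "C1 h" "\<And>p. grad_norm charts g h p \<le> L" and "chain charts \<gamma> a b"
  shows "\<bar>h (\<gamma> b) - h (\<gamma> a)\<bar> \<le> L * len \<gamma> a b"
  using assms(3)
proof (induction rule: chain.induct)
  case (base a b)
  then show ?case by (rule C1_curve_gradient_bound[OF assms(1,2)])
next
  case (step a b e)
  have "len \<gamma> a b + len \<gamma> b e = len \<gamma> a e"
    by (rule len_combine[OF chain.step[OF step(1,2,3)]]) (use step chain_less in force)+
  then have "L * len \<gamma> a e = L * len \<gamma> a b + L * len \<gamma> b e" by (metis distrib_left)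
  with C1_curve_gradient_bound[OF assms(1,2) step(2,3)] step.IH show ?case by linarith
qed

end


section \<open>The Riemannian distance\<close>

locale connected_riemannian_manifold = riemannian_manifold charts g
  for charts :: "('a::{t2_space, second_countable_topology}, 'n::finite) chart set" and g +
  assumes connected_manifold: "connected (UNIV :: 'a set)"

context riemannian_manifold begin

abbreviation rdist :: "'a \<Rightarrow> 'a \<Rightarrow> real" where "rdist \<equiv> riem_dist charts g"

lemma pspeed_cong:
  assumes "open T" "t \<in> T" "\<And>s. s \<in> T \<Longrightarrow> \<gamma> s = \<gamma>' s"
  shows "pspeed charts g UNIV \<gamma> t = pspeed charts g UNIV \<gamma>' t"
proof -
  have "\<forall>\<^sub>F s in nhds t. \<gamma> s = \<gamma>' s" using assms by (auto simp: eventually_nhds)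
  then have "vector_derivative (snd c \<circ> \<gamma>) (at t) = vector_derivative (snd c \<circ> \<gamma>') (at t)" for c :: "('a, 'n) chart"
    by (intro vector_derivative_cong_eq) (auto elim: eventually_mono)
  then show ?thesis using assms by (simp add: pspeed_def)
qed

text \<open>Leaving the parameter interval free turns concatenation of curves into gluing after a shift.\<close>

definition joins :: "'a \<Rightarrow> 'a \<Rightarrow> real \<Rightarrow> bool" where
  "joins p q l \<longleftrightarrow> (\<exists>\<gamma> a b. chain charts \<gamma> a b \<and> \<gamma> a = p \<and> \<gamma> b = q \<and> l = len \<gamma> a b)"

lemma joinsI: "chain charts \<gamma> a b \<Longrightarrow> joins (\<gamma> a) (\<gamma> b) (len \<gamma> a b)"
  unfolding joins_def by blast

lemma joins_unit_interval:
  assumes "joins p q l"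
  obtains \<gamma> where "chain charts \<gamma> 0 1" "\<gamma> 0 = p" "\<gamma> 1 = q" "l = len \<gamma> 0 1"
proof -
  obtain \<gamma> a b where *: "chain charts \<gamma> a b" "\<gamma> a = p" "\<gamma> b = q" "l = len \<gamma> a b"
    using assms unfolding joins_def by blast
  have "a < b" by (rule chain_less[OF *(1)])
  with chain_affine[OF *(1), of "b - a" a] show ?thesis
    by (intro that[of "\<lambda>t. \<gamma> ((b - a) * t + a)"]) (simp_all add: *)
qed

lemma riem_dist_joins: "rdist p q = Inf {l. joins p q l}"
proof -
  have "{curve_length charts g \<gamma> |\<gamma>. piecewise_C1_curve charts \<gamma> \<and> \<gamma> 0 = p \<and> \<gamma> 1 = q} = {l. joins p q l}"
  proof (intro equalityI subsetI)
    fix l assume "l \<in> {l. joins p q l}"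
    then have "joins p q l" by simp
    from joins_unit_interval[OF this]
    show "l \<in> {curve_length charts g \<gamma> |\<gamma>. piecewise_C1_curve charts \<gamma> \<and> \<gamma> 0 = p \<and> \<gamma> 1 = q}"
      unfolding piecewise_C1_curve_iff_chain curve_length_eq by blast
  qed (auto simp: piecewise_C1_curve_iff_chain curve_length_eq joins_def)
  then show ?thesis by (simp add: riem_dist_def)
qed

lemma joins_nonneg: "joins p q l \<Longrightarrow> l \<ge> 0"
  unfolding joins_def using len_nonneg by blast

lemma joins_sym: "joins p q l \<Longrightarrow> joins q p l"
proof -
  assume "joins p q l"
  then obtain \<gamma> a b where *: "chain charts \<gamma> a b" "\<gamma> a = p" "\<gamma> b = q" "l = len \<gamma> a b"
    unfolding joins_def by blast
  from joinsI[OF conjunct1[OF chain_reverse[OF *(1)]]] conjunct2[OF chain_reverse[OF *(1)]]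
  show ?thesis by (simp add: *)
qed

lemma joins_trans:
  assumes "joins p q k" "joins q s l" shows "joins p s (k + l)"
proof -
  obtain \<gamma>1 where 1: "chain charts \<gamma>1 0 1" "\<gamma>1 0 = p" "\<gamma>1 1 = q" "k = len \<gamma>1 0 1"
    using joins_unit_interval[OF assms(1)] by blast
  obtain \<gamma> where 2: "chain charts \<gamma> 0 1" "\<gamma> 0 = q" "\<gamma> 1 = s" "l = len \<gamma> 0 1"
    using joins_unit_interval[OF assms(2)] by blast
  define \<gamma>2 where "\<gamma>2 t = \<gamma> (t - 1)" for t
  have 3: "chain charts \<gamma>2 1 2" "l = len \<gamma>2 1 2"
    using chain_affine[OF 2(1), of 1 "-1"] 2(4) by (simp_all add: \<gamma>2_def[abs_def])
  define \<beta> where "\<beta> t = (if t \<le> 1 then \<gamma>1 t else \<gamma>2 t)" for t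
  have b1: "\<beta> t = \<gamma>1 t" if "t \<le> 1" for t using that by (simp add: \<beta>_def)
  have b2: "\<beta> t = \<gamma>2 t" if "1 \<le> t" for t
    using that 1(3) 2(2) by (auto simp: \<beta>_def \<gamma>2_def)
  have c1: "chain charts \<beta> 0 1" by (rule chain_cong[OF 1(1)]) (simp add: b1)
  have c2: "chain charts \<beta> 1 2" by (rule chain_cong[OF 3(1)]) (simp add: b2)
  have c: "chain charts \<beta> 0 2" by (rule chain_join[OF c2 c1])
  have ev1: "pspeed charts g UNIV \<beta> t = pspeed charts g UNIV \<gamma>1 t" if "0 < t" "t < 1" for t
    using that by (intro pspeed_cong[of "{0<..<1}"]) (auto simp: b1)
  have ev2: "pspeed charts g UNIV \<beta> t = pspeed charts g UNIV \<gamma>2 t" if "1 < t" "t < 2" for t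
    using that by (intro pspeed_cong[of "{1<..<2}"]) (auto simp: b2)
  have "len \<beta> 0 1 = len \<gamma>1 0 1" by (rule integral_spike[of "{0, 1}"]) (auto simp: ev1)
  moreover have "len \<beta> 1 2 = len \<gamma>2 1 2" by (rule integral_spike[of "{1, 2}"]) (auto simp: ev2)
  ultimately have "len \<beta> 0 2 = k + l"
    using len_combine[OF c, of 1] 1(4) 3(2) by simp
  moreover have "\<beta> 0 = p" "\<beta> 2 = s" using b1[of 0] b2[of 2] 1 2 by (auto simp: \<gamma>2_def)
  ultimately show ?thesis using joinsI[OF c] by simp
qed

lemma rdist_le: "joins p q l \<Longrightarrow> rdist p q \<le> l"
  unfolding riem_dist_joins by (rule cInf_lower) (auto intro: bdd_belowI[of _ 0] joins_nonneg)

text \<open>Straight coordinate segments bound the distance from above.\<close>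

lemma joins_segment:
  assumes c: "c \<in> charts" and B: "convex B" "B \<subseteq> chart_image c" "y \<in> B" "y' \<in> B"
    and K: "\<And>z. z \<in> B \<Longrightarrow> sqrt (quad (g c (inv_chart c z)) (y' - y) (y' - y)) \<le> K"
  obtains l where "joins (inv_chart c y) (inv_chart c y') l" "l \<le> K"
proof -
  define z where "z t = y + t *\<^sub>R (y' - y)" for t
  define \<gamma> where "\<gamma> t = inv_chart c (z t)" for t
  have zB: "z t \<in> B" if "t \<in> {0..1}" for t
  proof -
    have "z t = (1 - t) *\<^sub>R y + t *\<^sub>R y'" by (simp add: z_def algebra_simps)
    then show ?thesis using that B by (auto simp: convex_alt)
  qed
  have zc: "z t \<in> chart_image c" if "t \<in> {0..1}" for t using zB[OF that] B(2) by blast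
  have cz: "continuous_on S z" for S unfolding z_def by (intro continuous_intros)
  have cont: "continuous_on {0..1} \<gamma>"
    unfolding \<gamma>_def by (rule continuous_on_compose2[OF continuous_chart(2)[OF c] cz]) (use zc in blast)
  have in_c: "\<gamma> t \<in> fst c" "snd c (\<gamma> t) = z t" if "t \<in> {0..1}" for t
    using zc[OF that] c by (simp_all add: \<gamma>_def inv_chart_in chart_inv_chart)
  have vel: "((snd c \<circ> \<gamma>) has_vector_derivative (y' - y)) (at t within {0..1})" if t: "t \<in> {0..1}" for t
  proof (rule has_vector_derivative_transform[OF t])
    show "(z has_vector_derivative (y' - y)) (at t within {0..1})"
      unfolding z_def by (auto intro!: derivative_eq_intros)
    show "\<And>s. s \<in> {0..1} \<Longrightarrow> (snd c \<circ> \<gamma>) s = z s" using in_c(2) by simp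
  qed
  have C: "C1_curve_on charts {0..1} \<gamma>"
    unfolding C1_curve_on_def
  proof (intro conjI ballI cont)
    fix c' assume c': "c' \<in> charts"
    let ?A = "{t \<in> {0..1}. \<gamma> t \<in> fst c'}"
    let ?T = "snd c ` (fst c \<inter> fst c')"
    have cp: "continuous_on ?T (partial j (snd c' \<circ> inv_chart c))" for j
      using charts_compatible[OF c c', unfolded smooth_on_def, rule_format, of "Suc 0"] by simp
    have "z ` ?A \<subseteq> ?T"
    proof (rule image_subsetI)
      fix t assume "t \<in> ?A"
      then show "z t \<in> ?T" using in_c[of t] by (intro image_eqI[of _ _ "\<gamma> t"]) auto
    qed
    then have "continuous_on ?A (\<lambda>t. partial j (snd c' \<circ> inv_chart c) (z t))" for j
      by (rule continuous_on_compose2[OF cp cz])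
    then have "continuous_on ?A (\<lambda>t. \<Sum>j\<in>UNIV. (y' - y) $ j *\<^sub>R partial j (snd c' \<circ> inv_chart c) (z t))"
      by (intro continuous_on_sum continuous_on_scaleR continuous_on_const)
    moreover have "(\<Sum>j\<in>UNIV. (y' - y) $ j *\<^sub>R partial j (snd c' \<circ> inv_chart c) (z t))
        = coord_jacobian c c' (\<gamma> t) *v (y' - y)" if "t \<in> ?A" for t
    proof -
      have t: "t \<in> {0..1}" "\<gamma> t \<in> fst c'" using that by auto
      from frechet_derivative_at[OF transition_derivative[OF c c' in_c(1)[OF t(1)] t(2)]]
      have "frechet_derivative (snd c' \<circ> inv_chart c) (at (z t)) = (*v) (coord_jacobian c c' (\<gamma> t))"
        by (simp add: in_c(2)[OF t(1)])
      then show ?thesis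
        using linear_axis_sum[OF matrix_vector_mul_linear, of "coord_jacobian c c' (\<gamma> t)" "y' - y"] by simp
    qed
    ultimately have "continuous_on ?A (\<lambda>t. coord_jacobian c c' (\<gamma> t) *v (y' - y))"
      by (rule continuous_on_eq)
    moreover have "((snd c' \<circ> \<gamma>) has_vector_derivative (coord_jacobian c c' (\<gamma> t) *v (y' - y))) (at t within {0..1})"
      if "t \<in> {0..1}" "\<gamma> t \<in> fst c'" for t
      using velocity_change[OF vel[OF that(1)] _ that(1) c c' in_c(1)[OF that(1)] that(2)] cont that(1)
      by (simp add: continuous_on_eq_continuous_within)
    ultimately show "\<exists>v. continuous_on ?A v \<and> (\<forall>t\<in>{0..1}. \<gamma> t \<in> fst c' \<longrightarrow>
        ((snd c' \<circ> \<gamma>) has_vector_derivative v t) (at t within {0..1}))" by blast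
  qed
  have sp: "pspeed charts g {0..1} \<gamma> t \<le> K" if t: "t \<in> {0..1}" for t
  proof -
    have "pspeed charts g {0..1} \<gamma> t = sqrt (quad (g c (\<gamma> t)) (y' - y) (y' - y))"
      by (rule pspeed_eq[OF vel[OF t] _ t within_Icc_nontrivial[OF zero_less_one t] c in_c(1)[OF t]])
         (use cont t in \<open>simp add: continuous_on_eq_continuous_within\<close>)
    then show ?thesis using K[OF zB[OF t]] by (simp add: \<gamma>_def)
  qed
  have pi: "pspeed charts g {0..1} \<gamma> integrable_on {0..1}"
    by (intro integrable_continuous_interval pspeed_continuous C zero_less_one)
  have "len \<gamma> 0 1 = integral {0..1} (pspeed charts g {0..1} \<gamma>)"
    using C1_curve_length[OF C zero_less_one] by (rule integral_unique)
  also have "\<dots> \<le> integral {0..1} (\<lambda>t::real. K)" by (intro Henstock_Kurzweil_Integration.integral_le pi integrable_const_ivl sp)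
  finally have "len \<gamma> 0 1 \<le> K" by simp
  moreover have "\<gamma> 0 = inv_chart c y" "\<gamma> 1 = inv_chart c y'" by (simp_all add: \<gamma>_def z_def)
  ultimately show ?thesis
    using that joinsI[OF chain.base[OF zero_less_one C]] by metis
qed

text \<open>On a compact coordinate ball the quadratic forms, restricted to unit vectors, are uniformly
  continuous and bounded below; homogeneity extends the resulting comparison to all vectors.\<close>

lemma metric_comparable:
  assumes "c \<in> charts" "p \<in> fst c" "open U" "p \<in> U"
  obtains t where "t > 0" "cball (snd c p) t \<subseteq> chart_image c" "inv_chart c ` cball (snd c p) t \<subseteq> U"
    "\<And>y v. y \<in> cball (snd c p) t \<Longrightarrow>
       quad (g c (inv_chart c y)) v v \<le> 2 * quad (g c p) v v \<and>
       quad (g c p) v v \<le> 2 * quad (g c (inv_chart c y)) v v"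
proof -
  obtain s where s: "s > 0" "cball (snd c p) s \<subseteq> chart_image c" "inv_chart c ` cball (snd c p) s \<subseteq> U"
    using chart_ball[OF assms] .
  let ?G = "\<lambda>y. g c (inv_chart c y)"
  define q where "q y v = (\<Sum>i\<in>UNIV. v $ i * (\<Sum>j\<in>UNIV. ?G y $ i $ j * v $ j))" for y v
  have q: "q y v = quad (?G y) v v" for y v by (simp add: q_def inner_vec_def matrix_vector_mult_def)
  let ?S = "sphere 0 1 :: (real^'n) set"
  define K where "K = cball (snd c p) s \<times> ?S"
  have cK: "compact K" unfolding K_def by (intro compact_Times) auto
  have ge: "continuous_on K (\<lambda>x. ?G (fst x) $ i $ j)" for i j
    by (rule continuous_on_compose2[OF metric_entry_continuous[OF assms(1)] continuous_on_fst[OF continuous_on_id]])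
       (use s(2) in \<open>auto simp: K_def\<close>)
  have "continuous_on K (\<lambda>x. \<Sum>i\<in>UNIV. snd x $ i * (\<Sum>j\<in>UNIV. ?G (fst x) $ i $ j * snd x $ j))"
    by (intro continuous_intros ge)
  then have cq: "continuous_on K (\<lambda>x. q (fst x) (snd x))" by (simp add: q_def)
  have uc: "uniformly_continuous_on K (\<lambda>x. q (fst x) (snd x))"
    by (rule compact_uniformly_continuous[OF cq cK])
  have pos: "q y v > 0" if "y \<in> cball (snd c p) s" "v \<in> ?S" for y v
  proof -
    have "posdef (?G y)" using that s(2) by (intro posdef_metric inv_chart_in assms(1)) blast+
    moreover have "v \<noteq> 0" using that by auto
    ultimately show ?thesis by (simp add: q posdef_def)
  qed
  have "axis undefined 1 \<in> ?S" by (simp add: norm_axis_1)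
  then have "?S \<noteq> {}" by blast
  then have Kne: "K \<noteq> {}" using s(1) unfolding K_def by auto
  obtain k where k: "k \<in> K" "\<And>x. x \<in> K \<Longrightarrow> q (fst k) (snd k) \<le> q (fst x) (snd x)"
    using continuous_attains_inf[OF cK Kne cq] by blast
  define m where "m = q (fst k) (snd k)"
  have "m > 0" using k(1) pos by (auto simp: m_def K_def)
  have mle: "m \<le> q y v" if "y \<in> cball (snd c p) s" "v \<in> ?S" for y v
    using k(2)[of "(y, v)"] that by (simp add: K_def m_def)
  obtain d where d: "d > 0" "\<And>x x'. x \<in> K \<Longrightarrow> x' \<in> K \<Longrightarrow> dist x' x < d \<Longrightarrow>
      dist (q (fst x') (snd x')) (q (fst x) (snd x)) < m"
    using uc \<open>m > 0\<close> unfolding uniformly_continuous_on_def by metis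
  define t where "t = min s (d / 2)"
  have t: "t > 0" "t \<le> s" "t < d" using s d by (auto simp: t_def)
  have unit: "q y v \<le> 2 * q (snd c p) v \<and> q (snd c p) v \<le> 2 * q y v"
    if y: "y \<in> cball (snd c p) t" and v: "v \<in> ?S" for y v
  proof -
    have in_K: "(y, v) \<in> K" "(snd c p, v) \<in> K" using y v t s(1) by (auto simp: K_def)
    have "dist (q y v) (q (snd c p) v) < m"
      using d(2)[OF in_K(2,1)] y t by (simp add: dist_Pair_Pair dist_commute)
    moreover have "m \<le> q y v" "m \<le> q (snd c p) v" using mle in_K by (auto simp: K_def)
    ultimately show ?thesis by (simp add: dist_real_def abs_less_iff)
  qed
  have hom: "q y (a *\<^sub>R v) = a\<^sup>2 * q y v" for y a v
    by (simp add: q matrix_vector_mult_scaleR power2_eq_square)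
  have "q y v \<le> 2 * q (snd c p) v \<and> q (snd c p) v \<le> 2 * q y v" if y: "y \<in> cball (snd c p) t" for y v
  proof (cases "v = 0")
    case False
    define e where "e = (1 / norm v) *\<^sub>R v"
    have v: "v = norm v *\<^sub>R e" and e: "e \<in> ?S" using False by (auto simp: e_def)
    have qv: "q z v = (norm v)\<^sup>2 * q z e" for z
      using arg_cong[OF v, of "q z"] hom[of z "norm v" e] by (rule trans)
    have "(norm v)\<^sup>2 * q y e \<le> (norm v)\<^sup>2 * (2 * q (snd c p) e)"
      "(norm v)\<^sup>2 * q (snd c p) e \<le> (norm v)\<^sup>2 * (2 * q y e)"
      using unit[OF y e] by (intro mult_left_mono; simp)+
    then show ?thesis by (simp only: qv) (simp only: mult.left_commute mult.commute)
  qed (simp add: q)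
  then have *: "quad (?G y) v v \<le> 2 * quad (g c p) v v \<and> quad (g c p) v v \<le> 2 * quad (?G y) v v"
    if "y \<in> cball (snd c p) t" for y v
    using that by (simp add: q inv_chart_chart assms)
  show ?thesis
  proof (rule that[OF t(1)])
    show "cball (snd c p) t \<subseteq> chart_image c" using s(2) t(2) subset_cball by fast
    show "inv_chart c ` cball (snd c p) t \<subseteq> U" using s(3) t(2) subset_cball by fast
  qed (rule *)
qed

lemma quad_le_norm:
  fixes A :: "real^'n^'n"
  obtains L where "L > 0" "\<And>v. quad A v v \<le> L * (norm v)\<^sup>2"
proof -
  obtain K where K: "\<And>v. norm (A *v v) \<le> norm v * K"
    using bounded_linear.bounded[OF matrix_vector_mul_bounded_linear[of A]] by blast
  have "quad A v v \<le> max K 1 * (norm v)\<^sup>2" for v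
  proof -
    have "quad A v v \<le> norm v * norm (A *v v)" by (rule norm_cauchy_schwarz)
    also have "\<dots> \<le> norm v * (norm v * max K 1)"
      using K[of v] by (intro mult_left_mono order_trans[OF K] mult_left_mono) auto
    finally show ?thesis by (simp add: power2_eq_square mult_ac)
  qed
  then show ?thesis by (intro that[of "max K 1"]) auto
qed

lemma joins_nearby:
  assumes "s > 0"
  obtains U where "open U" "p \<in> U" "\<And>q. q \<in> U \<Longrightarrow> \<exists>l<s. joins p q l"
proof -
  let ?c = "chart_at charts p"
  have c: "?c \<in> charts" "p \<in> fst ?c" by (rule chart_at_in)+
  obtain t where t: "t > 0" "cball (snd ?c p) t \<subseteq> chart_image ?c"
    "\<And>y v. y \<in> cball (snd ?c p) t \<Longrightarrow> quad (g ?c (inv_chart ?c y)) v v \<le> 2 * quad (g ?c p) v v \<and>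
       quad (g ?c p) v v \<le> 2 * quad (g ?c (inv_chart ?c y)) v v"
    using metric_comparable[OF c open_UNIV UNIV_I] by metis
  obtain L where L: "L > 0" "\<And>v. quad (g ?c p) v v \<le> L * (norm v)\<^sup>2" using quad_le_norm by blast
  define e where "e = min t (s / (2 * sqrt (2 * L)))"
  have e: "e > 0" "e \<le> t" "sqrt (2 * L) * e < s"
  proof -
    have "sqrt (2 * L) > 0" using L by simp
    then show "e > 0" "e \<le> t" using t assms by (auto simp: e_def)
    have "sqrt (2 * L) * e \<le> sqrt (2 * L) * (s / (2 * sqrt (2 * L)))"
      using \<open>sqrt (2 * L) > 0\<close> by (intro mult_left_mono) (auto simp: e_def)
    also have "\<dots> = s / 2" using \<open>sqrt (2 * L) > 0\<close> by simp
    finally show "sqrt (2 * L) * e < s" using assms by linarith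
  qed
  have sub: "ball (snd ?c p) e \<subseteq> cball (snd ?c p) t" using e(2) by auto
  show ?thesis
  proof (rule that)
    show "open (inv_chart ?c ` ball (snd ?c p) e)"
      using open_inv_chart_image[OF c(1) open_ball] sub t(2) by blast
    show "p \<in> inv_chart ?c ` ball (snd ?c p) e"
      using e(1) inv_chart_chart[OF c] by (intro image_eqI[of _ _ "snd ?c p"]) auto
    fix q assume "q \<in> inv_chart ?c ` ball (snd ?c p) e"
    then obtain y where y: "q = inv_chart ?c y" "y \<in> ball (snd ?c p) e" by blast
    have K: "sqrt (quad (g ?c (inv_chart ?c z)) (y - snd ?c p) (y - snd ?c p)) \<le> sqrt (2 * L) * e"
      if z: "z \<in> cball (snd ?c p) t" for z
    proof -
      have "quad (g ?c (inv_chart ?c z)) (y - snd ?c p) (y - snd ?c p) \<le> 2 * (L * (norm (y - snd ?c p))\<^sup>2)"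
        using t(3)[OF z, of "y - snd ?c p"] L(2)[of "y - snd ?c p"] by linarith
      also have "\<dots> \<le> 2 * (L * e\<^sup>2)"
        using y(2) L(1) by (intro mult_left_mono power_mono) (auto simp: dist_norm norm_minus_commute)
      finally have "sqrt (quad (g ?c (inv_chart ?c z)) (y - snd ?c p) (y - snd ?c p)) \<le> sqrt (2 * L * e\<^sup>2)"
        by (simp add: mult.assoc)
      then show ?thesis using e(1) by (simp add: real_sqrt_mult)
    qed
    have p0: "snd ?c p \<in> cball (snd ?c p) t" using t(1) by simp
    have y0: "y \<in> cball (snd ?c p) t" using sub y(2) by blast
    obtain l where "joins (inv_chart ?c (snd ?c p)) (inv_chart ?c y) l" "l \<le> sqrt (2 * L) * e"
      by (rule joins_segment[OF c(1) convex_cball t(2) p0 y0 K]) (assumption, rule that)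
    then show "\<exists>l<s. joins p q l"
      using e(3) y(1) by (intro exI[of _ l]) (simp add: inv_chart_chart c)
  qed
qed

lemma manifold_bump:
  assumes "open U" "p \<in> U"
  obtains h V K where "C1 h" "\<And>q. 0 \<le> h q" "\<And>q. h q \<le> 1" "open V" "p \<in> V" "\<And>q. q \<in> V \<Longrightarrow> h q = 1"
    "compact K" "K \<subseteq> U" "\<And>q. q \<notin> K \<Longrightarrow> h q = 0"
proof -
  let ?c = "chart_at charts p"
  have c: "?c \<in> charts" "p \<in> fst ?c" by (rule chart_at_in)+
  obtain t where t: "t > 0" "cball (snd ?c p) t \<subseteq> chart_image ?c" "inv_chart ?c ` cball (snd ?c p) t \<subseteq> U"
    using chart_ball[OF c assms] .
  define F where "F x = cutoff ((t/2)\<^sup>2) (t\<^sup>2) ((x - snd ?c p) \<bullet> (x - snd ?c p))" for x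
  have lt: "0 < t/2" "t/2 < t" using t(1) by auto
  note F = coordinate_bump[OF lt, where y = "snd ?c p", folded F_def F_def[abs_def]]
  have sub: "ball (snd ?c p) (t/2) \<subseteq> chart_image ?c" using t by (auto simp: subset_iff)
  show ?thesis
  proof (rule that[of "pull ?c F" "inv_chart ?c ` ball (snd ?c p) (t/2)" "inv_chart ?c ` cball (snd ?c p) t"])
    show "C1 (pull ?c F)" by (rule Ck_function_pull[OF c(1) compact_cball t(2) F(5) F(1)])
    show "0 \<le> pull ?c F q" "pull ?c F q \<le> 1" for q using F(2,3) by (auto simp: pull_def)
    show "open (inv_chart ?c ` ball (snd ?c p) (t/2))" by (rule open_inv_chart_image[OF c(1) open_ball sub])
    show "p \<in> inv_chart ?c ` ball (snd ?c p) (t/2)"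
      using lt inv_chart_chart[OF c] by (intro image_eqI[of _ _ "snd ?c p"]) auto
    show "pull ?c F q = 1" if "q \<in> inv_chart ?c ` ball (snd ?c p) (t/2)" for q
      using that sub by (auto simp: pull_comp_inv_chart[OF c(1)] subset_iff F(4))
    show "compact (inv_chart ?c ` cball (snd ?c p) t)" by (rule compact_inv_chart[OF c(1) compact_cball t(2)])
    show "inv_chart ?c ` cball (snd ?c p) t \<subseteq> U" by (rule t(3))
    show "pull ?c F q = 0" if "q \<notin> inv_chart ?c ` cball (snd ?c p) t" for q
      by (rule pull_support(2)[OF c(1) t(2) F(5) that])
  qed
qed

text \<open>A bump function supported in a neighbourhood drops from one to zero on the way out, and its
  gradient is bounded, so leaving the neighbourhood costs a definite length.\<close>

lemma rdist_separates:
  assumes "open U" "p \<in> U"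
  obtains s where "s > 0" "\<And>q l. joins p q l \<Longrightarrow> l < s \<Longrightarrow> q \<in> U"
proof -
  obtain h V K where h: "C1 h" "p \<in> V" "\<And>q. q \<in> V \<Longrightarrow> h q = (1::real)"
    "compact K" "K \<subseteq> U" "\<And>q. q \<notin> K \<Longrightarrow> h q = 0"
    using manifold_bump[OF assms] by metis
  obtain L where L: "L > 0" "\<And>p. grad_norm charts g h p \<le> L"
    by (rule grad_norm_bounded[OF h(1,4,6)]) (assumption, rule that)
  show ?thesis
  proof (rule that[of "1 / L"])
    fix q l assume "joins p q l" "l < 1 / L"
    then have "L * l < 1" using L(1) by (simp add: field_simps)
    moreover have "\<bar>h q - h p\<bar> \<le> L * l"
      using \<open>joins p q l\<close> chain_gradient_bound[OF h(1) L(2)] unfolding joins_def by blast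
    ultimately have "h q \<noteq> 0" using h(3)[OF h(2)] by auto
    then show "q \<in> U" using h(5,6) by blast
  qed (use L in simp)
qed

end

context smooth_manifold begin

lemma Ck_function_glue:
  assumes "Ck_function k charts u" "Ck_function k charts v" "open U" "open W" "U \<union> W = UNIV"
    and "\<And>q. q \<in> U \<Longrightarrow> f q = u q" "\<And>q. q \<in> W \<Longrightarrow> f q = v q"
  shows "Ck_function k charts f"
  unfolding Ck_function_def
proof
  fix c assume c: "c \<in> charts"
  let ?A = "\<lambda>U. {y \<in> chart_image c. inv_chart c y \<in> U}"
  have eq: "chart_image c = ?A U \<union> ?A W" using assms(5) by blast
  have o: "open (?A U)" "open (?A W)" by (rule open_chart_image[OF c assms(3)] open_chart_image[OF c assms(4)])+
  have u: "Ck_on k (?A U) (u \<circ> inv_chart c)"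
    by (rule Ck_on_subset[OF bspec[OF assms(1)[unfolded Ck_function_def] c]]) blast
  have v: "Ck_on k (?A W) (v \<circ> inv_chart c)"
    by (rule Ck_on_subset[OF bspec[OF assms(2)[unfolded Ck_function_def] c]]) blast
  have 1: "Ck_on k (?A U) (f \<circ> inv_chart c)" by (rule Ck_on_cong[OF o(1) _ u]) (simp add: assms(6))
  have 2: "Ck_on k (?A W) (f \<circ> inv_chart c)" by (rule Ck_on_cong[OF o(2) _ v]) (simp add: assms(7))
  show "Ck_on k (chart_image c) (f \<circ> inv_chart c)"
    by (subst eq) (rule Ck_on_Un[OF o 1 2])
qed

end

lemma has_derivative_le_if_increments_le:
  fixes m :: "'b::real_normed_vector \<Rightarrow> real"
  assumes "(m has_derivative D) (at y)" "e > 0"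
    and "\<And>h. 0 < h \<Longrightarrow> h < e \<Longrightarrow> m (y + h *\<^sub>R v) - m y \<le> h * S"
  shows "D v \<le> S"
proof (rule ccontr)
  assume "\<not> D v \<le> S"
  have lin: "linear D" using assms(1) has_derivative_linear by blast
  have "((\<lambda>h. y + h *\<^sub>R v) has_derivative (\<lambda>h. h *\<^sub>R v)) (at 0)"
    by (auto intro!: derivative_eq_intros)
  from has_derivative_compose[OF this, of m D]
  have "((\<lambda>h. m (y + h *\<^sub>R v)) has_derivative (\<lambda>h. D (h *\<^sub>R v))) (at 0)" using assms(1) by simp
  then have "((\<lambda>h. m (y + h *\<^sub>R v)) has_real_derivative D v) (at 0)"
    by (simp add: has_field_derivative_def linear_scale[OF lin] mult_commute_abs)
  then have "((\<lambda>h. m (y + h *\<^sub>R v) - h * S) has_real_derivative D v - S) (at 0)"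
    by (auto intro!: derivative_eq_intros)
  from DERIV_pos_inc_right[OF this] \<open>\<not> D v \<le> S\<close>
  obtain d where d: "d > 0" "\<And>h. 0 < h \<Longrightarrow> h < d \<Longrightarrow> m y < m (y + h *\<^sub>R v) - h * S" by auto
  define k where "k = min d e / 2"
  have "0 < k" "k < d" "k < e" using d(1) assms(2) by (auto simp: k_def min_def)
  with d(2)[of k] assms(3)[of k] show False by simp
qed

context connected_riemannian_manifold begin

text \<open>The points that can be joined to \<open>p\<close> form a set that is open and closed.\<close>

lemma joins_exists: "\<exists>l. joins p q l"
proof -
  define R where "R = {q. \<exists>l. joins p q l}"
  have "open R"
  proof (subst open_subopen, intro ballI)
    fix q assume "q \<in> R"
    obtain U where U: "open U" "q \<in> U" "\<And>s. s \<in> U \<Longrightarrow> \<exists>l<1. joins q s l"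
      by (rule joins_nearby[of 1 q]) (simp, rule that)
    moreover have "U \<subseteq> R" using \<open>q \<in> R\<close> U(3) joins_trans unfolding R_def by blast
    ultimately show "\<exists>T. open T \<and> q \<in> T \<and> T \<subseteq> R" by blast
  qed
  moreover have "open (- R)"
  proof (subst open_subopen, intro ballI)
    fix q assume "q \<in> - R"
    obtain U where U: "open U" "q \<in> U" "\<And>s. s \<in> U \<Longrightarrow> \<exists>l<1. joins q s l"
      by (rule joins_nearby[of 1 q]) (simp, rule that)
    moreover have "U \<subseteq> - R" using \<open>q \<in> - R\<close> U(3) joins_trans joins_sym unfolding R_def by blast
    ultimately show "\<exists>T. open T \<and> q \<in> T \<and> T \<subseteq> - R" by blast
  qed
  moreover have "p \<in> R" by (rule joins_nearby[of 1 p]) (auto simp: R_def)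
  ultimately have "R = UNIV"
    using connected_manifold unfolding connected_clopen by (auto simp: closed_def)
  then show ?thesis by (auto simp: R_def)
qed

lemma rdist_lessD: "rdist p q < s \<Longrightarrow> \<exists>l<s. joins p q l"
  unfolding riem_dist_joins using cInf_lessD[of "{l. joins p q l}" s] joins_exists[of p q] by blast

lemma rdist_nonneg: "rdist p q \<ge> 0"
  unfolding riem_dist_joins using joins_exists[of p q] joins_nonneg by (intro cInf_greatest) auto

lemma rdist_sym: "rdist p q = rdist q p"
proof -
  have "{l. joins p q l} = {l. joins q p l}" using joins_sym by blast
  then show ?thesis by (simp add: riem_dist_joins)
qed

lemma rdist_triangle: "rdist p s \<le> rdist p q + rdist q s"
proof (rule field_le_epsilon)
  fix e :: real assume "e > 0"
  then obtain k l where "joins p q k" "k < rdist p q + e / 2" "joins q s l" "l < rdist q s + e / 2"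
    using rdist_lessD[of p q "rdist p q + e / 2"] rdist_lessD[of q s "rdist q s + e / 2"] by auto
  then show "rdist p s \<le> rdist p q + rdist q s + e"
    using rdist_le[OF joins_trans] by fastforce
qed

lemma rdist_nhd:
  assumes "s > 0" obtains U where "open U" "p \<in> U" "\<And>q. q \<in> U \<Longrightarrow> rdist p q < s"
proof -
  obtain U where "open U" "p \<in> U" "\<And>q. q \<in> U \<Longrightarrow> \<exists>l<s. joins p q l"
    by (rule joins_nearby[OF assms]) (rule that)
  then show ?thesis using that rdist_le by (meson le_less_trans)
qed

lemma rdist_open:
  assumes "open U" "p \<in> U" obtains s where "s > 0" "\<And>q. rdist p q < s \<Longrightarrow> q \<in> U"
proof -
  obtain s where s: "s > 0" "\<And>q l. joins p q l \<Longrightarrow> l < s \<Longrightarrow> q \<in> U"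
    by (rule rdist_separates[OF assms]) (rule that)
  show ?thesis by (rule that[OF s(1)]) (use s(2) rdist_lessD in blast)
qed

lemma rdist_self: "rdist p p = 0"
proof (rule antisym)
  show "rdist p p \<le> 0"
  proof (rule field_le_epsilon)
    fix e :: real assume "e > 0"
    then obtain U where "p \<in> U" "\<And>q. q \<in> U \<Longrightarrow> rdist p q < e" using rdist_nhd by metis
    then show "rdist p p \<le> 0 + e" by force
  qed
qed (rule rdist_nonneg)

lemma rdist_eq_0: "rdist p q = 0 \<longleftrightarrow> p = q"
proof
  assume eq: "rdist p q = 0"
  show "p = q"
  proof (rule ccontr)
    assume "p \<noteq> q"
    obtain s where "s > 0" "\<And>x. rdist p x < s \<Longrightarrow> x \<in> - {q}"
      by (rule rdist_open[of "- {q}" p]) (use \<open>p \<noteq> q\<close> in auto)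
    then show False using eq by force
  qed
qed (simp add: rdist_self)

lemma rdist_Lipschitz: "\<bar>rdist p x - rdist p y\<bar> \<le> rdist x y"
  using rdist_triangle[of p x y] rdist_triangle[of p y x] rdist_sym[of x y] by linarith

lemma rdist_Metric_space: "Metric_space UNIV rdist"
  by unfold_locales (auto simp: rdist_nonneg rdist_sym rdist_eq_0 rdist_triangle)

lemma rdist_topology: "Metric_space.mtopology UNIV rdist = euclidean"
proof -
  interpret R: Metric_space UNIV rdist by (rule rdist_Metric_space)
  have "openin R.mtopology U \<longleftrightarrow> open U" for U
  proof
    assume "openin R.mtopology U"
    show "open U"
    proof (subst open_subopen, intro ballI)
      fix p assume "p \<in> U"
      then obtain s where s: "s > 0" "R.mball p s \<subseteq> U"
        using \<open>openin R.mtopology U\<close> unfolding R.openin_mtopology by blast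
      obtain T where "open T" "p \<in> T" "\<And>q. q \<in> T \<Longrightarrow> rdist p q < s"
        by (rule rdist_nhd[OF s(1)]) (rule that)
      then show "\<exists>T. open T \<and> p \<in> T \<and> T \<subseteq> U" using s(2) by (intro exI[of _ T]) auto
    qed
  next
    assume U: "open U"
    have "\<exists>s>0. R.mball p s \<subseteq> U" if p: "p \<in> U" for p
    proof -
      obtain s where "s > 0" "\<And>q. rdist p q < s \<Longrightarrow> q \<in> U"
        by (rule rdist_open[OF U p]) (rule that)
      then show ?thesis by (intro exI[of _ s]) auto
    qed
    then show "openin R.mtopology U" by (simp add: R.openin_mtopology)
  qed
  then show ?thesis by (simp add: topology_eq open_openin[symmetric])
qed

lemma continuous_on_rdist: "continuous_on UNIV (rdist p)"
  unfolding continuous_on_eq_continuous_within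
proof
  fix x
  show "continuous (at x) (rdist p)"
    unfolding continuous_at tendsto_iff
  proof (intro allI impI)
    fix e :: real assume "e > 0"
    then obtain U where U: "open U" "x \<in> U" "\<And>q. q \<in> U \<Longrightarrow> rdist x q < e"
      by (rule rdist_nhd) (rule that)
    have "dist (rdist p q) (rdist p x) < e" if "q \<in> U" for q
      using rdist_Lipschitz[of p q x] U(3)[OF that] rdist_sym[of x q] by (simp add: dist_real_def)
    then show "\<forall>\<^sub>F q in at x. dist (rdist p q) (rdist p x) < e"
      using U(1,2) unfolding eventually_at_topological by blast
  qed
qed

lemma open_rdist_less: "open {q. rdist p q < R}"
  by (intro open_Collect_less continuous_on_rdist continuous_on_const)

lemma closed_rdist_le: "closed {q. rdist p q \<le> R}"
  by (intro closed_Collect_le continuous_on_rdist continuous_on_const)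

text \<open>The Riemannian distance is a length metric: cut an almost shortest curve at distance \<open>s\<close> from
  its starting point.\<close>

lemma rdist_split:
  assumes "0 \<le> s" "s \<le> rdist p q" "rdist p q < k"
  obtains z where "rdist p z = s" "rdist z q < k - s"
proof -
  obtain l where l: "l < k" "joins p q l" using rdist_lessD[OF assms(3)] by blast
  then obtain \<gamma> a b where \<gamma>: "chain charts \<gamma> a b" "\<gamma> a = p" "\<gamma> b = q" "l = len \<gamma> a b"
    unfolding joins_def by blast
  have "a < b" by (rule chain_less[OF \<gamma>(1)])
  have "continuous_on {a..b} (\<lambda>t. rdist p (\<gamma> t))"
    by (rule continuous_on_compose2[OF continuous_on_rdist chain_continuous[OF \<gamma>(1)]]) auto
  then obtain t where t: "a \<le> t" "t \<le> b" "rdist p (\<gamma> t) = s"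
    using IVT'[of "\<lambda>t. rdist p (\<gamma> t)" a s b] assms(1,2) \<gamma>(2,3) \<open>a < b\<close> rdist_self by auto
  have 1: "s \<le> len \<gamma> a t"
  proof (cases "t = a")
    case True
    then show ?thesis using t(3) \<gamma>(2) by (simp add: rdist_self)
  next
    case False
    then show ?thesis
      using rdist_le[OF joinsI[OF chain_sub[OF \<gamma>(1) order_refl, of t]]] t \<gamma>(2) by simp
  qed
  have 2: "rdist (\<gamma> t) q \<le> len \<gamma> t b"
  proof (cases "t = b")
    case True
    then show ?thesis using \<gamma>(3) by (simp add: rdist_self)
  next
    case False
    then show ?thesis
      using rdist_le[OF joinsI[OF chain_sub[OF \<gamma>(1) t(1) _ order_refl]]] t \<gamma>(3) by simp
  qed
  have "rdist (\<gamma> t) q < k - s"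
    using 1 2 len_combine[OF \<gamma>(1) t(1,2)] l(1) \<gamma>(4) by linarith
  then show ?thesis by (rule that[OF t(3)])
qed

lemma compact_uniform_nhd:
  assumes "compact K" "open W" "K \<subseteq> W"
  obtains e where "e > 0" "\<And>x q. x \<in> K \<Longrightarrow> rdist x q < e \<Longrightarrow> q \<in> W"
proof -
  have "\<exists>s>0. \<forall>q. rdist x q < s \<longrightarrow> q \<in> W" if "x \<in> K" for x
    using rdist_open[OF assms(2), of x] that assms(3) by (metis subsetD)
  then obtain s where s: "\<And>x. x \<in> K \<Longrightarrow> s x > 0" "\<And>x q. x \<in> K \<Longrightarrow> rdist x q < s x \<Longrightarrow> q \<in> W"
    by metis
  have cov: "K \<subseteq> (\<Union>x\<in>K. {q. rdist x q < s x / 2})" using s(1) by (force simp: rdist_self)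
  obtain F where F: "F \<subseteq> K" "finite F" "K \<subseteq> (\<Union>x\<in>F. {q. rdist x q < s x / 2})"
    by (rule compactE_image[OF assms(1) open_rdist_less cov]) (rule that)
  define e where "e = Min (insert 1 ((\<lambda>x. s x / 2) ` F))"
  have e: "e > 0" using F(1,2) s(1) by (auto simp: e_def Min_gr_iff subset_iff)
  have le: "e \<le> s x / 2" if "x \<in> F" for x
    unfolding e_def using F(2) that by (intro Min_le) auto
  show ?thesis
  proof (rule that[OF e])
    fix x q assume "x \<in> K" "rdist x q < e"
    then obtain y where y: "y \<in> F" "rdist y x < s y / 2" using F(3) by blast
    then have "rdist y q < s y" using rdist_triangle[of y q x] le[OF y(1)] \<open>rdist x q < e\<close> by linarith
    then show "q \<in> W" using s(2) y(1) F(1) by blast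
  qed
qed

end

locale complete_riemannian_manifold = connected_riemannian_manifold charts g
  for charts :: "('a::{t2_space, second_countable_topology}, 'n::finite) chart set" and g +
  assumes complete: "riem_complete charts g"

context complete_riemannian_manifold begin

text \<open>In a length metric every point at distance at most \<open>S\<close> is close to a slightly smaller ball, so the
  ball of radius \<open>S\<close> is totally bounded.\<close>

lemma compact_cball_limit:
  assumes "S > 0" and *: "\<And>R. R < S \<Longrightarrow> compact {q. rdist p q \<le> R}"
  shows "compact {q. rdist p q \<le> S}"
proof -
  interpret R: Metric_space UNIV rdist by (rule rdist_Metric_space)
  let ?B = "\<lambda>R. {q. rdist p q \<le> R}"
  have "R.mtotally_bounded (?B S)"
    unfolding R.mtotally_bounded_def
  proof (intro allI impI)
    fix e :: real assume e: "e > 0"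
    define R where "R = max 0 (S - e / 4)"
    have R: "0 \<le> R" "R < S" "S - R \<le> e / 4" using assms(1) e by (auto simp: R_def max_def)
    have "compactin R.mtopology (?B R)" using *[OF R(2)] by (simp add: rdist_topology)
    then have "R.mtotally_bounded (?B R)" by (rule R.compactin_imp_mtotally_bounded)
    then obtain K where K: "finite K" "K \<subseteq> ?B R" "?B R \<subseteq> (\<Union>x\<in>K. R.mball x (e / 4))"
      unfolding R.mtotally_bounded_def using e by (metis zero_less_divide_iff zero_less_numeral)
    have "?B S \<subseteq> (\<Union>x\<in>K. R.mball x e)"
    proof
      fix q assume q: "q \<in> ?B S"
      have "\<exists>z. z \<in> ?B R \<and> rdist z q < e / 2"
      proof (cases "rdist p q \<le> R")
        case True
        then show ?thesis using e by (intro exI[of _ q]) (simp add: rdist_self)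
      next
        case False
        then have "R \<le> rdist p q" "rdist p q < S + e / 4" using q e by auto
        then obtain z where "rdist p z = R" "rdist z q < S + e / 4 - R"
          using rdist_split[OF R(1)] by metis
        then show ?thesis using R(3) by (intro exI[of _ z]) auto
      qed
      then obtain z where z: "z \<in> ?B R" "rdist z q < e / 2" by blast
      then obtain x where "x \<in> K" "rdist x z < e / 4" using K(3) by auto
      then show "q \<in> (\<Union>x\<in>K. R.mball x e)"
        using rdist_triangle[of x q z] z(2) e by (intro UN_I[of x]) auto
    qed
    moreover have "K \<subseteq> ?B S" using K(2) R(2) by force
    ultimately show "\<exists>K. finite K \<and> K \<subseteq> ?B S \<and> ?B S \<subseteq> (\<Union>x\<in>K. R.mball x e)" using K(1) by blast
  qed
  moreover have "R.mcomplete" using complete by (simp add: riem_complete_def)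
  ultimately have "compactin R.mtopology (R.mtopology closure_of (?B S))"
    using R.mtotally_bounded_eq_compact_closure_of by blast
  then show ?thesis by (simp add: rdist_topology closure_of_eq closed_rdist_le closure_closed)
qed

text \<open>A compact ball has a neighbourhood with compact closure, and in a length metric the slightly larger
  balls stay inside.\<close>

lemma compact_cball_extend:
  assumes "S \<ge> 0" "compact {q. rdist p q \<le> S}"
  obtains e where "e > 0" "compact {q. rdist p q \<le> S + e}"
proof -
  let ?B = "\<lambda>R. {q. rdist p q \<le> R}"
  have "\<exists>V K. open V \<and> x \<in> V \<and> compact K \<and> V \<subseteq> K" for x :: 'a
  proof -
    obtain h V K where h: "\<And>q. q \<in> V \<Longrightarrow> h q = (1::real)" "open V" "x \<in> V" "compact K" "\<And>q. q \<notin> K \<Longrightarrow> h q = 0"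
      by (rule manifold_bump[OF open_UNIV UNIV_I[of x]]) (rule that)
    then have "V \<subseteq> K" by (metis subsetI zero_neq_one)
    then show ?thesis using h by blast
  qed
  then obtain V K where VK: "\<And>x::'a. open (V x) \<and> x \<in> V x \<and> compact (K x) \<and> V x \<subseteq> K x" by metis
  have cov: "?B S \<subseteq> (\<Union>x\<in>?B S. V x)" using VK by blast
  have oV: "\<And>x. open (V x)" using VK by blast
  obtain F where F: "F \<subseteq> ?B S" "finite F" "?B S \<subseteq> (\<Union>x\<in>F. V x)"
    by (rule compactE_image[OF assms(2) oV cov]) (rule that)
  have oW: "open (\<Union>x\<in>F. V x)" using VK by blast
  obtain e where e: "e > 0" "\<And>x q. x \<in> ?B S \<Longrightarrow> rdist x q < e \<Longrightarrow> q \<in> (\<Union>x\<in>F. V x)"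
    by (rule compact_uniform_nhd[OF assms(2) oW F(3)]) (rule that)
  have "?B (S + e / 2) \<subseteq> (\<Union>x\<in>F. K x)"
  proof
    fix q assume q: "q \<in> ?B (S + e / 2)"
    have "q \<in> (\<Union>x\<in>F. V x)"
    proof (cases "rdist p q \<le> S")
      case False
      then have "S \<le> rdist p q" "rdist p q < S + e" using q e(1) by auto
      then obtain z where "rdist p z = S" "rdist z q < S + e - S"
        using rdist_split[OF assms(1)] by metis
      then show ?thesis by (intro e(2)[of z]) auto
    qed (use F(3) in blast)
    then show "q \<in> (\<Union>x\<in>F. K x)" using VK by blast
  qed
  moreover have "compact (\<Union>x\<in>F. K x)" using F(2) VK by (intro compact_UN) auto
  ultimately have "compact ((\<Union>x\<in>F. K x) \<inter> ?B (S + e / 2))" "(\<Union>x\<in>F. K x) \<inter> ?B (S + e / 2) = ?B (S + e / 2)"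
    using compact_Int_closed[OF _ closed_rdist_le] by blast+
  then have "compact (?B (S + e / 2))" by simp
  then show ?thesis using e(1) by (intro that[of "e / 2"]) auto
qed

text \<open>The Hopf--Rinow theorem: the supremum of the radii of compact balls cannot be finite, because
  the ball of that radius would again be compact, and so would slightly larger balls.\<close>

theorem compact_rdist_le: "compact {q. rdist p q \<le> R}"
proof (rule ccontr)
  assume not: "\<not> compact {q. rdist p q \<le> R}"
  let ?B = "\<lambda>R. {q. rdist p q \<le> R}"
  define A where "A = {R. 0 \<le> R \<and> compact (?B R)}"
  have mono: "compact (?B T)" if "compact (?B S)" "T \<le> S" for S T
  proof -
    have "?B S \<inter> ?B T = ?B T" using that(2) by auto
    then show ?thesis using compact_Int_closed[OF that(1) closed_rdist_le, of p T] by simp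
  qed
  have "?B 0 = {p}"
    using rdist_eq_0[of p] antisym[OF _ rdist_nonneg[of p]] by (auto simp: rdist_self)
  then have "0 \<in> A" by (simp add: A_def)
  have bdd: "bdd_above A"
  proof (rule bdd_aboveI[of _ R], rule ccontr)
    fix x assume "x \<in> A" "\<not> x \<le> R"
    then show False using not mono[of x R] by (simp add: A_def)
  qed
  define S where "S = Sup A"
  have "0 \<le> S" unfolding S_def by (rule cSup_upper[OF \<open>0 \<in> A\<close> bdd])
  have "compact (?B S)"
  proof (cases "S = 0")
    case False
    show ?thesis
    proof (rule compact_cball_limit)
      fix T assume "T < S"
      then obtain R where "R \<in> A" "T < R" using less_cSupD[of A T] \<open>0 \<in> A\<close> by (auto simp: S_def)
      then show "compact (?B T)" using mono by (auto simp: A_def)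
    qed (use False \<open>0 \<le> S\<close> in simp)
  qed (use \<open>0 \<in> A\<close> in \<open>simp add: A_def\<close>)
  then obtain e where "e > 0" "compact (?B (S + e))"
    by (rule compact_cball_extend[OF \<open>0 \<le> S\<close>]) (rule that)
  then have "S + e \<in> A" using \<open>0 \<le> S\<close> by (simp add: A_def)
  then have "S + e \<le> S" unfolding S_def by (rule cSup_upper[OF _ bdd])
  then show False using \<open>e > 0\<close> by simp
qed

end


section \<open>Smoothing the distance function\<close>

context connected_riemannian_manifold begin

lemma rdist_segment:
  assumes "c \<in> charts" "convex B" "B \<subseteq> chart_image c" "y \<in> B" "y' \<in> B"
    "\<And>z. z \<in> B \<Longrightarrow> sqrt (quad (g c (inv_chart c z)) (y' - y) (y' - y)) \<le> K"
  shows "rdist (inv_chart c y) (inv_chart c y') \<le> K"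
proof -
  obtain l where "joins (inv_chart c y) (inv_chart c y') l" "l \<le> K"
    by (rule joins_segment[OF assms]) (assumption, rule that)
  then show ?thesis using rdist_le by fastforce
qed

text \<open>Averages of translates of a 1-Lipschitz function are almost 1-Lipschitz, with a loss that only
  comes from comparing the metric tensors at nearby points.\<close>

lemma rdist_local_smoothing:
  obtains V where "open V" "p \<in> V"
    "\<And>e. e > 0 \<Longrightarrow> \<exists>m. C1 m \<and> (\<forall>q\<in>V. \<bar>m q - rdist x0 q\<bar> \<le> e \<and> grad_norm charts g m q \<le> 2)"
proof -
  let ?c = "chart_at charts p"
  define c where "c = ?c"
  have c: "c \<in> charts" "p \<in> fst c" unfolding c_def by (rule chart_at_in)+
  define y0 where "y0 = snd c p"
  obtain t where t: "t > 0" "cball y0 t \<subseteq> chart_image c" "inv_chart c ` cball y0 t \<subseteq> UNIV"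
    "\<And>y v. y \<in> cball y0 t \<Longrightarrow> quad (g c (inv_chart c y)) v v \<le> 2 * quad (g c p) v v \<and>
       quad (g c p) v v \<le> 2 * quad (g c (inv_chart c y)) v v"
    by (rule metric_comparable[OF c open_UNIV UNIV_I, folded y0_def]) (rule that)
  obtain L where L: "L > 0" "\<And>v. quad (g c p) v v \<le> L * (norm v)\<^sup>2"
    by (rule quad_le_norm) (rule that)
  let ?r = "\<lambda>y. rdist x0 (inv_chart c y)"
  define F where "F y = cutoff ((t/2)\<^sup>2) ((3*t/4)\<^sup>2) ((y - y0) \<bullet> (y - y0))" for y
  have lt: "0 < t/2" "t/2 < 3*t/4" using t(1) by auto
  note F = coordinate_bump[OF lt, where y = y0, folded F_def F_def[abs_def]]
  define f where "f y = (if y \<in> chart_image c then F y * ?r y else 0)" for y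
  have f0: "f y = 0" if "y \<notin> cball y0 (3*t/4)" for y using F(5)[OF that] by (simp add: f_def)
  have rc: "continuous_on (chart_image c) ?r"
    by (rule continuous_on_compose2[OF continuous_on_rdist continuous_chart(2)[OF c(1)]]) simp
  have Fc: "continuous_on UNIV F" by (rule Ck_on_continuous[OF F(1)]) simp
  have f1: "continuous_on (chart_image c) f"
    by (rule continuous_on_eq[of _ "\<lambda>y. F y * ?r y"])
       (auto simp: f_def intro!: continuous_intros rc continuous_on_subset[OF Fc])
  have f2: "continuous_on (- cball y0 (3*t/4)) f"
    by (rule continuous_on_eq[of _ "\<lambda>y. 0"]) (auto simp: f0)
  have un: "chart_image c \<union> - cball y0 (3*t/4) = UNIV"
    using t(1,2) by (auto simp: subset_iff)
  have fc: "continuous_on UNIV f"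
    unfolding un[symmetric]
    by (rule continuous_on_open_Un[OF _ _ f1 f2]) (auto intro: open_chart(2)[OF c(1)])
  obtain a where a: "cball y0 (3*t/4) \<subseteq> cbox (- a) a"
    using bounded_subset_cbox_symmetric[OF bounded_cball] by blast
  have fbox: "f y = 0" if "y \<notin> cbox (- a) a" for y using a that by (intro f0) blast
  define V where "V = inv_chart c ` ball y0 (t/4)"
  have sub: "ball y0 (t/4) \<subseteq> cball y0 t" "ball y0 (t/4) \<subseteq> chart_image c"
    using t(1,2) by (auto simp: subset_iff)
  have near: "f y = ?r y" if "y \<in> cball y0 (t/2)" for y
    using that t(1,2) F(4)[of y] by (auto simp: f_def subset_iff)
  show ?thesis
  proof (rule that[of V])
    show "open V" unfolding V_def by (rule open_inv_chart_image[OF c(1) open_ball sub(2)])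
    show "p \<in> V" unfolding V_def y0_def
      using t(1) inv_chart_chart[OF c] by (intro image_eqI[of _ _ "snd c p"]) auto
    fix e :: real assume "e > 0"
    define d where "d = min (t/4) (e / sqrt (2 * L))"
    have sL: "sqrt (2 * L) > 0" using L by simp
    have d: "d > 0" "d \<le> t/4" "sqrt (2 * L) * d \<le> e"
    proof -
      show "d > 0" using t(1) \<open>e > 0\<close> sL by (simp add: d_def)
      show "d \<le> t/4" unfolding d_def by (rule min.cobounded1)
      have "sqrt (2 * L) * d \<le> sqrt (2 * L) * (e / sqrt (2 * L))"
        using sL by (intro mult_left_mono) (auto simp: d_def)
      then show "sqrt (2 * L) * d \<le> e" using sL by simp
    qed
    obtain m where m: "\<And>k. Ck_on k UNIV m"
      "\<And>y c e. \<forall>z. norm z < d \<longrightarrow> \<bar>f (y - z) - c\<bar> \<le> e \<Longrightarrow> \<bar>m y - c\<bar> \<le> e"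
      "\<And>y y' e. \<forall>z. norm z < d \<longrightarrow> \<bar>f (y' - z) - f (y - z)\<bar> \<le> e \<Longrightarrow> \<bar>m y' - m y\<bar> \<le> e"
      by (rule mollification[OF fc fbox d(1)]) (assumption, rule that)
    have m0: "m y = 0" if y: "y \<notin> cball y0 t" for y
    proof -
      have "\<bar>m y - 0\<bar> \<le> 0"
      proof (rule m(2), intro allI impI)
        fix z :: "real^'n" assume z: "norm z < d"
        have "dist y0 y \<le> dist y0 (y - z) + norm z"
          using dist_triangle[of y0 y "y - z"] by (simp add: dist_norm)
        then have "y - z \<notin> cball y0 (3*t/4)" using y z d(2) by auto
        then show "\<bar>f (y - z) - 0\<bar> \<le> 0" by (simp add: f0)
      qed
      then show ?thesis by simp
    qed
    have inn: "y - z \<in> cball y0 (t/2)" if "y \<in> ball y0 (t/4)" "norm z < d" for y z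
    proof -
      have "dist y0 (y - z) \<le> dist y0 y + norm z"
        using dist_triangle[of y0 "y - z" y] by (simp add: dist_norm)
      then show ?thesis using that d(2) by auto
    qed
    have half: "cball y0 (t/2) \<subseteq> chart_image c" "cball y0 (t/2) \<subseteq> cball y0 t"
      using t(1,2) by (auto simp: subset_iff)
    have close: "\<bar>m y - ?r y\<bar> \<le> e" if y: "y \<in> ball y0 (t/4)" for y
    proof (rule m(2), intro allI impI)
      fix z :: "real^'n" assume z: "norm z < d"
      have yy: "y \<in> cball y0 (t/2)" using y t(1) by auto
      have "rdist (inv_chart c (y - z)) (inv_chart c y) \<le> sqrt (2 * L) * d"
      proof (rule rdist_segment[OF c(1) convex_cball half(1) inn[OF y z] yy])
        fix w assume w: "w \<in> cball y0 (t/2)"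
        have wt: "w \<in> cball y0 t" using w half(2) by blast
        have yz: "y - (y - z) = z" by simp
        have "quad (g c (inv_chart c w)) (y - (y - z)) (y - (y - z)) \<le> 2 * (L * (norm z)\<^sup>2)"
          unfolding yz using t(4)[OF wt, of z] L(2)[of z] by linarith
        also have "\<dots> \<le> 2 * (L * d\<^sup>2)"
          using z L(1) by (intro mult_left_mono power_mono) auto
        finally have "sqrt (quad (g c (inv_chart c w)) (y - (y - z)) (y - (y - z))) \<le> sqrt (2 * L * d\<^sup>2)"
          by (simp add: mult.assoc)
        then show "sqrt (quad (g c (inv_chart c w)) (y - (y - z)) (y - (y - z))) \<le> sqrt (2 * L) * d"
          using d(1) by (simp add: real_sqrt_mult)
      qed
      then show "\<bar>f (y - z) - ?r y\<bar> \<le> e"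
        using rdist_Lipschitz[of x0 "inv_chart c (y - z)" "inv_chart c y"] d(3)
        by (simp add: near[OF inn[OF y z]])
    qed
    have lip: "\<bar>m y' - m y\<bar> \<le> 2 * sqrt (quad (g c (inv_chart c y)) (y' - y) (y' - y))"
      if y: "y \<in> ball y0 (t/4)" "y' \<in> ball y0 (t/4)" for y y'
    proof (rule m(3), intro allI impI)
      fix z :: "real^'n" assume z: "norm z < d"
      have "rdist (inv_chart c (y - z)) (inv_chart c (y' - z))
          \<le> 2 * sqrt (quad (g c (inv_chart c y)) (y' - y) (y' - y))"
      proof (rule rdist_segment[OF c(1) convex_cball half(1) inn[OF y(1) z] inn[OF y(2) z]])
        fix w assume w: "w \<in> cball y0 (t/2)"
        have "quad (g c (inv_chart c w)) (y' - y) (y' - y) \<le> 4 * quad (g c (inv_chart c y)) (y' - y) (y' - y)"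
        proof -
          have "w \<in> cball y0 t" "y \<in> cball y0 t" using w y(1) half(2) sub(1) by blast+
          then show ?thesis using t(4)[of w "y' - y"] t(4)[of y "y' - y"] by linarith
        qed
        then have "sqrt (quad (g c (inv_chart c w)) (y' - y) (y' - y))
            \<le> sqrt (4 * quad (g c (inv_chart c y)) (y' - y) (y' - y))" by simp
        then show "sqrt (quad (g c (inv_chart c w)) (y' - z - (y - z)) (y' - z - (y - z)))
            \<le> 2 * sqrt (quad (g c (inv_chart c y)) (y' - y) (y' - y))"
          by (simp add: real_sqrt_mult)
      qed
      then show "\<bar>f (y' - z) - f (y - z)\<bar> \<le> 2 * sqrt (quad (g c (inv_chart c y)) (y' - y) (y' - y))"
        using rdist_Lipschitz[of x0 "inv_chart c (y - z)" "inv_chart c (y' - z)"]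
        by (simp add: near[OF inn[OF y(1) z]] near[OF inn[OF y(2) z]])
    qed
    let ?M = "pull c m"
    have CM: "C1 ?M" by (rule Ck_function_pull[OF c(1) compact_cball t(2) m0 m(1)])
    have "\<bar>?M q - rdist x0 q\<bar> \<le> e \<and> grad_norm charts g ?M q \<le> 2" if qV: "q \<in> V" for q
    proof -
      obtain y where y: "y \<in> ball y0 (t/4)" "q = inv_chart c y" using qV by (auto simp: V_def)
      have yc: "y \<in> chart_image c" using y(1) sub(2) by blast
      have qc: "q \<in> fst c" "snd c q = y" using yc c(1) y(2) by (auto simp: inv_chart_in chart_inv_chart)
      have "(m has_derivative frechet_derivative m (at y)) (at y)"
        by (rule Ck_on_has_derivative[OF m(1)[of "Suc 0"]]) simp
      then have "((?M \<circ> inv_chart c) has_derivative frechet_derivative m (at y)) (at y)"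
        by (rule has_derivative_transform_within_open[OF _ open_chart(2)[OF c(1)] yc])
           (simp add: pull_comp_inv_chart[OF c(1)])
      then have D: "chart_deriv c ?M q = frechet_derivative m (at y)"
        "(m has_derivative chart_deriv c ?M q) (at y)"
        using chart_derivI[of ?M c "frechet_derivative m (at y)" q] qc(2)
          \<open>(m has_derivative frechet_derivative m (at y)) (at y)\<close> by auto
      have "chart_deriv c ?M q v \<le> 2 * sqrt (quad (g c q) v v)" for v
      proof -
        have oy: "\<exists>s>0. \<forall>h. 0 < h \<and> h < s \<longrightarrow> y + h *\<^sub>R v \<in> ball y0 (t/4)"
        proof -
          obtain s where s: "s > 0" "ball y s \<subseteq> ball y0 (t/4)"
            using open_contains_ball[THEN iffD1, OF open_ball, rule_format, OF y(1)] by blast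
          have nv: "norm v + 1 > 0" by (simp add: add_nonneg_pos)
          show ?thesis
          proof (intro exI conjI allI impI)
            show "s / (norm v + 1) > 0" using s(1) nv by simp
            fix h assume h: "0 < h \<and> h < s / (norm v + 1)"
            have "h * norm v \<le> h * (norm v + 1)" using h by simp
            also have "\<dots> < s" using h nv by (simp add: pos_less_divide_eq)
            finally have "y + h *\<^sub>R v \<in> ball y s" using h by (simp add: dist_norm)
            then show "y + h *\<^sub>R v \<in> ball y0 (t/4)" using s(2) by blast
          qed
        qed
        then obtain s where s: "s > 0" "\<And>h. 0 < h \<Longrightarrow> h < s \<Longrightarrow> y + h *\<^sub>R v \<in> ball y0 (t/4)" by blast
        show ?thesis
        proof (rule has_derivative_le_if_increments_le[OF D(2) s(1)])
          fix h assume h: "0 < h" "h < s"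
          have "m (y + h *\<^sub>R v) - m y \<le> 2 * sqrt (quad (g c q) (h *\<^sub>R v) (h *\<^sub>R v))"
            using lip[OF y(1) s(2)[OF h]] by (simp add: y(2))
          also have "\<dots> = h * (2 * sqrt (quad (g c q) v v))"
            using h by (simp add: matrix_vector_mult_scaleR real_sqrt_mult mult.assoc[symmetric] power2_eq_square[symmetric])
          finally show "m (y + h *\<^sub>R v) - m y \<le> h * (2 * sqrt (quad (g c q) v v))" .
        qed
      qed
      then have "grad_norm charts g ?M q \<le> 2"
        by (intro grad_norm_leI[OF CM c(1) qc(1)]) simp_all
      moreover have "?M q = m y" unfolding y(2) by (rule pull_comp_inv_chart[OF c(1) yc])
      ultimately show ?thesis using close[OF y(1)] y(2) by simp
    qed
    then show "\<exists>m. C1 m \<and> (\<forall>q\<in>V. \<bar>m q - rdist x0 q\<bar> \<le> e \<and> grad_norm charts g m q \<le> 2)"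
      using CM by blast
  qed
qed

text \<open>The slack \<open>e\<close> in the gradient bound makes room for the loss in each gluing step.\<close>

definition smoothable :: "'a \<Rightarrow> 'a set \<Rightarrow> bool" where
  "smoothable x0 U \<longleftrightarrow> (\<forall>e>0. \<exists>m. C1 m \<and>
     (\<forall>q\<in>U. \<bar>m q - rdist x0 q\<bar> \<le> e \<and> grad_norm charts g m q \<le> 2 + e))"

text \<open>Two approximations are glued with a bump function \<open>h\<close>; since both are uniformly close to the
  distance, the term with the gradient of \<open>h\<close> is as small as desired.\<close>

lemma smoothable_Un:
  assumes U: "smoothable x0 U" and W: "smoothable x0 W"
    and h: "C1 h" "\<And>q. 0 \<le> h q" "\<And>q. h q \<le> 1" "open V" "\<And>q. q \<in> V \<Longrightarrow> h q = 1"
      "compact K" "K \<subseteq> W" "\<And>q. q \<notin> K \<Longrightarrow> h q = 0"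
  shows "smoothable x0 (U \<union> V)"
  unfolding smoothable_def
proof (intro allI impI)
  fix e :: real assume "e > 0"
  obtain L where L: "L > 0" "\<And>p. grad_norm charts g h p \<le> L"
    by (rule grad_norm_bounded[OF h(1,6,8)]) (assumption, rule that)
  define d where "d = e / (1 + 2 * L)"
  have d: "d > 0" "d + 2 * L * d = e" "d \<le> e"
  proof -
    have eq: "d * (1 + 2 * L) = e" using L(1) by (simp add: d_def)
    show "d > 0" using \<open>e > 0\<close> L(1) by (simp add: d_def)
    moreover show "d + 2 * L * d = e" using eq by (simp add: algebra_simps)
    moreover have "0 \<le> 2 * L * d" using L(1) \<open>d > 0\<close> by simp
    ultimately show "d \<le> e" by linarith
  qed
  obtain m1 where m1: "C1 m1" "\<And>q. q \<in> U \<Longrightarrow> \<bar>m1 q - rdist x0 q\<bar> \<le> d"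
    "\<And>q. q \<in> U \<Longrightarrow> grad_norm charts g m1 q \<le> 2 + d"
    using U d(1) unfolding smoothable_def by blast
  obtain m2 where m2: "C1 m2" "\<And>q. q \<in> W \<Longrightarrow> \<bar>m2 q - rdist x0 q\<bar> \<le> d"
    "\<And>q. q \<in> W \<Longrightarrow> grad_norm charts g m2 q \<le> 2 + d"
    using W d(1) unfolding smoothable_def by blast
  define m where "m q = m1 q + h q * (m2 q + - m1 q)" for q
  have n1: "C1 (\<lambda>q. - m1 q)" using Ck_function_diff[OF Ck_function_const[of _ 0] m1(1)] by simp
  have df: "C1 (\<lambda>q. m2 q + - m1 q)" by (intro Ck_function_add m2(1) n1)
  have Cm: "C1 m" unfolding m_def by (intro Ck_function_add Ck_function_mult m1(1) h(1) df)
  have "\<bar>m q - rdist x0 q\<bar> \<le> e \<and> grad_norm charts g m q \<le> 2 + e" if qUV: "q \<in> U \<union> V" for q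
  proof -
    consider "q \<in> V" | "q \<in> U" "q \<notin> K" | "q \<in> U" "q \<in> K" using qUV by blast
    then show ?thesis
    proof cases
      case 1
      have eq: "m x = m2 x" if "x \<in> V" for x using h(5)[OF that] by (simp add: m_def)
      have "q \<in> W" using 1 h(5,7,8) by force
      moreover have "grad_norm charts g m q = grad_norm charts g m2 q"
        by (rule grad_norm_local[OF Cm m2(1) h(4) 1 eq])
      ultimately show ?thesis using m2(2,3)[of q] eq[OF 1] d(3) by simp
    next
      case 2
      have eq: "m x = m1 x" if "x \<in> - K" for x using h(8)[of x] that by (simp add: m_def)
      have "grad_norm charts g m q = grad_norm charts g m1 q"
        by (rule grad_norm_local[OF Cm m1(1) open_Compl[OF compact_imp_closed[OF h(6)]] _ eq])
           (use 2 in simp_all)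
      then show ?thesis using m1(2,3)[of q] 2 eq[of q] d(3) by simp
    next
      case 3
      then have qW: "q \<in> W" using h(7) by blast
      have "m q - rdist x0 q = (1 - h q) * (m1 q - rdist x0 q) + h q * (m2 q - rdist x0 q)"
        by (simp add: m_def algebra_simps)
      also have "\<bar>\<dots>\<bar> \<le> (1 - h q) * d + h q * d"
        using m1(2)[OF 3(1)] m2(2)[OF qW] h(2,3)[of q]
        by (intro order_trans[OF abs_triangle_ineq] add_mono) (auto simp: abs_mult intro!: mult_left_mono)
      finally have A: "\<bar>m q - rdist x0 q\<bar> \<le> e" using d(3) by (simp add: algebra_simps)
      have "grad_norm charts g m q \<le> 2 + e"
      proof (rule grad_norm_leI[OF Cm chart_at_in])
        fix v
        let ?c = "chart_at charts q"
        let ?Q = "sqrt (quad (g ?c q) v v)"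
        have Q: "?Q \<ge> 0" using quad_nonneg[OF posdef_metric[OF chart_at_in]] by simp
        have "chart_deriv ?c m q v = (1 - h q) * chart_deriv ?c m1 q v + h q * chart_deriv ?c m2 q v
            + (m2 q - m1 q) * chart_deriv ?c h q v"
        proof -
          have "chart_deriv ?c (\<lambda>q. - m1 q) q v = - chart_deriv ?c m1 q v"
            using chart_deriv_mult[OF Ck_function_const[of _ "-1"] m1(1) chart_at_in, of q v]
            by (simp add: chart_deriv_const)
          then show ?thesis
            unfolding m_def[abs_def]
            using chart_deriv_add[OF m1(1) Ck_function_mult[OF h(1) df] chart_at_in]
              chart_deriv_mult[OF h(1) df chart_at_in] chart_deriv_add[OF m2(1) n1 chart_at_in]
            by (simp add: algebra_simps)
        qed
        also have "\<dots> \<le> (1 - h q) * ((2 + d) * ?Q) + h q * ((2 + d) * ?Q) + (2 * d) * (L * ?Q)"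
        proof (intro add_mono)
          have "chart_deriv ?c m1 q v \<le> (2 + d) * ?Q"
            using chart_deriv_bound[OF m1(1) chart_at_in, of q v] mult_right_mono[OF m1(3)[OF 3(1)] Q] by linarith
          then show "(1 - h q) * chart_deriv ?c m1 q v \<le> (1 - h q) * ((2 + d) * ?Q)"
            using h(3)[of q] by (intro mult_left_mono) auto
          have "chart_deriv ?c m2 q v \<le> (2 + d) * ?Q"
            using chart_deriv_bound[OF m2(1) chart_at_in, of q v] mult_right_mono[OF m2(3)[OF qW] Q] by linarith
          then show "h q * chart_deriv ?c m2 q v \<le> h q * ((2 + d) * ?Q)"
            using h(2)[of q] by (intro mult_left_mono) auto
          have "\<bar>chart_deriv ?c h q v\<bar> \<le> L * ?Q"
            using chart_deriv_bound[OF h(1) chart_at_in, of q v] mult_right_mono[OF L(2)[of q] Q] by linarith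
          moreover have "\<bar>m2 q - m1 q\<bar> \<le> 2 * d" using m1(2)[OF 3(1)] m2(2)[OF qW] by linarith
          ultimately have "\<bar>m2 q - m1 q\<bar> * \<bar>chart_deriv ?c h q v\<bar> \<le> (2 * d) * (L * ?Q)"
            using d(1) by (intro mult_mono) auto
          then show "(m2 q - m1 q) * chart_deriv ?c h q v \<le> (2 * d) * (L * ?Q)"
            by (metis abs_le_D1 abs_mult)
        qed
        also have "\<dots> = (2 + (d + 2 * L * d)) * ?Q" by (simp add: algebra_simps)
        finally show "chart_deriv ?c m q v \<le> (2 + e) * ?Q" by (simp add: d(2))
      qed (use \<open>e > 0\<close> in simp)
      with A show ?thesis by simp
    qed
  qed
  then show "\<exists>m. C1 m \<and> (\<forall>q\<in>U \<union> V. \<bar>m q - rdist x0 q\<bar> \<le> e \<and> grad_norm charts g m q \<le> 2 + e)"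
    using Cm by blast
qed

lemma smoothable_subset: "smoothable x0 U \<Longrightarrow> W \<subseteq> U \<Longrightarrow> smoothable x0 W"
  unfolding smoothable_def by (meson subsetD)

lemma smoothable_compact:
  assumes "compact K" shows "smoothable x0 K"
proof -
  have "\<exists>V. open V \<and> p \<in> V \<and> (\<forall>U. smoothable x0 U \<longrightarrow> smoothable x0 (U \<union> V))" for p
  proof -
    obtain W where W: "open W" "p \<in> W"
      "\<And>e. e > 0 \<Longrightarrow> \<exists>m. C1 m \<and> (\<forall>q\<in>W. \<bar>m q - rdist x0 q\<bar> \<le> e \<and> grad_norm charts g m q \<le> 2)"
      by (rule rdist_local_smoothing) (rule that)
    have sW: "smoothable x0 W"
      unfolding smoothable_def
    proof (intro allI impI)
      fix e :: real assume "e > 0"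
      then obtain m where "C1 m" "\<forall>q\<in>W. \<bar>m q - rdist x0 q\<bar> \<le> e \<and> grad_norm charts g m q \<le> 2"
        using W(3) by blast
      then show "\<exists>m. C1 m \<and> (\<forall>q\<in>W. \<bar>m q - rdist x0 q\<bar> \<le> e \<and> grad_norm charts g m q \<le> 2 + e)"
        using \<open>e > 0\<close> by (intro exI[of _ m]) force
    qed
    obtain h V K where h: "C1 h" "\<And>q. 0 \<le> h q" "\<And>q. h q \<le> 1" "open V" "p \<in> V" "\<And>q. q \<in> V \<Longrightarrow> h q = 1"
      "compact K" "K \<subseteq> W" "\<And>q. q \<notin> K \<Longrightarrow> h q = 0"
      by (rule manifold_bump[OF W(1,2)]) (rule that)
    show ?thesis
      using smoothable_Un[OF _ sW h(1,2,3,4,6,7,8,9)] h(4,5) by blast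
  qed
  then obtain V where V: "\<And>p. open (V p)" "\<And>p. p \<in> V p"
    "\<And>p U. smoothable x0 U \<Longrightarrow> smoothable x0 (U \<union> V p)" by metis
  have cov: "K \<subseteq> (\<Union>p\<in>K. V p)" using V(2) by blast
  obtain F where F: "finite F" "K \<subseteq> (\<Union>p\<in>F. V p)"
    by (rule compactE_image[OF assms V(1) cov]) (rule that)
  have "smoothable x0 (\<Union>p\<in>F. V p)"
    using F(1)
  proof induction
    case empty
    have "C1 (\<lambda>q. 0)" by (rule Ck_function_const)
    then show ?case unfolding smoothable_def by blast
  next
    case (insert p F)
    show ?case using V(3)[OF insert.IH, of p] by (simp only: UN_insert Un_commute)
  qed
  then show ?thesis using F(2) by (rule smoothable_subset)
qed

end

context complete_riemannian_manifold begin

text \<open>The cutoff is applied to a \<open>C1\<close> approximation of the distance with error at most one and gradient at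
  most three. These errors cost a margin of one at both ends, and \<open>R \<ge> 8\<close> leaves a quarter of \<open>R\<close> for the
  descent. Beyond \<open>R + 1\<close> the approximation is not controlled and the function is set to zero.\<close>

lemma distance_cutoff:
  assumes "R \<ge> 8"
  obtains \<psi> where "C1 \<psi>" "\<And>q. 0 \<le> \<psi> q" "\<And>q. \<psi> q \<le> 1"
    "\<And>q. rdist x0 q \<le> R / 2 \<Longrightarrow> \<psi> q = 1" "\<And>q. R \<le> rdist x0 q \<Longrightarrow> \<psi> q = 0"
    "\<And>q. grad_norm charts g \<psi> q \<le> 48 / R" "\<And>q. rdist x0 q < R / 2 \<Longrightarrow> grad_norm charts g \<psi> q = 0"
proof -
  have "smoothable x0 {q. rdist x0 q \<le> R + 1}" by (intro smoothable_compact compact_rdist_le)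
  from this[unfolded smoothable_def, rule_format, OF zero_less_one]
  obtain m where m0: "C1 m" "\<forall>q\<in>{q. rdist x0 q \<le> R + 1}.
      \<bar>m q - rdist x0 q\<bar> \<le> 1 \<and> grad_norm charts g m q \<le> 2 + 1" by blast
  then have m: "C1 m" "\<And>q. rdist x0 q \<le> R + 1 \<Longrightarrow> \<bar>m q - rdist x0 q\<bar> \<le> 1"
    "\<And>q. rdist x0 q \<le> R + 1 \<Longrightarrow> grad_norm charts g m q \<le> 3" by simp_all
  define a b where "a = R / 2 + 1" and "b = R - 1"
  have ab: "a < b" "R / 4 \<le> b - a" using assms by (auto simp: a_def b_def)
  define v where "v q = cutoff a b (m q)" for q
  have Cv: "C1 v" unfolding v_def
    by (rule C1_compose[OF m(1) has_real_derivative_cutoff continuous_on_cutoff'[OF ab(1)]])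
  define \<psi> where "\<psi> q = (if rdist x0 q < R + 1 then v q else 0)" for q
  have far: "v q = 0" if "R \<le> rdist x0 q" "rdist x0 q \<le> R + 1" for q
    using m(2)[OF that(2)] that(1) unfolding v_def by (intro cutoff_ge[OF ab(1)]) (auto simp: b_def)
  have near: "v q = 1" if "rdist x0 q \<le> R / 2" for q
    using m(2)[of q] that assms unfolding v_def by (intro cutoff_le) (auto simp: a_def)
  have o: "open {q. rdist x0 q < S}" "open {q. S < rdist x0 q}" for S
    by (intro open_Collect_less continuous_on_rdist continuous_on_const)+
  have in_: "\<psi> q = v q" if "q \<in> {q. rdist x0 q < R + 1}" for q using that by (simp add: \<psi>_def)
  have out: "\<psi> q = 0" if "q \<in> {q. R < rdist x0 q}" for q using that far[of q] by (auto simp: \<psi>_def)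
  have un: "{q. rdist x0 q < R + 1} \<union> {q. R < rdist x0 q} = UNIV" by auto
  have C: "C1 \<psi>" by (rule Ck_function_glue[OF Cv Ck_function_const o un in_ out])
  have one: "\<psi> q = 1" if "rdist x0 q \<le> R / 2" for q
    using near[OF that] that assms by (simp add: \<psi>_def)
  show ?thesis
  proof (rule that[OF C])
    show "0 \<le> \<psi> q" "\<psi> q \<le> 1" for q by (simp_all add: \<psi>_def v_def cutoff_bounds)
    show "\<psi> q = 1" if "rdist x0 q \<le> R / 2" for q by (rule one[OF that])
    show "\<psi> q = 0" if "R \<le> rdist x0 q" for q using far[OF that] by (simp add: \<psi>_def)
    show "grad_norm charts g \<psi> q = 0" if "rdist x0 q < R / 2" for q
    proof -
      have "grad_norm charts g \<psi> q = grad_norm charts g (\<lambda>q. 1) q"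
        by (rule grad_norm_local[OF C Ck_function_const o(1)[of "R / 2"]]) (use that one in simp_all)
      then show ?thesis by (simp add: grad_norm_def grad_inner_const Ck_function_const)
    qed
    show "grad_norm charts g \<psi> q \<le> 48 / R" for q
    proof (cases "rdist x0 q < R + 1")
      case True
      have "grad_norm charts g \<psi> q = grad_norm charts g v q"
        by (rule grad_norm_local[OF C Cv o(1)[of "R + 1"] _ in_]) (use True in simp_all)
      also have "\<dots> \<le> \<bar>cutoff' a b (m q)\<bar> * grad_norm charts g m q"
        unfolding v_def
        by (rule grad_norm_compose[OF m(1) has_real_derivative_cutoff continuous_on_cutoff'[OF ab(1)]])
      also have "\<dots> \<le> 4 / (b - a) * 3"
        using True m(3)[of q] cutoff'_bound[OF ab(1)] ab(1) grad_norm_nonneg[OF m(1)]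
        by (intro mult_mono) auto
      also have "\<dots> \<le> 4 / (R / 4) * 3"
        using ab assms by (intro mult_right_mono divide_left_mono) auto
      finally show ?thesis by simp
    next
      case False
      have "grad_norm charts g \<psi> q = grad_norm charts g (\<lambda>q. 0) q"
        by (rule grad_norm_local[OF C Ck_function_const o(2)[of R] _ out]) (use False in simp_all)
      then show ?thesis using assms by (simp add: grad_norm_def grad_inner_const Ck_function_const)
    qed
  qed
qed

end


section \<open>The Riemannian volume\<close>

lemma quad_ge_norm:
  fixes A :: "real^'n^'n"
  assumes "posdef A"
  obtains k where "k > 0" "\<And>v. k * (norm v)\<^sup>2 \<le> quad A v v"
proof -
  let ?S = "sphere 0 1 :: (real^'n) set"
  have "axis undefined 1 \<in> ?S" by (simp add: norm_axis_1)
  then have ne: "?S \<noteq> {}" by blast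
  have c: "continuous_on ?S (\<lambda>v. quad A v v)"
    by (intro continuous_intros linear_continuous_on matrix_vector_mul_bounded_linear)
  obtain e where e: "e \<in> ?S" "\<And>v. v \<in> ?S \<Longrightarrow> quad A e e \<le> quad A v v"
    using continuous_attains_inf[OF compact_sphere ne c] by blast
  show ?thesis
  proof (rule that)
    have "e \<noteq> 0" using e(1) by auto
    then show "quad A e e > 0" using assms by (simp add: posdef_def)
    fix v
    show "quad A e e * (norm v)\<^sup>2 \<le> quad A v v"
    proof (cases "v = 0")
      case False
      define w where "w = (1 / norm v) *\<^sub>R v"
      have "w \<in> ?S" "v = norm v *\<^sub>R w" using False by (auto simp: w_def)
      have "quad A (norm v *\<^sub>R w) (norm v *\<^sub>R w) = (norm v)\<^sup>2 * quad A w w"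
        by (simp add: matrix_vector_mult_scaleR power2_eq_square)
      then have "quad A v v = (norm v)\<^sup>2 * quad A w w" using \<open>v = norm v *\<^sub>R w\<close> by metis
      then show ?thesis
        using mult_left_mono[OF e(2)[OF \<open>w \<in> ?S\<close>] zero_le_power2[of "norm v"]] by (simp add: mult.commute)
    qed simp
  qed
qed

lemma integral_abs_le:
  fixes f h :: "'b \<Rightarrow> real"
  assumes "integrable M f" "integrable M h" "\<And>x. \<bar>f x\<bar> \<le> h x"
  shows "\<bar>\<integral>x. f x \<partial>M\<bar> \<le> (\<integral>x. h x \<partial>M)"
  using integral_abs_bound[of M f] Bochner_Integration.integral_mono[OF integrable_abs[OF assms(1)] assms(2,3)]
  by linarith

locale riemannian_measure_space = complete_riemannian_manifold charts g
  for charts :: "('a::{t2_space, second_countable_topology}, 'n::finite) chart set" and g +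
  fixes dV :: "'a measure"
  assumes volume: "riemannian_volume charts g dV"
begin

lemma sets_dV [simp, measurable_cong]: "sets dV = sets borel"
  using volume by (simp add: riemannian_volume_def)

lemma space_dV [simp]: "space dV = UNIV"
  using sets_eq_imp_space_eq[OF sets_dV] by simp

lemma volume_coordinate_ball:
  assumes c: "c \<in> charts" and "cball y t \<subseteq> chart_image c" "t > 0"
  obtains k L where "0 < k" "0 < L" "ennreal (k * measure lborel (ball y t)) \<le> emeasure dV (inv_chart c ` ball y t)"
    "emeasure dV (inv_chart c ` ball y t) \<le> ennreal (L * measure lborel (ball y t))"
proof -
  let ?w = "\<lambda>y. sqrt (det (g c (inv_chart c y)))"
  have sub: "ball y t \<subseteq> chart_image c" using assms(2) by auto
  have w: "continuous_on (cball y t) ?w"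
    by (intro continuous_intros continuous_on_det continuous_on_subset[OF metric_entry_continuous[OF c] assms(2)])
  have pos: "?w z > 0" if "z \<in> cball y t" for z
    using posdef_det_pos[OF posdef_metric[OF c inv_chart_in[OF c]], of z] that assms(2) by auto
  have ne: "cball y t \<noteq> {}" using assms(3) by auto
  obtain z1 where z1: "z1 \<in> cball y t" "\<And>z. z \<in> cball y t \<Longrightarrow> ?w z1 \<le> ?w z"
    using continuous_attains_inf[OF compact_cball ne w] by blast
  obtain z2 where z2: "z2 \<in> cball y t" "\<And>z. z \<in> cball y t \<Longrightarrow> ?w z \<le> ?w z2"
    using continuous_attains_sup[OF compact_cball ne w] by blast
  have o: "open (inv_chart c ` ball y t)" by (rule open_inv_chart_image[OF c open_ball sub])
  have "snd c ` inv_chart c ` ball y t = ball y t"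
    using sub by (force simp: image_image chart_inv_chart[OF c] subset_iff)
  moreover have "inv_chart c ` ball y t \<subseteq> fst c" using sub inv_chart_in[OF c] by blast
  ultimately have em: "emeasure dV (inv_chart c ` ball y t) = (\<integral>\<^sup>+z\<in>ball y t. ennreal (?w z) \<partial>lborel)"
    using volume c o unfolding riemannian_volume_def by auto
  have fin: "emeasure lborel (ball y t) = ennreal (measure lborel (ball y t))"
    using emeasure_lborel_ball_finite[of y t] by (intro emeasure_eq_ennreal_measure) auto
  have const: "(\<integral>\<^sup>+z\<in>ball y t. ennreal k \<partial>lborel) = ennreal (k * measure lborel (ball y t))" if "k > 0" for k
    using that by (simp add: nn_integral_cmult_indicator fin ennreal_mult)
  show ?thesis
  proof (rule that[of "?w z1" "?w z2"])
    show "0 < ?w z1" "0 < ?w z2" using pos z1(1) z2(1) by auto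
    show "ennreal (?w z1 * measure lborel (ball y t)) \<le> emeasure dV (inv_chart c ` ball y t)"
      unfolding em const[OF pos[OF z1(1)], symmetric] using z1(2)
      by (intro nn_integral_mono) (auto simp: indicator_def intro!: ennreal_leI)
    show "emeasure dV (inv_chart c ` ball y t) \<le> ennreal (?w z2 * measure lborel (ball y t))"
      unfolding em const[OF pos[OF z2(1)], symmetric] using z2(2)
      by (intro nn_integral_mono) (auto simp: indicator_def intro!: ennreal_leI)
  qed
qed

lemma emeasure_compact_finite:
  assumes "compact K" shows "emeasure dV K < \<infinity>"
proof -
  have "\<exists>V. open V \<and> p \<in> V \<and> emeasure dV V < \<infinity>" for p
  proof -
    let ?c = "chart_at charts p"
    have c: "?c \<in> charts" "p \<in> fst ?c" by (rule chart_at_in)+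
    obtain t where t: "t > 0" "cball (snd ?c p) t \<subseteq> chart_image ?c"
      by (rule chart_ball[OF c open_UNIV UNIV_I]) (rule that)
    obtain L where "emeasure dV (inv_chart ?c ` ball (snd ?c p) t) \<le> ennreal L"
      by (rule volume_coordinate_ball[OF c(1) t(2,1)]) (rule that)
    then have "emeasure dV (inv_chart ?c ` ball (snd ?c p) t) < \<infinity>" using le_less_trans by fastforce
    moreover have "ball (snd ?c p) t \<subseteq> chart_image ?c" using t(2) by auto
    from open_inv_chart_image[OF c(1) open_ball this] have "open (inv_chart ?c ` ball (snd ?c p) t)" .
    moreover have "p \<in> inv_chart ?c ` ball (snd ?c p) t"
      using t(1) inv_chart_chart[OF c] by (intro image_eqI[of _ _ "snd ?c p"]) auto
    ultimately show ?thesis by blast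
  qed
  then obtain V where V: "\<And>p. open (V p)" "\<And>p. p \<in> V p" "\<And>p. emeasure dV (V p) < \<infinity>" by metis
  have cov: "K \<subseteq> (\<Union>p\<in>K. V p)" using V(2) by blast
  obtain F where F: "finite F" "K \<subseteq> (\<Union>p\<in>F. V p)"
    by (rule compactE_image[OF assms V(1) cov]) (rule that)
  have "emeasure dV K \<le> emeasure dV (\<Union>p\<in>F. V p)" using F(2) V(1) by (intro emeasure_mono) (auto intro!: borel_open)
  also have "\<dots> \<le> (\<Sum>p\<in>F. emeasure dV (V p))"
    using F(1) V(1) by (intro emeasure_subadditive_finite) auto
  also have "\<dots> < \<infinity>" using F(1) V(3) by simp
  finally show ?thesis .
qed

lemma emeasure_open_pos:
  assumes "open U" "p \<in> U" shows "emeasure dV U > 0"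
proof -
  let ?c = "chart_at charts p"
  have c: "?c \<in> charts" "p \<in> fst ?c" by (rule chart_at_in)+
  obtain t where t: "t > 0" "cball (snd ?c p) t \<subseteq> chart_image ?c" "inv_chart ?c ` cball (snd ?c p) t \<subseteq> U"
    by (rule chart_ball[OF c assms]) (rule that)
  obtain k where k: "k > 0"
    "ennreal (k * measure lborel (ball (snd ?c p) t)) \<le> emeasure dV (inv_chart ?c ` ball (snd ?c p) t)"
    by (rule volume_coordinate_ball[OF c(1) t(2,1)]) (rule that)
  have "0 < ennreal (k * measure lborel (ball (snd ?c p) t))"
    using k(1) content_ball_pos[OF t(1)] by (simp add: measure_completion)
  also note k(2)
  also have "emeasure dV (inv_chart ?c ` ball (snd ?c p) t) \<le> emeasure dV U"
    using t(3) assms(1) by (intro emeasure_mono) (auto dest: image_mono[OF ball_subset_cball, THEN subsetD])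
  finally show ?thesis .
qed

lemma integrable_continuous_compact:
  fixes h :: "'a \<Rightarrow> real"
  assumes "continuous_on UNIV h" "compact K" "\<And>x. x \<notin> K \<Longrightarrow> h x = 0"
  shows "integrable dV h"
proof -
  obtain B where B: "\<And>x. x \<in> K \<Longrightarrow> norm (h x) \<le> B"
    using compact_imp_bounded[OF compact_continuous_image[OF continuous_on_subset[OF assms(1)] assms(2)]]
    unfolding bounded_iff by auto
  have K: "K \<in> sets borel" using assms(2) by (simp add: borel_closed compact_imp_closed)
  have i: "integrable dV (\<lambda>x. B * indicator K x)"
    using emeasure_compact_finite[OF assms(2)] K by (intro integrable_mult_right integrable_real_indicator) auto
  show ?thesis
  proof (rule Bochner_Integration.integrable_bound[OF i])
    show "h \<in> borel_measurable dV"
      using borel_measurable_continuous_onI[OF assms(1)] by measurable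
    show "AE x in dV. norm (h x) \<le> norm (B * indicator K x)"
    proof (rule AE_I2)
      fix x show "norm (h x) \<le> norm (B * indicator K x)"
        using B[of x] assms(3)[of x] by (cases "x \<in> K") auto
    qed
  qed
qed

lemma integrable_dominated:
  fixes h a :: "'a \<Rightarrow> real"
  assumes "continuous_on UNIV h" "compact K" "\<And>x. x \<notin> K \<Longrightarrow> h x = 0"
    and "a \<in> borel_measurable borel" "\<And>x. \<bar>a x\<bar> \<le> h x"
  shows "integrable dV a"
proof (rule Bochner_Integration.integrable_bound[OF integrable_continuous_compact[OF assms(1-3)]])
  show "a \<in> borel_measurable dV" using assms(4) by measurable
  show "AE x in dV. norm (a x) \<le> norm (h x)"
    using assms(5) by (intro AE_I2) (metis abs_ge_self order_trans real_norm_def)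
qed

end


section \<open>Weak solutions tested with \<open>C1\<close> functions\<close>

locale weak_solution = riemannian_measure_space charts g dV
  for charts :: "('a::{t2_space, second_countable_topology}, 'n::finite) chart set" and g and dV +
  fixes D u b :: "'a \<Rightarrow> real" and \<phi> f l :: "real \<Rightarrow> real"
  assumes D_cont: "continuous_on UNIV D" and D_pos: "\<And>x. D x > 0"
    and phi_cont: "continuous_on {0..} \<phi>" and phi_nonneg: "\<And>t. t \<ge> 0 \<Longrightarrow> \<phi> t \<ge> 0" and phi_0: "\<phi> 0 = 0"
    and f_cont: "continuous_on (range u) f" and l_cont: "continuous_on {0..} l"
    and b_cont: "continuous_on UNIV b"
    and weak: "entire_classical_weak_solution charts g dV D \<phi> b f l u"
begin

definition G :: "'a \<Rightarrow> real" where "G = grad_norm charts g u"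

definition flux :: "('a \<Rightarrow> real) \<Rightarrow> 'a \<Rightarrow> real" where
  "flux \<psi> x = inverse (G x) * \<phi> (G x) * grad_inner charts g u \<psi> x * D x"

definition source :: "'a \<Rightarrow> real" where
  "source x = b x * f (u x) * l (G x)"

lemma u_C1: "C1 u"
  using weak unfolding entire_classical_weak_solution_def by simp

lemma u_cont: "continuous_on UNIV u" by (rule Ck_function_continuous[OF u_C1])

lemma G_nonneg: "G x \<ge> 0" unfolding G_def by (rule grad_norm_nonneg[OF u_C1])

lemma G_cont: "continuous_on UNIV G" unfolding G_def by (rule grad_norm_continuous[OF u_C1])

lemma phi_G_cont: "continuous_on UNIV (\<lambda>x. \<phi> (G x))"
  by (rule continuous_on_compose2[OF phi_cont G_cont]) (auto simp: G_nonneg)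

lemma source_cont: "continuous_on UNIV source"
  unfolding source_def[abs_def]
  by (intro continuous_intros b_cont continuous_on_compose2[OF f_cont u_cont]
      continuous_on_compose2[OF l_cont G_cont]) (auto simp: G_nonneg)

lemma weak_smooth:
  assumes "test_function charts \<psi>" "\<And>x. \<psi> x \<ge> 0"
  shows "(\<integral>x. source x * \<psi> x * D x \<partial>dV) \<le> - (\<integral>x. flux \<psi> x \<partial>dV)"
  using weak assms unfolding entire_classical_weak_solution_def flux_def source_def G_def by blast

lemma flux_bound:
  assumes "C1 \<psi>" shows "\<bar>flux \<psi> x\<bar> \<le> \<phi> (G x) * grad_norm charts g \<psi> x * D x"
proof (cases "G x = 0")
  case False
  then have pos: "G x > 0" using G_nonneg[of x] by simp
  have "\<bar>grad_inner charts g u \<psi> x\<bar> \<le> G x * grad_norm charts g \<psi> x"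
    unfolding G_def by (rule grad_inner_bound[OF u_C1 assms])
  then have "inverse (G x) * \<bar>grad_inner charts g u \<psi> x\<bar> \<le> grad_norm charts g \<psi> x"
    using pos by (simp add: field_simps)
  then have "\<phi> (G x) * (inverse (G x) * \<bar>grad_inner charts g u \<psi> x\<bar>) * D x
      \<le> \<phi> (G x) * grad_norm charts g \<psi> x * D x"
    using phi_nonneg[OF G_nonneg] D_pos[of x] by (intro mult_right_mono mult_left_mono) auto
  then show ?thesis
    using pos phi_nonneg[OF G_nonneg, of x] D_pos[of x] by (simp add: flux_def abs_mult mult_ac)
qed (use phi_0 in \<open>simp add: flux_def\<close>)

lemma grad_norm_support:
  assumes "C1 \<psi>" "compact K" "\<And>x. x \<notin> K \<Longrightarrow> \<psi> x = 0" "x \<notin> K"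
  shows "grad_norm charts g \<psi> x = 0"
proof -
  have "grad_norm charts g \<psi> x = grad_norm charts g (\<lambda>p. 0) x"
    by (rule grad_norm_local[OF assms(1) Ck_function_const, of "- K"])
       (use assms compact_imp_closed in auto)
  then show ?thesis by (simp add: grad_norm_def grad_inner_const Ck_function_const)
qed

lemma flux_measurable: "C1 \<psi> \<Longrightarrow> flux \<psi> \<in> borel_measurable borel"
  unfolding flux_def[abs_def]
  by (intro borel_measurable_times borel_measurable_inverse borel_measurable_continuous_onI
      G_cont phi_G_cont D_cont grad_inner_continuous u_C1)

lemma flux_integrable:
  assumes "C1 \<psi>" "compact K" "\<And>x. x \<notin> K \<Longrightarrow> \<psi> x = 0"
  shows "integrable dV (flux \<psi>)"
proof (rule integrable_dominated[OF _ assms(2) _ flux_measurable[OF assms(1)] flux_bound[OF assms(1)]])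
  show "continuous_on UNIV (\<lambda>x. \<phi> (G x) * grad_norm charts g \<psi> x * D x)"
    by (intro continuous_intros phi_G_cont grad_norm_continuous assms(1) D_cont)
qed (simp add: grad_norm_support[OF assms])

lemma source_integrable:
  assumes "C1 \<psi>" "compact K" "\<And>x. x \<notin> K \<Longrightarrow> \<psi> x = 0"
  shows "integrable dV (\<lambda>x. source x * \<psi> x * D x)"
  by (rule integrable_continuous_compact[OF _ assms(2)])
     (auto simp: assms(3) intro!: continuous_intros source_cont Ck_function_continuous[OF assms(1)] D_cont)

lemma flux_add:
  "C1 v \<Longrightarrow> C1 w \<Longrightarrow> flux (\<lambda>x. v x + w x) x = flux v x + flux w x"
  by (simp add: flux_def grad_inner_add[OF u_C1] algebra_simps)

definition admissible :: "('a \<Rightarrow> real) \<Rightarrow> bool" where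
  "admissible \<psi> \<longleftrightarrow> (\<integral>x. source x * \<psi> x * D x \<partial>dV) \<le> - (\<integral>x. flux \<psi> x \<partial>dV)"

lemma admissible_add:
  assumes "C1 v" "C1 w" "compact K" "\<And>x. x \<notin> K \<Longrightarrow> v x = 0" "compact L" "\<And>x. x \<notin> L \<Longrightarrow> w x = 0"
    and "admissible v" "admissible w"
  shows "admissible (\<lambda>x. v x + w x)"
proof -
  have "(\<integral>x. source x * (v x + w x) * D x \<partial>dV) = (\<integral>x. source x * v x * D x \<partial>dV) + (\<integral>x. source x * w x * D x \<partial>dV)"
    using source_integrable[OF assms(1,3,4)] source_integrable[OF assms(2,5,6)]
    by (subst Bochner_Integration.integral_add[symmetric]) (auto simp: algebra_simps)
  moreover have "(\<integral>x. flux (\<lambda>x. v x + w x) x \<partial>dV) = (\<integral>x. flux v x \<partial>dV) + (\<integral>x. flux w x \<partial>dV)"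
    using flux_integrable[OF assms(1,3,4)] flux_integrable[OF assms(2,5,6)]
    using Bochner_Integration.integral_add[of dV "flux v" "flux w"]
    by (simp add: flux_add[OF assms(1,2), abs_def])
  ultimately show ?thesis using assms(7,8) by (simp add: admissible_def)
qed

text \<open>Both sides of the inequality are continuous under \<open>C1\<close> convergence with supports in a fixed compact
  set.\<close>

lemma admissible_limit:
  assumes \<psi>: "C1 \<psi>" and K: "compact K" "\<And>x. x \<notin> K \<Longrightarrow> \<psi> x = 0" and "L \<ge> 0"
    and approx: "\<And>e. e > 0 \<Longrightarrow> \<exists>w. C1 w \<and> admissible w \<and> (\<forall>x. x \<notin> K \<longrightarrow> w x = 0) \<and>
       (\<forall>x. \<bar>w x - \<psi> x\<bar> \<le> e) \<and> (\<forall>x. grad_norm charts g (\<lambda>x. w x - \<psi> x) x \<le> L * e)"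
  shows "admissible \<psi>"
  unfolding admissible_def
proof (rule field_le_epsilon)
  fix e :: real assume "e > 0"
  have Kb: "K \<in> sets borel" using K(1) by (simp add: borel_closed compact_imp_closed)
  have bound: "\<exists>B\<ge>0. \<forall>x\<in>K. \<bar>h x\<bar> \<le> B" if h: "continuous_on UNIV h" for h :: "'a \<Rightarrow> real"
  proof -
    obtain B where "B > 0" "\<And>y. y \<in> h ` K \<Longrightarrow> norm y \<le> B"
      using compact_imp_bounded[OF compact_continuous_image[OF continuous_on_subset[OF h subset_UNIV] K(1)]]
      unfolding bounded_pos by blast
    then show ?thesis by (intro exI[of _ B]) auto
  qed
  obtain B1 where B1: "B1 \<ge> 0" "\<And>x. x \<in> K \<Longrightarrow> \<bar>source x * D x\<bar> \<le> B1"
    using bound[OF continuous_on_mult[OF source_cont D_cont]] by blast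
  obtain B2 where B2: "B2 \<ge> 0" "\<And>x. x \<in> K \<Longrightarrow> \<bar>\<phi> (G x) * D x\<bar> \<le> B2"
    using bound[OF continuous_on_mult[OF phi_G_cont D_cont]] by blast
  define m where "m = measure dV K"
  define d where "d = e / ((B1 + B2 * L) * m + 1)"
  have pos: "(B1 + B2 * L) * m + 1 > 0" "(B1 + B2 * L) * m \<ge> 0"
    using B1(1) B2(1) assms(4) by (auto simp: m_def add_nonneg_pos)
  have d: "d > 0" "(B1 + B2 * L) * m * d \<le> e"
  proof -
    show "d > 0" using \<open>e > 0\<close> pos by (simp add: d_def)
    have "(B1 + B2 * L) * m * d \<le> ((B1 + B2 * L) * m + 1) * d" using \<open>d > 0\<close> by (intro mult_right_mono) auto
    also have "\<dots> = e" using pos by (simp add: d_def)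
    finally show "(B1 + B2 * L) * m * d \<le> e" .
  qed
  obtain w where w: "C1 w" "admissible w" "\<And>x. x \<notin> K \<Longrightarrow> w x = 0" "\<And>x. \<bar>w x - \<psi> x\<bar> \<le> d"
    "\<And>x. grad_norm charts g (\<lambda>x. w x - \<psi> x) x \<le> L * d"
    using approx[OF d(1)] by blast
  have Cd: "C1 (\<lambda>x. w x - \<psi> x)" by (rule Ck_function_diff[OF w(1) \<psi>])
  have d0: "w x - \<psi> x = 0" if "x \<notin> K" for x using that K(2) w(3) by simp
  have ind: "integrable dV (\<lambda>x. B * indicator K x)" "(\<integral>x. B * indicator K x \<partial>dV) = B * m" for B
    using emeasure_compact_finite[OF K(1)] Kb by (simp_all add: m_def)
  have S: "\<bar>(\<integral>x. source x * (w x - \<psi> x) * D x \<partial>dV)\<bar> \<le> (B1 * d) * m"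
  proof -
    have "\<bar>source x * (w x - \<psi> x) * D x\<bar> \<le> (B1 * d) * indicator K x" for x
    proof (cases "x \<in> K")
      case True
      have "\<bar>source x * D x\<bar> * \<bar>w x - \<psi> x\<bar> \<le> B1 * d" using B1 True w(4) by (intro mult_mono) auto
      then show ?thesis using True by (simp add: abs_mult mult_ac)
    qed (simp add: d0)
    note * = this
    have "\<bar>(\<integral>x. source x * (w x - \<psi> x) * D x \<partial>dV)\<bar> \<le> (\<integral>x. (B1 * d) * indicator K x \<partial>dV)"
      by (rule integral_abs_le[OF source_integrable[OF Cd K(1) d0] ind(1) *])
    then show ?thesis by (simp only: ind(2))
  qed
  have F: "\<bar>(\<integral>x. flux (\<lambda>x. w x - \<psi> x) x \<partial>dV)\<bar> \<le> (B2 * (L * d)) * m"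
  proof -
    have "\<bar>flux (\<lambda>x. w x - \<psi> x) x\<bar> \<le> (B2 * (L * d)) * indicator K x" for x
    proof (cases "x \<in> K")
      case True
      have "\<bar>\<phi> (G x) * D x\<bar> * grad_norm charts g (\<lambda>x. w x - \<psi> x) x \<le> B2 * (L * d)"
        using B2 True w(5) grad_norm_nonneg[OF Cd] by (intro mult_mono) auto
      then show ?thesis
        using flux_bound[OF Cd, of x] True D_pos[of x] phi_nonneg[OF G_nonneg, of x] by (simp add: mult_ac)
    next
      case False
      then show ?thesis
        using flux_bound[OF Cd, of x] grad_norm_support[OF Cd K(1) d0 False] by simp
    qed
    note * = this
    have "\<bar>(\<integral>x. flux (\<lambda>x. w x - \<psi> x) x \<partial>dV)\<bar> \<le> (\<integral>x. (B2 * (L * d)) * indicator K x \<partial>dV)"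
      by (rule integral_abs_le[OF flux_integrable[OF Cd K(1) d0] ind(1) *])
    then show ?thesis by (simp only: ind(2))
  qed
  have eqS: "(\<integral>x. source x * w x * D x \<partial>dV) = (\<integral>x. source x * \<psi> x * D x \<partial>dV) + (\<integral>x. source x * (w x - \<psi> x) * D x \<partial>dV)"
    by (subst Bochner_Integration.integral_add[symmetric, OF source_integrable[OF \<psi> K] source_integrable[OF Cd K(1) d0]])
       (auto simp: algebra_simps)
  have "flux w x = flux \<psi> x + flux (\<lambda>x. w x - \<psi> x) x" for x
    using flux_add[OF \<psi> Cd, of x] by simp
  then have eqF: "(\<integral>x. flux w x \<partial>dV) = (\<integral>x. flux \<psi> x \<partial>dV) + (\<integral>x. flux (\<lambda>x. w x - \<psi> x) x \<partial>dV)"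
    using Bochner_Integration.integral_add[OF flux_integrable[OF \<psi> K] flux_integrable[OF Cd K(1) d0]] by simp
  have "(B1 * d) * m + (B2 * (L * d)) * m \<le> e" using d(2) by (simp add: algebra_simps)
  then show "(\<integral>x. source x * \<psi> x * D x \<partial>dV) \<le> - (\<integral>x. flux \<psi> x \<partial>dV) + e"
    using w(2) S F unfolding admissible_def eqS eqF by linarith
qed

lemma compact_support_translates:
  fixes h :: "real^'n \<Rightarrow> real"
  assumes h: "continuous_on UNIV h" and K: "compact K" "\<And>y. y \<notin> K \<Longrightarrow> h y = 0" and "e > 0"
  shows "\<exists>d>0. \<forall>y z. norm z < d \<longrightarrow> \<bar>h (y - z) - h y\<bar> \<le> e"
proof -
  define Q where "Q = (\<Union>x\<in>K. \<Union>y\<in>cball (0::real^'n) 1. {x + y})"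
  have "compact Q" unfolding Q_def by (rule compact_sums'[OF K(1) compact_cball])
  then have "uniformly_continuous_on Q h"
    using continuous_on_subset[OF h] by (intro compact_uniformly_continuous) auto
  then obtain d where d: "d > 0" "\<And>x x'. x \<in> Q \<Longrightarrow> x' \<in> Q \<Longrightarrow> dist x' x < d \<Longrightarrow> dist (h x') (h x) < e"
    using \<open>e > 0\<close> unfolding uniformly_continuous_on_def by metis
  have "\<bar>h (y - z) - h y\<bar> \<le> e" if z: "norm z < min 1 d" for y z
  proof (cases "y \<in> K \<or> y - z \<in> K")
    case True
    have "y \<in> Q \<and> y - z \<in> Q"
      using True
    proof
      assume y: "y \<in> K"
      have "y = y + 0" "y - z = y + (- z)" "0 \<in> cball (0::real^'n) 1" "- z \<in> cball 0 1" using z by auto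
      then show ?thesis unfolding Q_def using y by blast
    next
      assume y: "y - z \<in> K"
      have "y = (y - z) + z" "y - z = (y - z) + 0" "0 \<in> cball (0::real^'n) 1" "z \<in> cball 0 1" using z by auto
      then show ?thesis unfolding Q_def using y by blast
    qed
    then show ?thesis using d(2)[of y "y - z"] z by (simp add: dist_norm)
  qed (use K(2) \<open>e > 0\<close> in simp)
  then show ?thesis using d(1) by (intro exI[of _ "min 1 d"]) simp
qed

text \<open>In one chart, mollifications of a compactly supported \<open>C1\<close> function converge uniformly together with
  their partial derivatives. The constant \<open>k\<close> translates the latter into Riemannian gradients.\<close>

lemma admissible_local:
  assumes c: "c \<in> charts" and t: "t > 0" "cball y0 t \<subseteq> chart_image c" and "k > 0"
    and k: "\<And>y v. y \<in> cball y0 t \<Longrightarrow> k * (norm v)\<^sup>2 \<le> quad (g c (inv_chart c y)) v v"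
    and \<psi>: "C1 \<psi>" "\<And>x. \<psi> x \<ge> 0" "\<And>x. x \<notin> inv_chart c ` cball y0 (t/2) \<Longrightarrow> \<psi> x = 0"
  shows "admissible \<psi>"
proof -
  define F where "F y = (if y \<in> chart_image c then \<psi> (inv_chart c y) else 0)" for y
  have half: "cball y0 (t/2) \<subseteq> cball y0 t" "cball y0 (t/2) \<subseteq> chart_image c"
    using t by (auto simp: subset_iff)
  have F0: "F y = 0" if "y \<notin> cball y0 (t/2)" for y
  proof (cases "y \<in> chart_image c")
    case True
    have "inv_chart c y \<notin> inv_chart c ` cball y0 (t/2)"
    proof
      assume "inv_chart c y \<in> inv_chart c ` cball y0 (t/2)"
      then obtain z where "z \<in> cball y0 (t/2)" "inv_chart c y = inv_chart c z" by blast
      then show False using chart_inv_chart[OF c True] chart_inv_chart[OF c, of z] half(2) that by auto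
    qed
    then show ?thesis using \<psi>(3) by (simp add: F_def)
  qed (simp add: F_def)
  have o: "open (chart_image c)" "open (- cball y0 (t/2))" using open_chart(2)[OF c] by auto
  have C\<psi>: "Ck_on (Suc 0) (chart_image c) (\<psi> \<circ> inv_chart c)"
    by (rule bspec[OF \<psi>(1)[unfolded Ck_function_def] c])
  have 1: "Ck_on (Suc 0) (chart_image c) F" by (rule Ck_on_cong[OF o(1) _ C\<psi>]) (simp add: F_def)
  have 2: "Ck_on (Suc 0) (- cball y0 (t/2)) F"
    by (rule Ck_on_cong[OF o(2) _ Ck_on_const[of _ _ 0]]) (simp add: F0)
  have un: "chart_image c \<union> - cball y0 (t/2) = UNIV" using half(2) by blast
  have CF: "Ck_on (Suc 0) UNIV F" using Ck_on_Un[OF o 1 2] by (simp only: un)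
  have Fc: "continuous_on UNIV F" by (rule Ck_on_continuous[OF CF]) simp
  have Fnn: "\<forall>y. F y \<ge> 0" using \<psi>(2) by (simp add: F_def)
  have pc: "continuous_on UNIV (partial i F)" for i using CF by simp
  have p0: "partial i F y = 0" if "y \<notin> cball y0 (t/2)" for i y
  proof -
    have "(F has_derivative (\<lambda>v. 0)) (at y)"
      by (rule has_derivative_transform_within_open[OF has_derivative_const o(2)])
         (use that F0 in auto)
    from frechet_derivative_at[OF this] show ?thesis by metis
  qed
  obtain a where a: "cball y0 (t/2) \<subseteq> cbox (- a) a"
    using bounded_subset_cbox_symmetric[OF bounded_cball] by blast
  have fbox: "F y = 0" if "y \<notin> cbox (- a) a" for y using a that by (intro F0) blast
  let ?K = "inv_chart c ` cball y0 t"
  define N where "N = real CARD('n)"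
  define L where "L = N / sqrt k"
  have L: "L \<ge> 0" using \<open>k > 0\<close> by (simp add: L_def N_def)
  have Kc: "compact ?K" by (rule compact_inv_chart[OF c compact_cball t(2)])
  have \<psi>K: "\<psi> x = 0" if "x \<notin> ?K" for x using that half(1) by (intro \<psi>(3)) blast
  show ?thesis
  proof (rule admissible_limit[OF \<psi>(1) Kc \<psi>K L])
    fix e :: real assume "e > 0"
    obtain d0 where d0: "d0 > 0" "\<And>y z. norm z < d0 \<Longrightarrow> \<bar>F (y - z) - F y\<bar> \<le> e"
      using compact_support_translates[OF Fc compact_cball F0 \<open>e > 0\<close>] by blast
    have "\<exists>d>0. \<forall>y z. norm z < d \<longrightarrow> \<bar>partial i F (y - z) - partial i F y\<bar> \<le> e" for i
      by (rule compact_support_translates[OF pc compact_cball p0 \<open>e > 0\<close>])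
    then obtain di where di: "\<And>i. di i > 0"
      "\<And>i y z. norm z < di i \<Longrightarrow> \<bar>partial i F (y - z) - partial i F y\<bar> \<le> e" by metis
    define d where "d = Min (insert (t/2) (insert d0 (range di)))"
    have d: "d > 0" "d \<le> t/2" "d \<le> d0"
      unfolding d_def using t(1) d0(1) di(1) by (auto simp: Min_gr_iff)
    have ddi: "d \<le> di i" for i unfolding d_def by (intro Min_le) auto
    obtain m where m: "\<And>k. Ck_on k UNIV m"
      "\<And>y c e. \<forall>z. norm z < d \<longrightarrow> \<bar>F (y - z) - c\<bar> \<le> e \<Longrightarrow> \<bar>m y - c\<bar> \<le> e"
      "\<And>x. \<forall>x. F x \<ge> 0 \<Longrightarrow> m x \<ge> 0"
      "\<And>i y c e. Ck_on (Suc 0) UNIV F \<Longrightarrow> \<forall>z. norm z < d \<longrightarrow> \<bar>partial i F (y - z) - c\<bar> \<le> e \<Longrightarrow> \<bar>partial i m y - c\<bar> \<le> e"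
      by (rule mollification[OF Fc fbox d(1)]) (assumption, rule that)
    have m0: "m y = 0" if y: "y \<notin> cball y0 t" for y
    proof -
      have "\<bar>m y - 0\<bar> \<le> 0"
      proof (rule m(2), intro allI impI)
        fix z :: "real^'n" assume z: "norm z < d"
        have "dist y0 y \<le> dist y0 (y - z) + norm z"
          using dist_triangle[of y0 y "y - z"] by (simp add: dist_norm)
        then have "y - z \<notin> cball y0 (t/2)" using y z d(2) by auto
        then show "\<bar>F (y - z) - 0\<bar> \<le> 0" by (simp add: F0)
      qed
      then show ?thesis by simp
    qed
    define w where "w = pull c m"
    have Cw: "C1 w" unfolding w_def by (rule Ck_function_pull[OF c compact_cball t(2) m0 m(1)])
    have wK: "w x = 0" if "x \<notin> ?K" for x unfolding w_def by (rule pull_support(2)[OF c t(2) m0 that])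
    have "Ck_function k charts w" for k
      unfolding w_def by (rule Ck_function_pull[OF c compact_cball t(2) m0 m(1)])
    moreover have "compact (closure {x. w x \<noteq> 0})"
      unfolding w_def by (rule compact_pull_support[OF c compact_cball t(2) m0])
    ultimately have "test_function charts w" by (simp add: test_function_def)
    then have adm: "admissible w"
      unfolding admissible_def by (rule weak_smooth) (simp add: w_def pull_def m(3)[OF Fnn])
    have close: "\<bar>m y - F y\<bar> \<le> e" for y by (rule m(2)) (use d(3) d0(2) in auto)
    have pclose: "\<bar>partial i m y - partial i F y\<bar> \<le> e" for i y
      by (rule m(4)[OF CF]) (use ddi[of i] di(2)[of _ i] in auto)
    have "\<bar>w x - \<psi> x\<bar> \<le> e" for x
    proof (cases "x \<in> fst c")
      case True
      then show ?thesis
        using close[of "snd c x"] by (simp add: w_def pull_def F_def chart_in inv_chart_chart[OF c])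
    next
      case False
      then have "x \<notin> ?K" using inv_chart_in[OF c] t(2) by blast
      then show ?thesis using \<psi>K wK \<open>e > 0\<close> by simp
    qed
    moreover have Cd: "C1 (\<lambda>x. w x - \<psi> x)" by (rule Ck_function_diff[OF Cw \<psi>(1)])
    have "grad_norm charts g (\<lambda>x. w x - \<psi> x) x \<le> L * e" for x
    proof (cases "x \<in> ?K")
      case True
      then obtain y where y: "y \<in> cball y0 t" "x = inv_chart c y" by blast
      have yc: "y \<in> chart_image c" using y(1) t(2) by blast
      have x: "x \<in> fst c" "snd c x = y" using yc c y(2) by (auto simp: inv_chart_in chart_inv_chart)
      have "((\<lambda>y. m y - F y) has_derivative (\<lambda>v. frechet_derivative m (at y) v - frechet_derivative F (at y) v)) (at y)"
        by (intro has_derivative_diff Ck_on_has_derivative[OF m(1)[of "Suc 0"]] Ck_on_has_derivative[OF CF]) auto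
      then have "(((\<lambda>x. w x - \<psi> x) \<circ> inv_chart c) has_derivative
          (\<lambda>v. frechet_derivative m (at y) v - frechet_derivative F (at y) v)) (at y)"
        by (rule has_derivative_transform_within_open[OF _ o(1) yc])
           (simp add: w_def pull_comp_inv_chart[OF c] F_def)
      then have D: "chart_deriv c (\<lambda>x. w x - \<psi> x) x = (\<lambda>v. frechet_derivative m (at y) v - frechet_derivative F (at y) v)"
        using x(2) by (intro chart_derivI) simp
      have lin: "linear (frechet_derivative m (at y))" "linear (frechet_derivative F (at y))"
        using has_derivative_linear[OF Ck_on_has_derivative[OF m(1)[of "Suc 0"] UNIV_I]]
          has_derivative_linear[OF Ck_on_has_derivative[OF CF UNIV_I]] by auto
      have "chart_deriv c (\<lambda>x. w x - \<psi> x) x v \<le> L * e * sqrt (quad (g c x) v v)" for v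
      proof -
        have "chart_deriv c (\<lambda>x. w x - \<psi> x) x v = (\<Sum>j\<in>UNIV. v $ j * (partial j m y - partial j F y))"
          unfolding D using linear_axis_sum[OF lin(1), of v] linear_axis_sum[OF lin(2), of v]
          by (simp add: right_diff_distrib sum_subtractf)
        also have "\<dots> \<le> (\<Sum>j\<in>(UNIV::'n set). norm v * e)"
        proof (rule sum_mono)
          fix j
          have "\<bar>v $ j\<bar> * \<bar>partial j m y - partial j F y\<bar> \<le> norm v * e"
            using component_le_norm_cart[of v j] pclose[where i = j and y = y] by (intro mult_mono) auto
          then show "v $ j * (partial j m y - partial j F y) \<le> norm v * e"
            by (metis abs_le_D1 abs_mult)
        qed
        also have "\<dots> = N * e * norm v" by (simp add: N_def)
        also have "\<dots> \<le> N * e * (sqrt (quad (g c x) v v) / sqrt k)"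
        proof (intro mult_left_mono)
          have "sqrt (k * (norm v)\<^sup>2) \<le> sqrt (quad (g c x) v v)"
            using k[OF y(1), of v] y(2) by simp
          then show "norm v \<le> sqrt (quad (g c x) v v) / sqrt k"
            using \<open>k > 0\<close> by (simp add: real_sqrt_mult field_simps)
        qed (use \<open>e > 0\<close> in \<open>simp add: N_def\<close>)
        also have "\<dots> = L * e * sqrt (quad (g c x) v v)" by (simp add: L_def)
        finally show ?thesis .
      qed
      then show ?thesis using L \<open>e > 0\<close> by (intro grad_norm_leI[OF Cd c x(1)]) auto
    next
      case False
      have "grad_norm charts g (\<lambda>x. w x - \<psi> x) x = 0"
        by (rule grad_norm_support[OF Cd Kc _ False]) (simp add: wK \<psi>K)
      then show ?thesis using L \<open>e > 0\<close> by simp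
    qed
    ultimately show "\<exists>w. C1 w \<and> admissible w \<and> (\<forall>x. x \<notin> ?K \<longrightarrow> w x = 0) \<and>
       (\<forall>x. \<bar>w x - \<psi> x\<bar> \<le> e) \<and> (\<forall>x. grad_norm charts g (\<lambda>x. w x - \<psi> x) x \<le> L * e)"
      using Cw adm wK by (intro exI[of _ w]) simp
  qed
qed

text \<open>Localisation: multiplying by a bump function \<open>h\<close> splits off a part supported in one chart, and the
  part with the factor \<open>1 - h\<close> is supported in a set that fewer charts cover.\<close>

theorem admissible_C1:
  assumes "C1 \<psi>" "\<And>x. \<psi> x \<ge> 0" "compact K" "\<And>x. x \<notin> K \<Longrightarrow> \<psi> x = 0"
  shows "admissible \<psi>"
proof -
  have "\<exists>V h C. open V \<and> p \<in> V \<and> compact C \<and> C1 h \<and> (\<forall>x. 0 \<le> h x) \<and> (\<forall>x. h x \<le> 1) \<and> (\<forall>x\<in>V. h x = 1) \<and>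
      (\<forall>x. x \<notin> C \<longrightarrow> h x = 0) \<and>
      (\<forall>v. C1 v \<longrightarrow> (\<forall>x. v x \<ge> 0) \<longrightarrow> (\<forall>x. x \<notin> C \<longrightarrow> v x = 0) \<longrightarrow> admissible v)" for p
  proof -
    define c where "c = chart_at charts p"
    have c: "c \<in> charts" "p \<in> fst c" unfolding c_def by (rule chart_at_in)+
    obtain t where t: "t > 0" "cball (snd c p) t \<subseteq> chart_image c" "inv_chart c ` cball (snd c p) t \<subseteq> UNIV"
      "\<And>y v. y \<in> cball (snd c p) t \<Longrightarrow> quad (g c (inv_chart c y)) v v \<le> 2 * quad (g c p) v v \<and>
         quad (g c p) v v \<le> 2 * quad (g c (inv_chart c y)) v v"
      by (rule metric_comparable[OF c open_UNIV UNIV_I]) (rule that)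
    obtain k where k: "k > 0" "\<And>v. k * (norm v)\<^sup>2 \<le> quad (g c p) v v"
      by (rule quad_ge_norm[OF posdef_metric[OF c]]) (rule that)
    have k2: "(k / 2) * (norm v)\<^sup>2 \<le> quad (g c (inv_chart c y)) v v" if "y \<in> cball (snd c p) t" for y v
      using t(4)[OF that, of v] k(2)[of v] by simp
    let ?B = "ball (snd c p) (t/2)"
    have B: "?B \<subseteq> chart_image c" using t(1,2) by (auto simp: subset_iff)
    have oU: "open (inv_chart c ` ?B)" by (rule open_inv_chart_image[OF c(1) open_ball B])
    have pU: "p \<in> inv_chart c ` ?B"
      using t(1) inv_chart_chart[OF c] by (intro image_eqI[of _ _ "snd c p"]) auto
    obtain h V C where h: "C1 h" "\<And>q. 0 \<le> h q" "\<And>q. h q \<le> 1" "open V" "p \<in> V" "\<And>q. q \<in> V \<Longrightarrow> h q = 1"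
      "compact C" "C \<subseteq> inv_chart c ` ?B" "\<And>q. q \<notin> C \<Longrightarrow> h q = 0"
      by (rule manifold_bump[OF oU pU]) (rule that)
    have sub: "C \<subseteq> inv_chart c ` cball (snd c p) (t/2)"
      using h(8) image_mono[OF ball_subset_cball] by (rule subset_trans)
    have "admissible v" if v: "C1 v" "\<forall>x. v x \<ge> 0" "\<forall>x. x \<notin> C \<longrightarrow> v x = 0" for v
    proof (rule admissible_local[OF c(1) t(1,2) _ k2 v(1)])
      show "v x = 0" if "x \<notin> inv_chart c ` cball (snd c p) (t/2)" for x
        using v(3) contra_subsetD[OF sub that] by simp
    qed (use k(1) v(2) in auto)
    then show ?thesis using h by blast
  qed
  then obtain V h C where V: "\<And>p. open (V p)" "\<And>p. p \<in> V p" "\<And>p. compact (C p)" "\<And>p. C1 (h p)"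
    "\<And>p x. 0 \<le> h p x" "\<And>p x. h p x \<le> 1" "\<And>p x. x \<in> V p \<Longrightarrow> h p x = 1" "\<And>p x. x \<notin> C p \<Longrightarrow> h p x = 0"
    "\<And>p v. C1 v \<Longrightarrow> \<forall>x. v x \<ge> 0 \<Longrightarrow> \<forall>x. x \<notin> C p \<longrightarrow> v x = 0 \<Longrightarrow> admissible v"
    by metis
  have cov: "K \<subseteq> (\<Union>p\<in>K. V p)" using V(2) by blast
  obtain F where F: "finite F" "K \<subseteq> (\<Union>p\<in>F. V p)"
    by (rule compactE_image[OF assms(3) V(1) cov]) (rule that)
  from F(1) show ?thesis using F(2) assms
  proof (induction F arbitrary: K \<psi>)
    case empty
    then have z: "\<psi> = (\<lambda>x. 0)" by auto
    show ?case by (rule V(9)[OF empty.prems(2)]) (simp_all add: z)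
  next
    case (insert p F)
    let ?v = "\<lambda>x. h p x * \<psi> x" and ?w = "\<lambda>x. (1 - h p x) * \<psi> x"
    have Cv: "C1 ?v" by (intro Ck_function_mult V(4) insert.prems)
    have Cw: "C1 ?w" by (intro Ck_function_mult Ck_function_diff Ck_function_const V(4) insert.prems)
    have cK: "compact (K - V p)" using insert.prems(4) V(1) by (intro compact_diff)
    have "admissible ?v"
      by (rule V(9)[OF Cv]) (use V(5,8) insert.prems(3) in auto)
    moreover have w0: "?w x = 0" if "x \<notin> K - V p" for x
      using that V(7)[of x p] insert.prems(5)[of x] by auto
    have "admissible ?w"
    proof (rule insert.IH[OF _ Cw _ cK w0])
      show "K - V p \<subseteq> (\<Union>p\<in>F. V p)" using insert.prems(1) by auto
      show "?w x \<ge> 0" for x using V(6)[of p x] insert.prems(3)[of x] by simp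
    qed
    ultimately have "admissible (\<lambda>x. ?v x + ?w x)"
      by (intro admissible_add[OF Cv Cw insert.prems(4) _ cK w0]) (simp_all add: insert.prems(5))
    then show ?case by (simp add: algebra_simps)
  qed
qed

end


section \<open>Energy estimates\<close>

locale growth_solution = weak_solution charts g dV D u b \<phi> f l
  for charts :: "('a::{t2_space, second_countable_topology}, 'n::finite) chart set" and g and dV
    and D u b and \<phi> f l +
  fixes x0 :: 'a and A \<delta> chi Cl :: real
  assumes A_pos: "A > 0" and phi_le: "\<And>t. t > 0 \<Longrightarrow> \<phi> t \<le> A * t powr \<delta>"
    and l_ge: "\<And>t. t > 0 \<Longrightarrow> l t \<ge> Cl * t powr chi" and Cl_pos: "Cl > 0"
    and b_pos: "\<And>x. b x > 0" and chi: "0 \<le> chi" "chi < \<delta>"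
begin

text \<open>At \<open>t = 0\<close> the bound reads \<open>l 0 \<ge> 0\<close>, because \<open>0 powr chi = 0\<close>, and follows from continuity.\<close>

lemma l_ge': "t \<ge> 0 \<Longrightarrow> l t \<ge> Cl * t powr chi"
proof (cases "t = 0")
  case True
  have "l 0 \<ge> 0"
  proof (rule ccontr)
    assume neg: "\<not> l 0 \<ge> 0"
    have "continuous (at 0 within {0..}) l" using l_cont by (simp add: continuous_on_eq_continuous_within)
    then have "(l \<longlongrightarrow> l 0) (at 0 within {0..})" by (simp add: continuous_within)
    then have "\<forall>\<^sub>F t in at 0 within {0..}. l t < 0" using neg by (intro order_tendstoD) auto
    then obtain d where d: "d > 0" "\<And>t. t \<ge> 0 \<Longrightarrow> t \<noteq> 0 \<Longrightarrow> \<bar>t\<bar> < d \<Longrightarrow> l t < 0"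
      by (auto simp: eventually_at dist_real_def)
    have "l (d/2) \<ge> Cl * (d/2) powr chi" using d(1) by (intro l_ge) simp
    moreover have "Cl * (d/2) powr chi \<ge> 0" using Cl_pos by simp
    ultimately show False using d(2)[of "d/2"] d(1) by simp
  qed
  then show ?thesis using True by simp
qed (auto intro: l_ge)

abbreviation r :: "'a \<Rightarrow> real" where "r \<equiv> rdist x0"

text \<open>The weight is the part of the test function that depends on \<open>u\<close>. Its exponential factor makes
  its logarithmic derivative at least \<open>q\<close>, which turns the flux into the second term of \<open>bulk\<close>.\<close>

definition wt :: "real \<Rightarrow> real \<Rightarrow> 'a \<Rightarrow> real" where
  "wt \<gamma> q x = pos2 (u x - \<gamma>) * exp (q * (u x - \<gamma>))"

definition bulk :: "real \<Rightarrow> real \<Rightarrow> 'a \<Rightarrow> real" where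
  "bulk c q x = c * b x * G x powr chi + q * \<phi> (G x) * G x"

definition J :: "real \<Rightarrow> real \<Rightarrow> real \<Rightarrow> real \<Rightarrow> real" where
  "J c \<gamma> q R = (\<integral>x. indicator {x. r x < R} x * (wt \<gamma> q x * bulk c q x * D x) \<partial>dV)"

definition Vol :: "real \<Rightarrow> real" where
  "Vol R = (\<integral>x. indicator {x. r x < R} x * D x \<partial>dV)"

lemma Vol_nonneg: "Vol R \<ge> 0"
  unfolding Vol_def by (intro integral_nonneg_AE AE_I2) (simp add: less_imp_le[OF D_pos])

lemma wt_nonneg: "wt \<gamma> q x \<ge> 0" by (simp add: wt_def pos2_nonneg)

lemma wt_eq_0: "u x \<le> \<gamma> \<Longrightarrow> wt \<gamma> q x = 0" by (simp add: wt_def pos2_eq_0)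

lemma wt_cont: "continuous_on UNIV (wt \<gamma> q)"
  unfolding wt_def[abs_def] by (intro continuous_intros u_cont)

lemma bulk_nonneg: "c \<ge> 0 \<Longrightarrow> q \<ge> 0 \<Longrightarrow> bulk c q x \<ge> 0"
  unfolding bulk_def
  by (intro add_nonneg_nonneg mult_nonneg_nonneg powr_ge_zero phi_nonneg G_nonneg less_imp_le[OF b_pos])

lemma G_powr_measurable: "(\<lambda>x. G x powr chi) \<in> borel_measurable borel"
  using borel_measurable_continuous_onI[OF G_cont] by measurable

lemma bulk_measurable: "bulk c q \<in> borel_measurable borel"
  unfolding bulk_def[abs_def]
  using G_powr_measurable borel_measurable_continuous_onI[OF b_cont]
    borel_measurable_continuous_onI[OF phi_G_cont] borel_measurable_continuous_onI[OF G_cont]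
  by measurable

text \<open>A continuous majorant of \<open>bulk\<close>, which itself may be discontinuous at critical points of \<open>u\<close> if
  \<open>chi = 0\<close>, because of \<open>0 powr 0 = 0\<close>.\<close>

definition bulk_bound :: "real \<Rightarrow> real \<Rightarrow> 'a \<Rightarrow> real" where
  "bulk_bound c q x = c * b x * (1 + G x) powr chi + q * \<phi> (G x) * G x"

lemma bulk_le: "c \<ge> 0 \<Longrightarrow> bulk c q x \<le> bulk_bound c q x"
  unfolding bulk_def bulk_bound_def
  using G_nonneg[of x] b_pos[of x] chi(1)
  by (intro add_right_mono mult_left_mono powr_mono2) auto

lemma bulk_bound_cont: "continuous_on UNIV (bulk_bound c q)"
proof -
  have pc: "continuous_on UNIV (\<lambda>x. (1 + G x) powr chi)"
  proof (intro continuous_on_powr continuous_intros G_cont)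
    show "\<forall>x\<in>UNIV. 1 + G x \<noteq> 0" using G_nonneg by (smt (verit))
  qed
  show ?thesis
    unfolding bulk_bound_def[abs_def]
    by (intro continuous_on_add continuous_on_mult continuous_on_const pc b_cont phi_G_cont G_cont)
qed

lemma integrable_compact_support:
  fixes a h :: "'a \<Rightarrow> real"
  assumes "a \<in> borel_measurable borel" "continuous_on UNIV h" "\<And>x. \<bar>a x\<bar> \<le> h x"
    and "compact K" "\<And>x. x \<notin> K \<Longrightarrow> a x = 0"
  shows "integrable dV a"
proof -
  obtain B where B: "\<And>y. y \<in> h ` K \<Longrightarrow> norm y \<le> B"
    using compact_imp_bounded[OF compact_continuous_image[OF continuous_on_subset[OF assms(2) subset_UNIV] assms(4)]]
    unfolding bounded_iff by blast
  have Kb: "K \<in> sets borel" using assms(4) by (simp add: borel_closed compact_imp_closed)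
  have i: "integrable dV (\<lambda>x. B * indicator K x)"
    using emeasure_compact_finite[OF assms(4)] Kb by (intro integrable_mult_right integrable_real_indicator) auto
  show ?thesis
  proof (rule Bochner_Integration.integrable_bound[OF i])
    show "a \<in> borel_measurable dV" using assms(1) by measurable
    show "AE x in dV. norm (a x) \<le> norm (B * indicator K x)"
    proof (rule AE_I2)
      fix x show "norm (a x) \<le> norm (B * indicator K x)"
        using B[of "h x"] assms(3)[of x] assms(5)[of x] by (cases "x \<in> K") auto
    qed
  qed
qed

lemma ball_measurable: "(indicator {x. r x < R} :: 'a \<Rightarrow> real) \<in> borel_measurable borel"
  using open_rdist_less[of x0 R] by (intro borel_measurable_indicator borel_open)

lemma integrable_ball:
  fixes a h :: "'a \<Rightarrow> real"
  assumes "a \<in> borel_measurable borel" "continuous_on UNIV h" "\<And>x. \<bar>a x\<bar> \<le> h x"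
  shows "integrable dV (\<lambda>x. indicator {x. r x < R} x * a x)"
proof (rule integrable_compact_support[OF _ assms(2) _ compact_rdist_le[of x0 R]])
  show "(\<lambda>x. indicator {x. r x < R} x * a x) \<in> borel_measurable borel"
    by (intro borel_measurable_times ball_measurable assms(1))
  show "\<bar>indicator {x. r x < R} x * a x\<bar> \<le> h x" for x
    using assms(3)[of x] by (auto simp: indicator_def)
qed (auto simp: indicator_def)

lemma wbD_measurable: "(\<lambda>x. wt \<gamma> q x * bulk c q x * D x) \<in> borel_measurable borel"
  by (intro borel_measurable_times borel_measurable_continuous_onI wt_cont D_cont bulk_measurable)

lemma wbD_bound:
  assumes "c \<ge> 0" "q \<ge> 0"
  shows "\<bar>wt \<gamma> q x * bulk c q x * D x\<bar> \<le> wt \<gamma> q x * bulk_bound c q x * D x"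
proof -
  have "0 \<le> wt \<gamma> q x * bulk c q x * D x"
    using wt_nonneg bulk_nonneg[OF assms] D_pos[of x] by simp
  moreover have "wt \<gamma> q x * bulk c q x * D x \<le> wt \<gamma> q x * bulk_bound c q x * D x"
    using wt_nonneg bulk_le[OF assms(1)] D_pos[of x] by (intro mult_right_mono mult_left_mono) auto
  ultimately show ?thesis by simp
qed

lemma wbD_bound_cont: "continuous_on UNIV (\<lambda>x. wt \<gamma> q x * bulk_bound c q x * D x)"
  by (intro continuous_intros wt_cont bulk_bound_cont D_cont)

lemma J_integrable: "c \<ge> 0 \<Longrightarrow> q \<ge> 0 \<Longrightarrow>
    integrable dV (\<lambda>x. indicator {x. r x < R} x * (wt \<gamma> q x * bulk c q x * D x))"
  by (rule integrable_ball[OF wbD_measurable wbD_bound_cont wbD_bound])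

lemma Vol_integrable: "integrable dV (\<lambda>x. indicator {x. r x < R} x * D x)"
  by (rule integrable_ball[OF borel_measurable_continuous_onI[OF D_cont] D_cont])
     (simp add: less_imp_le[OF D_pos])

lemma J_mono: "c \<ge> 0 \<Longrightarrow> q \<ge> 0 \<Longrightarrow> R \<le> S \<Longrightarrow> J c \<gamma> q R \<le> J c \<gamma> q S"
  unfolding J_def
proof (rule Bochner_Integration.integral_mono)
  fix x assume "c \<ge> 0" "q \<ge> 0" "R \<le> S"
  then show "indicator {x. r x < R} x * (wt \<gamma> q x * bulk c q x * D x)
      \<le> indicator {x. r x < S} x * (wt \<gamma> q x * bulk c q x * D x)"
    using wt_nonneg[of \<gamma> q x] bulk_nonneg[of c q x] D_pos[of x]
    by (intro mult_right_mono) (auto simp: indicator_def)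
qed (auto intro: J_integrable)

text \<open>The test function is \<open>\<psi> ^ n\<close> times the weight. The derivative of the weight contributes the flux
  part of \<open>bulk\<close>, and only the derivative of the cutoff \<open>\<psi>\<close> has no sign and goes to the right.\<close>

lemma energy_inequality:
  assumes c: "c \<ge> 0" "\<And>x. u x > \<gamma> \<Longrightarrow> f (u x) * l (G x) \<ge> c * G x powr chi" and "q \<ge> 0"
    and \<psi>: "C1 \<psi>" "\<And>x. 0 \<le> \<psi> x" "compact K" "\<And>x. x \<notin> K \<Longrightarrow> \<psi> x = 0" and "n > 0"
  shows "integrable dV (\<lambda>x. \<psi> x ^ n * (wt \<gamma> q x * bulk c q x * D x))" (is ?i1)
    and "integrable dV (\<lambda>x. real n * \<psi> x ^ (n - 1) * wt \<gamma> q x * grad_norm charts g \<psi> x * \<phi> (G x) * D x)" (is ?i2)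
    and "(\<integral>x. \<psi> x ^ n * (wt \<gamma> q x * bulk c q x * D x) \<partial>dV)
      \<le> (\<integral>x. real n * \<psi> x ^ (n - 1) * wt \<gamma> q x * grad_norm charts g \<psi> x * \<phi> (G x) * D x \<partial>dV)"
proof -
  define W where "W t = pos2 (t - \<gamma>) * exp (q * (t - \<gamma>))" for t
  define W' where "W' t = 2 * max 0 (t - \<gamma>) * exp (q * (t - \<gamma>)) + pos2 (t - \<gamma>) * (q * exp (q * (t - \<gamma>)))" for t
  have dW: "(W has_real_derivative W' t) (at t)" for t
  proof -
    have 1: "((\<lambda>t. pos2 (t - \<gamma>)) has_real_derivative 2 * max 0 (t - \<gamma>)) (at t)"
      using DERIV_chain2[OF has_real_derivative_pos2 DERIV_diff[OF DERIV_ident DERIV_const]] by simp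
    have 2: "((\<lambda>t. exp (q * (t - \<gamma>))) has_real_derivative q * exp (q * (t - \<gamma>))) (at t)"
      by (auto intro!: derivative_eq_intros)
    show ?thesis
      unfolding W_def[abs_def] W'_def
      by (rule DERIV_cong[OF DERIV_mult[OF 1 2]]) (simp add: algebra_simps)
  qed
  have cW': "continuous_on UNIV W'" unfolding W'_def[abs_def] by (intro continuous_intros)
  have W'_ge: "W' t \<ge> q * W t" for t by (simp add: W_def W'_def)
  have Wu: "W (u x) = wt \<gamma> q x" for x by (simp add: W_def wt_def)
  define \<Psi> where "\<Psi> x = \<psi> x ^ n * W (u x)" for x
  have CW: "C1 (\<lambda>x. W (u x))" by (rule C1_compose[OF u_C1 dW cW'])
  have C\<Psi>: "C1 \<Psi>" unfolding \<Psi>_def by (intro Ck_function_mult Ck_function_power \<psi>(1) CW)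
  have \<Psi>0: "\<Psi> x = 0" if "x \<notin> K" for x using \<psi>(4)[OF that] \<open>n > 0\<close> by (simp add: \<Psi>_def)
  have \<Psi>nn: "\<Psi> x \<ge> 0" for x using \<psi>(2) wt_nonneg by (simp add: \<Psi>_def Wu)
  have adm: "(\<integral>x. source x * \<Psi> x * D x \<partial>dV) \<le> - (\<integral>x. flux \<Psi> x \<partial>dV)"
    using admissible_C1[OF C\<Psi> \<Psi>nn \<psi>(3) \<Psi>0] unfolding admissible_def by simp
  have \<psi>c: "continuous_on UNIV \<psi>" by (rule Ck_function_continuous[OF \<psi>(1)])
  show i1: ?i1
  proof (rule integrable_compact_support[OF _ _ _ \<psi>(3)])
    show "(\<lambda>x. \<psi> x ^ n * (wt \<gamma> q x * bulk c q x * D x)) \<in> borel_measurable borel"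
      by (intro borel_measurable_times wbD_measurable borel_measurable_power borel_measurable_continuous_onI \<psi>c)
    show "continuous_on UNIV (\<lambda>x. \<psi> x ^ n * (wt \<gamma> q x * bulk_bound c q x * D x))"
      by (intro continuous_on_mult continuous_on_power \<psi>c wbD_bound_cont)
    show "\<bar>\<psi> x ^ n * (wt \<gamma> q x * bulk c q x * D x)\<bar> \<le> \<psi> x ^ n * (wt \<gamma> q x * bulk_bound c q x * D x)" for x
      using mult_left_mono[OF wbD_bound[OF c(1) \<open>q \<ge> 0\<close>, of \<gamma> x], of "\<psi> x ^ n"] \<psi>(2)[of x]
      by (simp add: abs_mult)
  qed (use \<psi>(4) \<open>n > 0\<close> in simp)
  let ?rhs = "\<lambda>x. real n * \<psi> x ^ (n - 1) * wt \<gamma> q x * grad_norm charts g \<psi> x * \<phi> (G x) * D x"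
  show i2: ?i2
  proof (rule integrable_continuous_compact[OF _ \<psi>(3)])
    show "continuous_on UNIV ?rhs"
      by (intro continuous_intros \<psi>c wt_cont grad_norm_continuous \<psi>(1) phi_G_cont D_cont)
  qed (simp add: grad_norm_support[OF \<psi>(1,3,4)])
  have "(\<integral>x. \<psi> x ^ n * (wt \<gamma> q x * bulk c q x * D x) \<partial>dV) \<le> (\<integral>x. source x * \<Psi> x * D x + flux \<Psi> x + ?rhs x \<partial>dV)"
  proof (rule Bochner_Integration.integral_mono[OF i1])
    show "integrable dV (\<lambda>x. source x * \<Psi> x * D x + flux \<Psi> x + ?rhs x)"
      using source_integrable[OF C\<Psi> \<psi>(3) \<Psi>0] flux_integrable[OF C\<Psi> \<psi>(3) \<Psi>0] i2
      by (intro Bochner_Integration.integrable_add) auto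
    fix x
    have src: "\<psi> x ^ n * wt \<gamma> q x * (c * b x * G x powr chi) * D x \<le> source x * \<Psi> x * D x"
    proof (cases "u x > \<gamma>")
      case True
      have "c * b x * G x powr chi \<le> source x"
        using mult_left_mono[OF c(2)[OF True] less_imp_le[OF b_pos[of x]]] by (simp add: source_def mult_ac)
      then have "\<psi> x ^ n * wt \<gamma> q x * (c * b x * G x powr chi) * D x \<le> \<psi> x ^ n * wt \<gamma> q x * source x * D x"
        using \<psi>(2)[of x] wt_nonneg[of \<gamma> q x] D_pos[of x] by (intro mult_right_mono mult_left_mono) auto
      then show ?thesis by (simp add: \<Psi>_def Wu mult_ac)
    qed (simp add: wt_eq_0 \<Psi>_def Wu)
    have pw: "grad_inner charts g u (\<lambda>x. \<psi> x ^ n) x = real n * \<psi> x ^ (n - 1) * grad_inner charts g u \<psi> x"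
    proof -
      have "continuous_on UNIV (\<lambda>t::real. real n * t ^ (n - Suc 0))" by (intro continuous_intros)
      from grad_inner_compose[OF u_C1 \<psi>(1) DERIV_pow this] show ?thesis by simp
    qed
    have gi: "grad_inner charts g u \<Psi> x = \<psi> x ^ n * (W' (u x) * (G x)\<^sup>2)
        + wt \<gamma> q x * (real n * \<psi> x ^ (n - 1) * grad_inner charts g u \<psi> x)"
      unfolding \<Psi>_def[abs_def] grad_inner_mult[OF u_C1 Ck_function_power[OF \<psi>(1)] CW]
        grad_inner_compose[OF u_C1 u_C1 dW cW'] pw
      by (simp add: G_def grad_norm_square[OF u_C1] Wu)
    have "flux \<Psi> x = \<psi> x ^ n * W' (u x) * (inverse (G x) * (G x)\<^sup>2) * \<phi> (G x) * D x
        + real n * \<psi> x ^ (n - 1) * wt \<gamma> q x * flux \<psi> x"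
      unfolding flux_def gi by (simp add: algebra_simps)
    moreover have "inverse (G x) * (G x)\<^sup>2 = G x" by (cases "G x = 0") (simp_all add: power2_eq_square)
    ultimately have fl: "flux \<Psi> x = \<psi> x ^ n * W' (u x) * G x * \<phi> (G x) * D x
        + real n * \<psi> x ^ (n - 1) * wt \<gamma> q x * flux \<psi> x" by simp
    have "\<psi> x ^ n * (q * wt \<gamma> q x) * G x * \<phi> (G x) * D x \<le> \<psi> x ^ n * W' (u x) * G x * \<phi> (G x) * D x"
      using W'_ge[of "u x"] \<psi>(2)[of x] G_nonneg[of x] phi_nonneg[OF G_nonneg, of x] D_pos[of x]
      by (intro mult_right_mono mult_left_mono) (auto simp: Wu)
    moreover have "real n * \<psi> x ^ (n - 1) * wt \<gamma> q x * (- flux \<psi> x) \<le> ?rhs x"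
    proof -
      have "- flux \<psi> x \<le> \<phi> (G x) * grad_norm charts g \<psi> x * D x" using flux_bound[OF \<psi>(1), of x] by linarith
      then have "real n * \<psi> x ^ (n - 1) * wt \<gamma> q x * (- flux \<psi> x)
         \<le> real n * \<psi> x ^ (n - 1) * wt \<gamma> q x * (\<phi> (G x) * grad_norm charts g \<psi> x * D x)"
        using \<psi>(2)[of x] wt_nonneg[of \<gamma> q x] by (intro mult_left_mono) auto
      then show ?thesis by (simp add: mult_ac)
    qed
    ultimately have "\<psi> x ^ n * (q * wt \<gamma> q x) * G x * \<phi> (G x) * D x \<le> flux \<Psi> x + ?rhs x"
      unfolding fl by linarith
    with src show "\<psi> x ^ n * (wt \<gamma> q x * bulk c q x * D x) \<le> source x * \<Psi> x * D x + flux \<Psi> x + ?rhs x"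
      by (simp add: bulk_def algebra_simps)
  qed
  also have "\<dots> = (\<integral>x. source x * \<Psi> x * D x \<partial>dV) + (\<integral>x. flux \<Psi> x \<partial>dV) + (\<integral>x. ?rhs x \<partial>dV)"
    using source_integrable[OF C\<Psi> \<psi>(3) \<Psi>0] flux_integrable[OF C\<Psi> \<psi>(3) \<Psi>0] i2
    by (simp add: Bochner_Integration.integral_add)
  also have "\<dots> \<le> (\<integral>x. ?rhs x \<partial>dV)" using adm by linarith
  finally show "(\<integral>x. \<psi> x ^ n * (wt \<gamma> q x * bulk c q x * D x) \<partial>dV) \<le> (\<integral>x. ?rhs x \<partial>dV)" .
qed

text \<open>Half of the good term absorbs the bad one up to an error \<open>h\<close>. The variables \<open>s\<close> and \<open>a\<close> stand for
  the values of the cutoff and of its gradient norm, whose bound \<open>48 / R\<close> comes from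
  \<open>distance_cutoff\<close>.\<close>

lemma absorb:
  assumes c: "c \<ge> 0" "\<And>x. u x > \<gamma> \<Longrightarrow> f (u x) * l (G x) \<ge> c * G x powr chi" and "q \<ge> 0"
    and "R \<ge> 8" "n \<ge> 2" and h: "integrable dV h"
    and pt: "\<And>s a x. 0 \<le> s \<Longrightarrow> s \<le> 1 \<Longrightarrow> 0 \<le> a \<Longrightarrow> a \<le> 48 / R \<Longrightarrow> R / 2 \<le> r x \<Longrightarrow> r x < R \<Longrightarrow> \<gamma> < u x \<Longrightarrow>
       real n * s ^ (n - 1) * wt \<gamma> q x * a * \<phi> (G x) * D x \<le> s ^ n * (wt \<gamma> q x * bulk c q x * D x) / 2 + h x"
    and hnn: "\<And>x. h x \<ge> 0"
  shows "J c \<gamma> q (R / 2) \<le> 2 * (\<integral>x. h x \<partial>dV)"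
proof -
  have "n > 0" using \<open>n \<ge> 2\<close> by simp
  obtain \<psi> where \<psi>: "C1 \<psi>" "\<And>q. 0 \<le> \<psi> q" "\<And>q. \<psi> q \<le> 1"
    "\<And>q. r q \<le> R / 2 \<Longrightarrow> \<psi> q = 1" "\<And>q. R \<le> r q \<Longrightarrow> \<psi> q = 0"
    "\<And>q. grad_norm charts g \<psi> q \<le> 48 / R" "\<And>q. r q < R / 2 \<Longrightarrow> grad_norm charts g \<psi> q = 0"
    by (rule distance_cutoff[OF \<open>R \<ge> 8\<close>, of x0]) (rule that)
  have \<psi>0: "\<psi> x = 0" if "x \<notin> {x. r x \<le> R}" for x using \<psi>(5)[of x] that by simp
  let ?good = "\<lambda>x. \<psi> x ^ n * (wt \<gamma> q x * bulk c q x * D x)"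
  let ?bad = "\<lambda>x. real n * \<psi> x ^ (n - 1) * wt \<gamma> q x * grad_norm charts g \<psi> x * \<phi> (G x) * D x"
  note E0 = energy_inequality[OF c \<open>q \<ge> 0\<close> \<psi>(1,2) compact_rdist_le[of x0 R] \<psi>0 \<open>n > 0\<close>]
  have E1: "integrable dV ?good" by (rule E0(1)) assumption+
  have E2: "integrable dV ?bad" by (rule E0(2)) assumption+
  have E3: "(\<integral>x. ?good x \<partial>dV) \<le> (\<integral>x. ?bad x \<partial>dV)" by (rule E0(3)) assumption+
  have gh: "integrable dV (\<lambda>x. ?good x / 2 + h x)"
    by (intro Bochner_Integration.integrable_add integrable_divide h E1)
  have pos: "0 \<le> wt \<gamma> q x * bulk c q x * D x" for x
    using wt_nonneg bulk_nonneg[OF c(1) \<open>q \<ge> 0\<close>] D_pos[of x] by simp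
  have good: "0 \<le> ?good x" for x by (rule mult_nonneg_nonneg[OF zero_le_power[OF \<psi>(2)] pos])
  have bad: "?bad x \<le> ?good x / 2 + h x" for x
  proof -
    consider "r x < R / 2" | "R \<le> r x" | "u x \<le> \<gamma>" | "R / 2 \<le> r x" "r x < R" "\<gamma> < u x" by linarith
    then show ?thesis
    proof cases
      case 2
      have "n - 1 > 0" using \<open>n \<ge> 2\<close> by simp
      then have "?bad x = 0" using \<psi>(5)[OF 2] by simp
      then show ?thesis using good[of x] hnn[of x] by linarith
    next
      case 4
      then show ?thesis by (intro pt \<psi>(2,3,6) grad_norm_nonneg \<psi>(1))
    qed (use \<psi>(7)[of x] wt_eq_0[of x \<gamma> q] good[of x] hnn[of x] in simp_all)
  qed
  have "(\<integral>x. ?bad x \<partial>dV) \<le> (\<integral>x. ?good x / 2 + h x \<partial>dV)"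
    by (rule Bochner_Integration.integral_mono[OF E2 gh bad])
  also have "\<dots> = (\<integral>x. ?good x \<partial>dV) / 2 + (\<integral>x. h x \<partial>dV)"
    by (subst Bochner_Integration.integral_add[OF integrable_divide h]) (simp_all add: E1)
  finally have "(\<integral>x. ?good x \<partial>dV) \<le> 2 * (\<integral>x. h x \<partial>dV)" using E3 by linarith
  moreover have "J c \<gamma> q (R / 2) \<le> (\<integral>x. ?good x \<partial>dV)"
    unfolding J_def
  proof (rule Bochner_Integration.integral_mono[OF J_integrable[OF c(1) \<open>q \<ge> 0\<close>] E1])
    fix x
    show "indicator {x. r x < R / 2} x * (wt \<gamma> q x * bulk c q x * D x) \<le> ?good x"
      using \<psi>(4)[of x] good[of x] by (cases "r x < R / 2") (auto simp: indicator_def)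
  qed
  ultimately show ?thesis by linarith
qed

text \<open>Where the cutoff is at least \<open>1/2\<close>, the bad term is at most half the good one; elsewhere its power
  \<open>n - 1\<close> is at most \<open>2 * (1/2) ^ n\<close>. The number 192 is four times the constant 48 of the cutoff.\<close>

lemma decay_step:
  assumes c: "c \<ge> 0" "\<And>x. u x > \<gamma> \<Longrightarrow> f (u x) * l (G x) \<ge> c * G x powr chi" and "q \<ge> 0"
    and "R \<ge> 8" "n \<ge> 2" and H: "192 * real n \<le> H * R"
    and dom: "\<And>x. R / 2 \<le> r x \<Longrightarrow> r x < R \<Longrightarrow> \<gamma> < u x \<Longrightarrow> H * \<phi> (G x) \<le> bulk c q x"
  shows "J c \<gamma> q (R / 2) \<le> 2 * (1/2) ^ n * J c \<gamma> q R"
proof -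
  define Z where "Z x = wt \<gamma> q x * bulk c q x * D x" for x
  have Z: "Z x \<ge> 0" for x using wt_nonneg bulk_nonneg[OF c(1) \<open>q \<ge> 0\<close>] D_pos[of x] by (simp add: Z_def)
  define h where "h x = (1/2) ^ n * (indicator {x. r x < R} x * Z x)" for x
  have h: "integrable dV h" "(\<integral>x. h x \<partial>dV) = (1/2) ^ n * J c \<gamma> q R"
    using J_integrable[OF c(1) \<open>q \<ge> 0\<close>, of R \<gamma>] by (simp_all add: h_def[abs_def] J_def Z_def)
  have "n > 0" using \<open>n \<ge> 2\<close> by simp
  have "J c \<gamma> q (R / 2) \<le> 2 * (\<integral>x. h x \<partial>dV)"
  proof (rule absorb[OF c \<open>q \<ge> 0\<close> \<open>R \<ge> 8\<close> \<open>n \<ge> 2\<close> h(1)])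
    fix s a :: real and x
    assume s: "0 \<le> s" "s \<le> 1" and a: "0 \<le> a" "a \<le> 48 / R" and x: "R / 2 \<le> r x" "r x < R" "\<gamma> < u x"
    have wD: "0 \<le> wt \<gamma> q x * D x" using wt_nonneg D_pos[of x] by simp
    have ph: "0 \<le> \<phi> (G x)" by (rule phi_nonneg[OF G_nonneg])
    have "real n * a \<le> real n * (48 / R)" using a by (intro mult_left_mono) auto
    also have "\<dots> \<le> H / 4" using H \<open>R \<ge> 8\<close> by (simp add: field_simps)
    finally have "real n * a * \<phi> (G x) \<le> H / 4 * \<phi> (G x)" using ph by (rule mult_right_mono)
    also have "\<dots> \<le> bulk c q x / 4" using dom[OF x] by simp
    finally have "s ^ (n - 1) * (wt \<gamma> q x * D x) * (real n * a * \<phi> (G x)) \<le> s ^ (n - 1) * (wt \<gamma> q x * D x) * (bulk c q x / 4)"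
      using s by (intro mult_left_mono mult_nonneg_nonneg[OF _ wD]) auto
    then have 1: "real n * s ^ (n - 1) * wt \<gamma> q x * a * \<phi> (G x) * D x \<le> s ^ (n - 1) * Z x / 4"
      by (simp add: Z_def mult_ac)
    have sn: "s ^ n = s * s ^ (n - 1)" using \<open>n > 0\<close> by (simp add: power_eq_if)
    have hx: "h x = (1/2) ^ n * Z x" using x(2) by (simp add: h_def)
    have "s ^ (n - 1) * Z x / 4 \<le> s ^ n * Z x / 2 + h x"
    proof (cases "s \<ge> 1/2")
      case True
      have "1/2 * (s ^ (n - 1) * Z x) \<le> s * (s ^ (n - 1) * Z x)"
        using True s Z[of x] by (intro mult_right_mono) auto
      moreover have "h x \<ge> 0" using Z[of x] by (simp add: hx)
      moreover have "s ^ n * Z x = s * (s ^ (n - 1) * Z x)" by (simp only: sn mult.assoc)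
      ultimately show ?thesis by linarith
    next
      case False
      then have "s ^ (n - 1) \<le> (1/2) ^ (n - 1)" using s by (intro power_mono) auto
      also have "\<dots> = 2 * (1/2) ^ n" using \<open>n > 0\<close> by (simp add: power_eq_if)
      finally have "s ^ (n - 1) * Z x \<le> 2 * (1/2) ^ n * Z x" using Z[of x] by (rule mult_right_mono)
      moreover have "0 \<le> s ^ n * Z x" "0 \<le> h x" using s Z[of x] by (simp_all add: hx)
      ultimately show ?thesis unfolding hx by linarith
    qed
    from order_trans[OF 1 this]
    show "real n * s ^ (n - 1) * wt \<gamma> q x * a * \<phi> (G x) * D x \<le> s ^ n * (wt \<gamma> q x * bulk c q x * D x) / 2 + h x"
      unfolding Z_def .
  next
    show "h x \<ge> 0" for x
      unfolding h_def by (intro mult_nonneg_nonneg Z) (simp_all add: indicator_def)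
  qed
  then show ?thesis by (simp add: h(2))
qed

text \<open>With the cutoff \<open>\<psi>\<close>, the second term of \<open>bulk\<close> absorbs the bad term where \<open>G\<close> is large compared to the
  norm of the gradient of \<open>\<psi>\<close> divided by \<open>q * \<psi>\<close>. Elsewhere \<open>\<phi> (G x)\<close> is at most a constant times
  \<open>\<psi> powr (- \<delta>)\<close>, for which the factor \<open>\<psi> ^ (n - 1)\<close> compensates.\<close>

lemma caccioppoli:
  assumes c: "c \<ge> 0" "\<And>x. u x > \<gamma> \<Longrightarrow> f (u x) * l (G x) \<ge> c * G x powr chi" and "q > 0"
    and "R \<ge> 8" "n \<ge> 2" "real n \<ge> \<delta> + 1" and S: "\<And>x. r x < R \<Longrightarrow> wt \<gamma> q x \<le> S"
  shows "J c \<gamma> q (R / 2) \<le> 2 * (real n * (48 / R) * A * (2 * real n * (48 / R) / q) powr \<delta> * S * Vol R)"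
proof -
  define E where "E = real n * (48 / R) * A * (2 * real n * (48 / R) / q) powr \<delta>"
  have E: "E \<ge> 0" using \<open>R \<ge> 8\<close> A_pos by (simp add: E_def)
  have "r x0 < R" using \<open>R \<ge> 8\<close> by (simp add: rdist_self)
  then have S0: "S \<ge> 0" using order_trans[OF wt_nonneg S] by blast
  define h where "h x = E * S * (indicator {x. r x < R} x * D x)" for x
  have h: "integrable dV h" "(\<integral>x. h x \<partial>dV) = E * S * Vol R"
    using Vol_integrable[of R] by (simp_all add: h_def[abs_def] Vol_def)
  have "n > 0" "\<delta> > 0" "q \<ge> 0" using \<open>n \<ge> 2\<close> chi \<open>q > 0\<close> by auto
  have "J c \<gamma> q (R / 2) \<le> 2 * (\<integral>x. h x \<partial>dV)"
  proof (rule absorb[OF c \<open>q \<ge> 0\<close> \<open>R \<ge> 8\<close> \<open>n \<ge> 2\<close> h(1)])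
    fix s a :: real and x
    assume s: "0 \<le> s" "s \<le> 1" and a: "0 \<le> a" "a \<le> 48 / R" and x: "R / 2 \<le> r x" "r x < R" "\<gamma> < u x"
    have ph: "0 \<le> \<phi> (G x)" by (rule phi_nonneg[OF G_nonneg])
    have w: "0 \<le> wt \<gamma> q x" "wt \<gamma> q x \<le> S" using wt_nonneg S[OF x(2)] by auto
    have sn: "s ^ n = s * s ^ (n - 1)" using \<open>n > 0\<close> by (simp add: power_eq_if)
    have hx: "h x = E * S * D x" using x(2) by (simp add: h_def)
    have hnn: "h x \<ge> 0" using E S0 D_pos[of x] by (simp add: hx)
    have good: "0 \<le> s ^ n * (wt \<gamma> q x * bulk c q x * D x)"
      using s(1) w(1) bulk_nonneg[OF c(1) \<open>q \<ge> 0\<close>] D_pos[of x] by simp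
    show "real n * s ^ (n - 1) * wt \<gamma> q x * a * \<phi> (G x) * D x \<le> s ^ n * (wt \<gamma> q x * bulk c q x * D x) / 2 + h x"
    proof (cases "real n * a \<le> s * q * G x / 2")
      case True
      have "c * b x * G x powr chi \<ge> 0" using c(1) b_pos[of x] by simp
      then have "q * \<phi> (G x) * G x \<le> bulk c q x" by (simp add: bulk_def)
      have "real n * a * \<phi> (G x) \<le> s * q * G x / 2 * \<phi> (G x)" using True ph by (rule mult_right_mono)
      also have "\<dots> = s * (q * \<phi> (G x) * G x) / 2" by simp
      also have "\<dots> \<le> s * bulk c q x / 2" using \<open>q * \<phi> (G x) * G x \<le> _\<close> s(1) by (simp add: mult_left_mono)
      finally have "(s ^ (n - 1) * wt \<gamma> q x * D x) * (real n * a * \<phi> (G x)) \<le> (s ^ (n - 1) * wt \<gamma> q x * D x) * (s * bulk c q x / 2)"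
        using s w D_pos[of x] by (intro mult_left_mono mult_nonneg_nonneg) auto
      then have "real n * s ^ (n - 1) * wt \<gamma> q x * a * \<phi> (G x) * D x \<le> s ^ n * (wt \<gamma> q x * bulk c q x * D x) / 2"
        by (simp add: sn mult_ac)
      then show ?thesis using hnn by linarith
    next
      case False
      have small: "s ^ (n - 1) * \<phi> (G x) \<le> A * (2 * real n * a / q) powr \<delta>"
      proof (cases "s = 0 \<or> G x = 0")
        case True
        have "n - 1 > 0" using \<open>n \<ge> 2\<close> by simp
        then have "s ^ (n - 1) * \<phi> (G x) = 0" using True by (auto simp: phi_0)
        moreover have "0 \<le> A * (2 * real n * a / q) powr \<delta>" using A_pos by simp
        ultimately show ?thesis by linarith
      next
        case F2: False
        then have sp: "s > 0" and Gp: "G x > 0" using s(1) G_nonneg[of x] by auto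
        have "G x \<le> (2 * real n * a / q) / s" using False sp \<open>q > 0\<close> by (simp add: field_simps)
        then have "G x powr \<delta> \<le> ((2 * real n * a / q) / s) powr \<delta>" using Gp \<open>\<delta> > 0\<close> by (intro powr_mono2) auto
        also have "\<dots> = (2 * real n * a / q) powr \<delta> / s powr \<delta>" by (rule powr_divide)
        finally have G1: "G x powr \<delta> \<le> (2 * real n * a / q) powr \<delta> / s powr \<delta>" .
        have "s ^ (n - 1) = s powr (real (n - 1))" using sp by (simp add: powr_realpow)
        also have "\<dots> \<le> s powr \<delta>" using sp s(2) assms(6) \<open>n > 0\<close> by (intro powr_mono') (auto simp: of_nat_diff)
        finally have s1: "s ^ (n - 1) \<le> s powr \<delta>" .
        have "s ^ (n - 1) * \<phi> (G x) \<le> s powr \<delta> * (A * G x powr \<delta>)"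
          using s1 phi_le[OF Gp] ph sp by (intro mult_mono) auto
        also have "\<dots> \<le> s powr \<delta> * (A * ((2 * real n * a / q) powr \<delta> / s powr \<delta>))"
          using G1 A_pos by (intro mult_left_mono) auto
        also have "\<dots> = A * (2 * real n * a / q) powr \<delta>" using sp by simp
        finally show ?thesis .
      qed
      also have "\<dots> \<le> A * (2 * real n * (48 / R) / q) powr \<delta>"
        using a A_pos \<open>q > 0\<close> \<open>\<delta> > 0\<close>
        by (intro mult_left_mono powr_mono2 divide_right_mono) auto
      finally have small2: "s ^ (n - 1) * \<phi> (G x) \<le> A * (2 * real n * (48 / R) / q) powr \<delta>" .
      have nn: "0 \<le> s ^ (n - 1) * \<phi> (G x)" by (rule mult_nonneg_nonneg[OF zero_le_power[OF s(1)] ph])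
      have na: "real n * a \<le> real n * (48 / R)" "0 \<le> real n * a" "0 \<le> real n * (48 / R)"
      proof -
        show "real n * a \<le> real n * (48 / R)" by (rule mult_left_mono[OF a(2)]) simp
      qed (use a(1) \<open>R \<ge> 8\<close> in simp_all)
      have "(real n * a) * (s ^ (n - 1) * \<phi> (G x)) \<le> E"
        using mult_mono[OF na(1) small2 na(3) nn] by (simp only: E_def mult.assoc)
      from mult_mono[OF w(2) this S0 mult_nonneg_nonneg[OF na(2) nn]]
      have "wt \<gamma> q x * ((real n * a) * (s ^ (n - 1) * \<phi> (G x))) * D x \<le> S * E * D x"
        using D_pos[of x] by (intro mult_right_mono) auto
      then have "real n * s ^ (n - 1) * wt \<gamma> q x * a * \<phi> (G x) * D x \<le> h x" by (simp add: hx mult_ac)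
      then show ?thesis using good by linarith
    qed
  next
    show "h x \<ge> 0" for x
      unfolding h_def
      by (intro mult_nonneg_nonneg E S0 less_imp_le[OF D_pos]) (simp add: indicator_def)
  qed
  then show ?thesis by (simp add: h(2) E_def mult.assoc)
qed

definition \<theta> :: real where "\<theta> = (\<delta> - chi) / (1 + \<delta> - chi)"

lemma theta: "0 < \<theta>" "\<theta> < 1" "(1 - \<theta>) * (1 + \<delta> - chi) = 1" "\<delta> * (1 - \<theta>) = \<theta> + chi * (1 - \<theta>)"
proof -
  have e: "1 + \<delta> - chi > 0" using chi by simp
  show "0 < \<theta>" "\<theta> < 1" and 1: "(1 - \<theta>) * (1 + \<delta> - chi) = 1"
    using chi e by (simp_all add: \<theta>_def field_simps)
  show "\<delta> * (1 - \<theta>) = \<theta> + chi * (1 - \<theta>)" using 1 by (simp add: algebra_simps)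
qed

text \<open>The sum \<open>X + Z\<close> of the two terms of \<open>bulk\<close> is at least \<open>X powr \<theta> * Z powr (1 - \<theta>)\<close>. The exponent
  \<open>\<theta>\<close> is the one for which the bound on \<open>\<phi>\<close> by a power of \<open>G\<close> removes all powers of \<open>G\<close> from this product
  and leaves a multiple of \<open>\<phi> (G x)\<close>.\<close>

lemma flux_le_bulk:
  assumes "c > 0" "q > 0" "B > 0" "b x \<ge> B"
  shows "A powr (\<theta> - 1) * q powr \<theta> * (c * B) powr (1 - \<theta>) * \<phi> (G x) \<le> bulk c q x"
proof (cases "\<phi> (G x) = 0")
  case True
  then show ?thesis using bulk_nonneg[of c q x] assms by simp
next
  case False
  then have P: "\<phi> (G x) > 0" and Gp: "G x > 0"
    using phi_nonneg[OF G_nonneg, of x] G_nonneg[of x] phi_0 by (auto simp: order.order_iff_strict)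
  define X where "X = q * \<phi> (G x) * G x"
  define Z where "Z = c * B * G x powr chi"
  have XZ: "X > 0" "Z > 0" using assms P Gp by (simp_all add: X_def Z_def)
  have "Z \<le> c * b x * G x powr chi" unfolding Z_def using assms by (intro mult_right_mono mult_left_mono) auto
  then have bulk: "X + Z \<le> bulk c q x" by (simp add: bulk_def X_def)
  have "\<phi> (G x) powr (1 - \<theta>) \<le> (A * G x powr \<delta>) powr (1 - \<theta>)"
    using phi_le[OF Gp] P theta by (intro powr_mono2) auto
  also have "\<dots> = A powr (1 - \<theta>) * G x powr (\<theta> + chi * (1 - \<theta>))"
    using A_pos theta(4) by (simp add: powr_mult powr_powr)
  finally have "A powr (\<theta> - 1) * \<phi> (G x) powr (1 - \<theta>) \<le> A powr (\<theta> - 1) * (A powr (1 - \<theta>) * G x powr (\<theta> + chi * (1 - \<theta>)))"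
    by (intro mult_left_mono) auto
  also have "\<dots> = G x powr (\<theta> + chi * (1 - \<theta>))"
    using A_pos by (simp add: mult.assoc[symmetric] powr_add[symmetric])
  finally have 1: "A powr (\<theta> - 1) * \<phi> (G x) powr (1 - \<theta>) \<le> G x powr \<theta> * G x powr (chi * (1 - \<theta>))"
    by (simp add: powr_add)
  have "\<phi> (G x) = \<phi> (G x) powr \<theta> * \<phi> (G x) powr (1 - \<theta>)" using P by (simp add: powr_add[symmetric])
  then have "A powr (\<theta> - 1) * q powr \<theta> * (c * B) powr (1 - \<theta>) * \<phi> (G x)
      = A powr (\<theta> - 1) * q powr \<theta> * (c * B) powr (1 - \<theta>) * (\<phi> (G x) powr \<theta> * \<phi> (G x) powr (1 - \<theta>))"
    by (rule arg_cong)
  also have "\<dots> = (q powr \<theta> * (c * B) powr (1 - \<theta>) * \<phi> (G x) powr \<theta>) * (A powr (\<theta> - 1) * \<phi> (G x) powr (1 - \<theta>))"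
    by (simp only: mult_ac)
  also have "\<dots> \<le> (q powr \<theta> * (c * B) powr (1 - \<theta>) * \<phi> (G x) powr \<theta>) * (G x powr \<theta> * G x powr (chi * (1 - \<theta>)))"
    by (rule mult_left_mono[OF 1]) simp
  also have "\<dots> = X powr \<theta> * Z powr (1 - \<theta>)"
    using assms P Gp by (simp add: X_def Z_def powr_mult powr_powr mult_ac)
  also have "\<dots> \<le> (X + Z) powr \<theta> * (X + Z) powr (1 - \<theta>)"
    using XZ theta by (intro mult_mono powr_mono2) auto
  also have "\<dots> = X + Z" using XZ by (simp add: powr_add[symmetric])
  finally show ?thesis using bulk by linarith
qed

lemma wt_mono_q: "0 \<le> q \<Longrightarrow> wt \<gamma> 0 x \<le> wt \<gamma> q x"
proof (cases "u x \<le> \<gamma>")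
  case False
  assume "0 \<le> q"
  then have "1 \<le> exp (q * (u x - \<gamma>))" using False by simp
  then show ?thesis using mult_left_mono[OF _ pos2_nonneg[of "u x - \<gamma>"], of 1] by (simp add: wt_def)
qed (simp add: wt_eq_0)

lemma bulk_mono_q: "0 \<le> q \<Longrightarrow> q \<le> q' \<Longrightarrow> bulk c q x \<le> bulk c q' x"
  unfolding bulk_def using phi_nonneg[OF G_nonneg, of x] G_nonneg[of x]
  by (intro add_left_mono mult_right_mono) auto

lemma J_0_le:
  assumes "c \<ge> 0" "q \<ge> 0" "R \<le> S" shows "J c \<gamma> 0 R \<le> J c \<gamma> q S"
proof -
  have "J c \<gamma> 0 R \<le> J c \<gamma> q R"
    unfolding J_def
  proof (rule Bochner_Integration.integral_mono)
    fix x
    have "wt \<gamma> 0 x * bulk c 0 x * D x \<le> wt \<gamma> q x * bulk c q x * D x"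
      using wt_mono_q[OF assms(2)] bulk_mono_q[OF order_refl assms(2)] wt_nonneg
        bulk_nonneg[OF assms(1) order_refl] D_pos[of x]
      by (intro mult_right_mono mult_mono) auto
    then show "indicator {x. r x < R} x * (wt \<gamma> 0 x * bulk c 0 x * D x) \<le> indicator {x. r x < R} x * (wt \<gamma> q x * bulk c q x * D x)"
      by (intro mult_left_mono) auto
  qed (use assms in \<open>auto intro: J_integrable\<close>)
  also have "\<dots> \<le> J c \<gamma> q S" by (rule J_mono[OF assms])
  finally show ?thesis .
qed

lemma J_0_pos:
  assumes "c > 0" "u x1 > \<gamma>" "G x1 > 0" "r x1 < R"
  shows "J c \<gamma> 0 R > 0"
proof -
  let ?h = "\<lambda>x. indicator {x. r x < R} x * (wt \<gamma> 0 x * bulk c 0 x * D x)"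
  have i: "integrable dV ?h" using assms(1) by (intro J_integrable) auto
  have nn: "?h x \<ge> 0" for x
    using wt_nonneg bulk_nonneg[of c 0 x] assms(1) D_pos[of x] by (simp add: indicator_def)
  define N where "N = {x. r x < R} \<inter> {x. \<gamma> < u x} \<inter> {x. 0 < G x}"
  have oN: "open N" unfolding N_def
    by (intro open_Int open_rdist_less open_Collect_less continuous_on_const u_cont G_cont)
  have xN: "x1 \<in> N" using assms by (simp add: N_def)
  have pos: "?h x > 0" if "x \<in> N" for x
    using that assms(1) b_pos[of x] D_pos[of x] by (simp add: N_def wt_def bulk_def pos2_pos_iff)
  have "J c \<gamma> 0 R \<noteq> 0"
  proof
    assume "J c \<gamma> 0 R = 0"
    then have "AE x in dV. ?h x = 0"
      using integral_nonneg_eq_0_iff_AE[OF i AE_I2[OF nn]] by (simp add: J_def)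
    then have "AE x in dV. x \<notin> N" by eventually_elim (use pos in force)
    then have "emeasure dV {x \<in> space dV. x \<in> N} = 0"
      using oN by (intro emeasure_eq_0_AE) auto
    then show False using emeasure_open_pos[OF oN xN] by simp
  qed
  moreover have "J c \<gamma> 0 R \<ge> 0" unfolding J_def by (intro integral_nonneg_AE AE_I2 nn)
  ultimately show ?thesis by simp
qed

text \<open>Where its gradient vanishes \<open>u\<close> is locally constant, so otherwise the level set of \<open>u p\<close> would be
  open as well as closed.\<close>

lemma gradient_above_level:
  assumes "u p > \<gamma>" "u p \<noteq> u p'"
  shows "\<exists>x. u x > \<gamma> \<and> G x > 0"
proof (rule ccontr)
  assume no: "\<not> ?thesis"
  then have G0: "G x = 0" if "u x > \<gamma>" for x using that G_nonneg[of x] by (meson not_less order.order_iff_strict)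
  let ?S = "{x. u x = u p}"
  have "open ?S"
  proof (subst open_subopen, intro ballI)
    fix x assume "x \<in> ?S"
    then have ux: "u x > \<gamma>" using assms(1) by simp
    define c where "c = chart_at charts x"
    have c: "c \<in> charts" "x \<in> fst c" unfolding c_def by (rule chart_at_in)+
    have "open {x. \<gamma> < u x}" by (intro open_Collect_less continuous_on_const u_cont)
    from chart_ball[OF c this] ux
    obtain t where t: "t > 0" "cball (snd c x) t \<subseteq> chart_image c" "inv_chart c ` cball (snd c x) t \<subseteq> {x. \<gamma> < u x}"
      by blast
    let ?B = "ball (snd c x) t"
    have B: "?B \<subseteq> chart_image c" using t(2) by auto
    have d: "((u \<circ> inv_chart c) has_derivative (\<lambda>v. 0)) (at y within ?B)" if y: "y \<in> ?B" for y
    proof -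
      let ?q = "inv_chart c y"
      have q: "?q \<in> fst c" "snd c ?q = y" using y B c(1) by (auto simp: inv_chart_in chart_inv_chart)
      have "y \<in> cball (snd c x) t" using y by simp
      then have "G ?q = 0" using t(3) by (intro G0) blast
      then have "chart_deriv c u ?q v = 0" for v
        using chart_deriv_bound[OF u_C1 c(1) q(1), of v] by (simp add: G_def)
      then have "chart_deriv c u ?q = (\<lambda>v. 0)" by auto
      then show ?thesis using C1_chart_deriv[OF u_C1 c(1) q(1)] q(2) by (simp add: has_derivative_at_withinI)
    qed
    have con: "(u \<circ> inv_chart c) y = (u \<circ> inv_chart c) (snd c x)" if "y \<in> ?B" for y
      by (rule has_derivative_zero_unique[OF convex_ball d that]) (use t(1) in auto)
    have "open (inv_chart c ` ?B)" by (rule open_inv_chart_image[OF c(1) open_ball B])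
    moreover have "x \<in> inv_chart c ` ?B"
      using t(1) inv_chart_chart[OF c] by (intro image_eqI[of _ _ "snd c x"]) auto
    moreover have "inv_chart c ` ?B \<subseteq> ?S"
      using con \<open>x \<in> ?S\<close> inv_chart_chart[OF c] by auto
    ultimately show "\<exists>T. open T \<and> x \<in> T \<and> T \<subseteq> ?S" by blast
  qed
  moreover have "closed ?S" by (intro closed_Collect_eq u_cont continuous_on_const)
  moreover have "\<forall>T::'a set. open T \<and> closed T \<longrightarrow> T = {} \<or> T = UNIV"
    using connected_manifold unfolding connected_clopen by simp
  ultimately have "?S = {} \<or> ?S = UNIV" by blast
  then show False using assms(2) by (metis (mono_tags) UNIV_I empty_iff mem_Collect_eq)
qed

end


section \<open>Volume growth forces a contradiction\<close>

locale scaled_solution = growth_solution charts g dV D u b \<phi> f l x0 A \<delta> chi Cl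
  for charts :: "('a::{t2_space, second_countable_topology}, 'n::finite) chart set" and g and dV
    and D u b and \<phi> f l and x0 and A \<delta> chi Cl +
  fixes \<sigma> \<eta> \<mu> Cb Rb c :: real
  assumes sigma: "\<sigma> \<ge> 0" and eta: "\<eta> = \<mu> - (1 + \<delta> - chi) * (1 - \<sigma>)"
    and Cb_pos: "Cb > 0" and b_ge: "\<And>x. r x \<ge> Rb \<Longrightarrow> b x \<ge> Cb * r x powr (- \<mu>)" and c_pos: "c > 0"
begin

text \<open>The constant that remains of the interpolation inequality \<open>flux_le_bulk\<close> in \<open>scaling\<close>.\<close>

definition h0 :: real where
  "h0 = A powr (\<theta> - 1) * (c * (Cb * 2 powr (- \<bar>\<mu>\<bar>))) powr (1 - \<theta>)"

lemma h0_pos: "h0 > 0" using A_pos c_pos Cb_pos by (simp add: h0_def)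

text \<open>The factor \<open>2 powr (- \<bar>\<mu>\<bar>)\<close> covers both signs of \<open>\<mu>\<close>.\<close>

lemma b_annulus:
  assumes "T > 0" "T / 2 \<ge> Rb" "T / 2 \<le> r x" "r x < T"
  shows "b x \<ge> Cb * 2 powr (- \<bar>\<mu>\<bar>) * T powr (- \<mu>)"
proof -
  have rp: "r x > 0" using assms by linarith
  have "2 powr (- \<bar>\<mu>\<bar>) * T powr (- \<mu>) \<le> r x powr (- \<mu>)"
  proof (cases "\<mu> \<ge> 0")
    case True
    have "2 powr (- \<bar>\<mu>\<bar>) * T powr (- \<mu>) \<le> 1 * T powr (- \<mu>)"
      using powr_mono[of "- \<bar>\<mu>\<bar>" 0 "2::real"] by (intro mult_right_mono) auto
    also have "\<dots> \<le> r x powr (- \<mu>)" using assms rp True by (simp add: powr_mono2')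
    finally show ?thesis .
  next
    case False
    have "2 powr (- \<bar>\<mu>\<bar>) * T powr (- \<mu>) = (T / 2) powr (- \<mu>)"
      using False by (simp add: powr_divide powr_minus_divide)
    also have "\<dots> \<le> r x powr (- \<mu>)" using assms False by (intro powr_mono2) auto
    finally show ?thesis .
  qed
  then have "Cb * (2 powr (- \<bar>\<mu>\<bar>) * T powr (- \<mu>)) \<le> Cb * r x powr (- \<mu>)"
    using Cb_pos by (intro mult_left_mono) auto
  also have "\<dots> \<le> b x" using assms by (intro b_ge) auto
  finally show ?thesis by (simp add: mult.assoc)
qed

text \<open>This identity is where \<open>\<eta>\<close> comes from: for \<open>q = \<kappa> * T powr (- \<eta>)\<close> the admissible number \<open>n\<close> of factors
  \<open>1/2\<close> in \<open>decay_step\<close> has the same order \<open>T powr (\<sigma> - \<eta>)\<close> as the exponent \<open>q * (u x - \<gamma>)\<close> of the weight.\<close>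

lemma scaling:
  assumes "T > 0" "\<kappa> > 0"
  shows "A powr (\<theta> - 1) * (\<kappa> * T powr (- \<eta>)) powr \<theta> * (c * (Cb * 2 powr (- \<bar>\<mu>\<bar>) * T powr (- \<mu>))) powr (1 - \<theta>) * T
    = h0 * \<kappa> powr \<theta> * T powr (\<sigma> - \<eta>)"
proof -
  have ex: "(- \<eta>) * \<theta> + (- \<mu>) * (1 - \<theta>) + 1 = \<sigma> - \<eta>"
  proof -
    have "\<mu> * (1 - \<theta>) = \<eta> * (1 - \<theta>) + (1 - \<sigma>) * ((1 - \<theta>) * (1 + \<delta> - chi))"
      by (simp add: eta algebra_simps)
    then have "\<mu> * (1 - \<theta>) = \<eta> * (1 - \<theta>) + (1 - \<sigma>)" by (simp only: theta(3) mult_1_right)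
    then show ?thesis by (simp add: algebra_simps)
  qed
  have 1: "(\<kappa> * T powr (- \<eta>)) powr \<theta> = \<kappa> powr \<theta> * T powr ((- \<eta>) * \<theta>)"
    using assms by (simp add: powr_mult powr_powr)
  have 2: "(c * (Cb * 2 powr (- \<bar>\<mu>\<bar>) * T powr (- \<mu>))) powr (1 - \<theta>)
      = (c * (Cb * 2 powr (- \<bar>\<mu>\<bar>))) powr (1 - \<theta>) * T powr ((- \<mu>) * (1 - \<theta>))"
  proof -
    have "c * (Cb * 2 powr (- \<bar>\<mu>\<bar>) * T powr (- \<mu>)) = (c * (Cb * 2 powr (- \<bar>\<mu>\<bar>))) * T powr (- \<mu>)" by simp
    also have "\<dots> powr (1 - \<theta>) = (c * (Cb * 2 powr (- \<bar>\<mu>\<bar>))) powr (1 - \<theta>) * (T powr (- \<mu>)) powr (1 - \<theta>)"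
      by (rule powr_mult)
    finally show ?thesis by (simp only: powr_powr)
  qed
  have "T powr (\<sigma> - \<eta>) = T powr ((- \<eta>) * \<theta>) * T powr ((- \<mu>) * (1 - \<theta>)) * T"
    using assms(1) unfolding ex[symmetric] powr_add by simp
  then show ?thesis unfolding 1 2 h0_def by (simp only: mult_ac)
qed

definition level :: "real \<Rightarrow> bool" where
  "level \<gamma> \<longleftrightarrow> (\<forall>x. u x > \<gamma> \<longrightarrow> f (u x) * l (G x) \<ge> c * G x powr chi)"

lemma levelD: "level \<gamma> \<Longrightarrow> u x > \<gamma> \<Longrightarrow> f (u x) * l (G x) \<ge> c * G x powr chi"
  by (simp add: level_def)

lemma scaled_decay:
  assumes "level \<gamma>" "\<kappa> > 0" "T \<ge> 8" "T / 2 \<ge> Rb" "n \<ge> 2"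
    and "192 * real n \<le> h0 * \<kappa> powr \<theta> * T powr (\<sigma> - \<eta>)"
  shows "J c \<gamma> (\<kappa> * T powr (- \<eta>)) (T / 2) \<le> 2 * (1/2) ^ n * J c \<gamma> (\<kappa> * T powr (- \<eta>)) T"
proof -
  have T: "T > 0" using assms(3) by simp
  define B where "B = Cb * 2 powr (- \<bar>\<mu>\<bar>) * T powr (- \<mu>)"
  have B: "B > 0" using Cb_pos T by (simp add: B_def)
  have q: "\<kappa> * T powr (- \<eta>) > 0" using assms(2) T by simp
  define H where "H = A powr (\<theta> - 1) * (\<kappa> * T powr (- \<eta>)) powr \<theta> * (c * B) powr (1 - \<theta>)"
  have H: "192 * real n \<le> H * T"
    using assms(6) unfolding H_def B_def scaling[OF T assms(2)] .
  show ?thesis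
  proof (rule decay_step[OF less_imp_le[OF c_pos] levelD[OF assms(1)] less_imp_le[OF q] assms(3,5) H])
    fix x assume "T / 2 \<le> r x" "r x < T"
    then have "b x \<ge> B" unfolding B_def by (intro b_annulus T assms(4))
    then show "H * \<phi> (G x) \<le> bulk c (\<kappa> * T powr (- \<eta>)) x"
      unfolding H_def by (rule flux_le_bulk[OF c_pos q B])
  qed
qed

definition P0 :: "nat \<Rightarrow> real \<Rightarrow> real" where
  "P0 N \<kappa> = 48 * real N * A * (48 * real N / \<kappa>) powr \<delta> / \<kappa>\<^sup>2"

definition p0 :: real where "p0 = 2 * \<sigma> - 1 + (\<eta> - 1) * \<delta>"

lemma P0_nonneg: "P0 N \<kappa> \<ge> 0" using A_pos by (simp add: P0_def)

text \<open>The bound on \<open>u\<close> makes the exponent of the weight at most \<open>T powr (\<sigma> - \<eta>)\<close> on the ball of radius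
  \<open>2 * T\<close>, on which \<open>caccioppoli\<close> is applied.\<close>

lemma volume_bound:
  assumes "level \<gamma>" "\<kappa> > 0" "T \<ge> 8" "N \<ge> 2" "real N \<ge> \<delta> + 1"
    and osc: "\<And>x. r x < 2 * T \<Longrightarrow> u x - \<gamma> \<le> 1 / (\<kappa> * 2 powr \<sigma>) * (2 * T) powr \<sigma>"
  shows "J c \<gamma> (\<kappa> * T powr (- \<eta>)) T \<le> P0 N \<kappa> * T powr p0 * exp (T powr (\<sigma> - \<eta>)) * Vol (2 * T)"
proof -
  have T: "T > 0" using assms(3) by simp
  define q where "q = \<kappa> * T powr (- \<eta>)"
  have q: "q > 0" using assms(2) T by (simp add: q_def)
  define S where "S = (T powr \<sigma> / \<kappa>)\<^sup>2 * exp (T powr (\<sigma> - \<eta>))"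
  have eq: "1 / (\<kappa> * 2 powr \<sigma>) * (2 * T) powr \<sigma> = T powr \<sigma> / \<kappa>" using T by (simp add: powr_mult)
  have S: "wt \<gamma> q x \<le> S" if "r x < 2 * T" for x
  proof (cases "u x \<le> \<gamma>")
    case True
    then show ?thesis by (simp add: wt_eq_0 S_def)
  next
    case False
    have o: "u x - \<gamma> \<le> T powr \<sigma> / \<kappa>" using osc[OF that] unfolding eq .
    have "q * (u x - \<gamma>) \<le> q * (T powr \<sigma> / \<kappa>)" using o q by (intro mult_left_mono) auto
    also have "\<dots> = T powr (- \<eta>) * T powr \<sigma>" using assms(2) by (simp add: q_def)
    also have "\<dots> = T powr (\<sigma> - \<eta>)" by (simp add: powr_add[symmetric])
    finally have e: "exp (q * (u x - \<gamma>)) \<le> exp (T powr (\<sigma> - \<eta>))" by simp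
    have "pos2 (u x - \<gamma>) \<le> (T powr \<sigma> / \<kappa>)\<^sup>2" using False o by (simp add: pos2_def power_mono)
    then show ?thesis unfolding wt_def S_def using e by (intro mult_mono) (simp_all add: pos2_nonneg)
  qed
  have "2 * T \<ge> 8" using assms(3) by simp
  from caccioppoli[OF less_imp_le[OF c_pos] levelD[OF assms(1)] q this assms(4,5) S]
  have "J c \<gamma> q T \<le> 2 * (real N * (48 / (2 * T)) * A * (2 * real N * (48 / (2 * T)) / q) powr \<delta> * S * Vol (2 * T))"
    by simp
  also have "2 * real N * (48 / (2 * T)) / q = 48 * real N / \<kappa> * T powr (\<eta> - 1)"
    using T assms(2) by (simp add: q_def powr_diff powr_minus field_simps)
  also have "(48 * real N / \<kappa> * T powr (\<eta> - 1)) powr \<delta> = (48 * real N / \<kappa>) powr \<delta> * T powr ((\<eta> - 1) * \<delta>)"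
    by (simp only: powr_mult powr_powr)
  also have "2 * (real N * (48 / (2 * T)) * A * ((48 * real N / \<kappa>) powr \<delta> * T powr ((\<eta> - 1) * \<delta>)) * S * Vol (2 * T))
    = (48 * real N * A * (48 * real N / \<kappa>) powr \<delta> / \<kappa>\<^sup>2) * ((T powr \<sigma>)\<^sup>2 * (1 / T) * T powr ((\<eta> - 1) * \<delta>)) * exp (T powr (\<sigma> - \<eta>)) * Vol (2 * T)"
    by (simp add: S_def power_divide mult_ac)
  also have "(T powr \<sigma>)\<^sup>2 * (1 / T) * T powr ((\<eta> - 1) * \<delta>) = T powr p0"
  proof -
    have "p0 = (\<sigma> + \<sigma>) + (- 1) + (\<eta> - 1) * \<delta>" by (simp add: p0_def)
    then have "T powr p0 = T powr (\<sigma> + \<sigma>) * T powr (- 1) * T powr ((\<eta> - 1) * \<delta>)"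
      by (simp only: powr_add)
    also have "T powr (\<sigma> + \<sigma>) = (T powr \<sigma>)\<^sup>2" by (simp only: powr_add power2_eq_square)
    also have "T powr (- 1) = 1 / T" using T by (simp add: powr_minus_divide)
    finally show ?thesis by simp
  qed
  finally show ?thesis by (simp add: P0_def q_def)
qed

lemma choose_kappa:
  assumes "M > 0" obtains \<kappa> where "\<kappa> > 0" "h0 * \<kappa> powr \<theta> = M"
proof (rule that[of "(M / h0) powr (1 / \<theta>)"])
  show "(M / h0) powr (1 / \<theta>) > 0" using assms h0_pos by simp
  show "h0 * ((M / h0) powr (1 / \<theta>)) powr \<theta> = M" using assms h0_pos theta by (simp add: powr_powr)
qed

text \<open>The smaller \<open>e\<close> is, the larger the constant \<open>\<kappa>\<close> that \<open>volume_bound\<close> allows, and with it the decay.\<close>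

definition reachable_levels :: bool where
  "reachable_levels \<longleftrightarrow> (\<forall>e>0. \<exists>\<gamma>. level \<gamma> \<and> (\<exists>x. u x > \<gamma> \<and> G x > 0) \<and>
     (\<exists>R1. \<forall>R\<ge>R1. \<forall>x. r x < R \<longrightarrow> u x - \<gamma> \<le> e * R powr \<sigma>))"

lemma powr_exp_tendsto_0:
  fixes p s :: real
  assumes "s > 0" shows "((\<lambda>T. T powr p * exp (- (T powr s))) \<longlongrightarrow> 0) at_top"
proof -
  define k where "k = nat \<lceil>\<bar>p\<bar> / s\<rceil>"
  have k: "p \<le> s * real k"
  proof -
    have "\<bar>p\<bar> / s \<le> real k" unfolding k_def by linarith
    then show ?thesis using assms by (simp add: field_simps)
  qed
  have lim: "filterlim (\<lambda>T::real. T powr s) at_top at_top"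
    unfolding filterlim_at_top
  proof
    fix Z :: real
    show "\<forall>\<^sub>F T in at_top. Z \<le> T powr s"
      using eventually_ge_at_top[of "(max Z 1) powr (1 / s)"]
    proof eventually_elim
      case (elim T)
      have "Z \<le> ((max Z 1) powr (1 / s)) powr s" using assms by (simp add: powr_powr)
      also have "\<dots> \<le> T powr s" using elim assms by (intro powr_mono2) auto
      finally show ?case .
    qed
  qed
  have "((\<lambda>T. (T powr s) ^ k / exp (T powr s)) \<longlongrightarrow> 0) at_top"
    by (rule filterlim_compose[OF tendsto_power_div_exp_0 lim])
  then show ?thesis
  proof (rule Lim_null_comparison[rotated])
    show "\<forall>\<^sub>F T in at_top. norm (T powr p * exp (- (T powr s))) \<le> (T powr s) ^ k / exp (T powr s)"
      using eventually_ge_at_top[of 1]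
    proof eventually_elim
      case (elim T)
      have "T powr p \<le> T powr (s * real k)" using elim k by (intro powr_mono) auto
      also have "\<dots> = (T powr s) ^ k" using elim by (simp add: powr_powr[symmetric] powr_realpow)
      finally show ?case by (simp add: exp_minus divide_inverse mult_right_mono)
    qed
  qed
qed

text \<open>A single decay step is enough: the number \<open>n\<close> of factors \<open>1/2\<close> that it gains grows like the exponent
  of the volume bound, and a large \<open>\<kappa>\<close> makes it win.\<close>

lemma no_exponential_growth:
  assumes levels: reachable_levels and s: "\<sigma> - \<eta> > 0"
    and V: "\<exists>\<^sub>F R in at_top. Vol R \<le> exp (V * R powr (\<sigma> - \<eta>))"
  shows False
proof -
  define s where "s = \<sigma> - \<eta>"
  \<comment> \<open>Of the excess 2 over the volume exponent, one unit pays for the weight and one is left to beat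
    the polynomial factors.\<close>
  define X where "X = max V 0 * 2 powr s + 2"
  have X: "X > 0" "V * 2 powr s + 2 \<le> X" by (auto simp: X_def intro!: add_nonneg_pos mult_right_mono)
  \<comment> \<open>This makes \<open>n\<close> about \<open>X * T powr s / ln 2\<close>, so that \<open>(1/2) ^ n\<close> is about \<open>exp (- X * T powr s)\<close>.\<close>
  define M where "M = 192 * X / ln 2"
  have M: "M > 0" using X by (simp add: M_def)
  obtain \<kappa> where \<kappa>: "\<kappa> > 0" "h0 * \<kappa> powr \<theta> = M" by (rule choose_kappa[OF M]) (rule that)
  have e: "1 / (\<kappa> * 2 powr \<sigma>) > 0" using \<kappa>(1) by simp
  from levels[unfolded reachable_levels_def, rule_format, OF e]
  obtain \<gamma> x1 R1 where \<gamma>: "level \<gamma>" "u x1 > \<gamma>" "G x1 > 0"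
    "\<And>R x. R \<ge> R1 \<Longrightarrow> r x < R \<Longrightarrow> u x - \<gamma> \<le> 1 / (\<kappa> * 2 powr \<sigma>) * R powr \<sigma>" by blast
  define R0 where "R0 = r x1 + 1"
  define j0 where "j0 = J c \<gamma> 0 R0"
  have j0: "j0 > 0" unfolding j0_def by (rule J_0_pos[OF c_pos \<gamma>(2,3)]) (simp add: R0_def)
  define N where "N = nat \<lceil>\<delta> + 2\<rceil>"
  have N: "N \<ge> 2" "real N \<ge> \<delta> + 1" using chi by (auto simp: N_def; linarith)+
  have half: "filterlim (\<lambda>R::real. R / 2) at_top at_top"
    using filterlim_at_top_mult_tendsto_pos[of "\<lambda>_. 1/2" "1/2" at_top "\<lambda>R. R"] by (simp add: filterlim_ident)
  have lim: "((\<lambda>T. 4 * P0 N \<kappa> * (T powr p0 * exp (- (T powr s)))) \<longlongrightarrow> 0) at_top"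
    using tendsto_mult_right_zero[OF powr_exp_tendsto_0, of s] s by (simp add: s_def)
  have "\<forall>\<^sub>F T in at_top. 4 * P0 N \<kappa> * (T powr p0 * exp (- (T powr s))) < j0"
    by (rule order_tendstoD(2)[OF lim j0])
  moreover have "\<forall>\<^sub>F T in at_top. T \<ge> Max {8, 2 * Rb, R1, 2 * R0, (192 * 2 / M) powr (1 / s)}"
    by (rule eventually_ge_at_top)
  ultimately have "\<forall>\<^sub>F T in at_top. 4 * P0 N \<kappa> * (T powr p0 * exp (- (T powr s))) < j0 \<and>
      T \<ge> 8 \<and> T \<ge> 2 * Rb \<and> T \<ge> R1 \<and> T \<ge> 2 * R0 \<and> T \<ge> (192 * 2 / M) powr (1 / s)"
    by eventually_elim simp
  from eventually_compose_filterlim[OF this half]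
  have ev: "\<forall>\<^sub>F R in at_top. 4 * P0 N \<kappa> * ((R/2) powr p0 * exp (- ((R/2) powr s))) < j0 \<and>
      R/2 \<ge> 8 \<and> R/2 \<ge> 2 * Rb \<and> R/2 \<ge> R1 \<and> R/2 \<ge> 2 * R0 \<and> R/2 \<ge> (192 * 2 / M) powr (1 / s)" .
  obtain R where R: "Vol R \<le> exp (V * R powr (\<sigma> - \<eta>))" "4 * P0 N \<kappa> * ((R/2) powr p0 * exp (- ((R/2) powr s))) < j0"
      "R/2 \<ge> 8" "R/2 \<ge> 2 * Rb" "R/2 \<ge> R1" "R/2 \<ge> 2 * R0" "R/2 \<ge> (192 * 2 / M) powr (1 / s)"
    using frequently_ex[OF frequently_eventually_frequently[OF V ev]] by blast
  define T where "T = R / 2"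
  have T: "T \<ge> 8" "T > 0" "R = 2 * T" "T / 2 \<ge> Rb" "T / 2 \<ge> R0" using R by (auto simp: T_def)
  define y where "y = T powr s"
  have y: "M * y / 192 \<ge> 2"
  proof -
    have "192 * 2 / M = ((192 * 2 / M) powr (1 / s)) powr s" using M s by (simp add: powr_powr s_def)
    also have "\<dots> \<le> y" unfolding y_def using R(7) s by (intro powr_mono2) (auto simp: s_def T_def)
    finally show ?thesis using M by (simp add: field_simps)
  qed
  define n where "n = nat \<lfloor>M * y / 192\<rfloor>"
  have n: "n \<ge> 2" "192 * real n \<le> M * y" "real n \<ge> M * y / 192 - 1" using y unfolding n_def by linarith+
  define q where "q = \<kappa> * T powr (- \<eta>)"
  have q: "q \<ge> 0" using \<kappa>(1) by (simp add: q_def)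
  have "R1 \<le> 2 * T" using R(5) T(2) by (simp add: T_def)
  from \<gamma>(4)[OF this]
  have osc: "u x - \<gamma> \<le> 1 / (\<kappa> * 2 powr \<sigma>) * (2 * T) powr \<sigma>" if "r x < 2 * T" for x
    using that .
  have "j0 \<le> J c \<gamma> q (T / 2)" unfolding j0_def using c_pos q T(5) by (intro J_0_le) auto
  also have "\<dots> \<le> 2 * (1/2) ^ n * J c \<gamma> q T"
    unfolding q_def using n(2) \<kappa> by (intro scaled_decay \<gamma>(1) T(1,4) n(1)) (simp_all add: y_def s_def)
  also have "\<dots> \<le> 2 * (1/2) ^ n * (P0 N \<kappa> * T powr p0 * exp (T powr (\<sigma> - \<eta>)) * Vol (2 * T))"
  proof (rule mult_left_mono)
    show "J c \<gamma> q T \<le> P0 N \<kappa> * T powr p0 * exp (T powr (\<sigma> - \<eta>)) * Vol (2 * T)"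
      unfolding q_def by (rule volume_bound[OF \<gamma>(1) \<kappa>(1) T(1) N osc])
  qed (intro mult_nonneg_nonneg zero_le_power, simp_all)
  also have "\<dots> \<le> 2 * (2 * exp (- X * y)) * (P0 N \<kappa> * T powr p0 * exp y * exp (V * 2 powr s * y))"
  proof -
    have "(1/2::real) ^ n = exp (- (real n * ln 2))" by (simp add: exp_minus exp_of_nat_mult power_one_over inverse_eq_divide)
    also have "\<dots> \<le> exp (- ((M * y / 192 - 1) * ln 2))" using n(3) by (simp add: mult_right_mono)
    also have "\<dots> = exp (ln 2 - X * y)" by (simp add: M_def field_simps)
    also have "\<dots> = 2 * exp (- X * y)" by (simp add: exp_diff exp_minus field_simps)
    finally have 1: "(1/2::real) ^ n \<le> 2 * exp (- X * y)" .
    have "R powr (\<sigma> - \<eta>) = 2 powr s * y" using T by (simp add: y_def s_def powr_mult)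
    then have 2: "Vol (2 * T) \<le> exp (V * 2 powr s * y)" using R(1) T(3) by (simp add: mult.assoc)
    have "P0 N \<kappa> * T powr p0 * exp y * Vol (2 * T) \<le> P0 N \<kappa> * T powr p0 * exp y * exp (V * 2 powr s * y)"
      using P0_nonneg by (intro mult_left_mono 2) auto
    moreover have "0 \<le> P0 N \<kappa> * T powr p0 * exp y * Vol (2 * T)"
      by (intro mult_nonneg_nonneg P0_nonneg Vol_nonneg) simp_all
    moreover have "2 * (1/2::real) ^ n \<le> 2 * (2 * exp (- X * y))" using 1 by simp
    ultimately have "2 * (1/2) ^ n * (P0 N \<kappa> * T powr p0 * exp y * Vol (2 * T))
        \<le> 2 * (2 * exp (- X * y)) * (P0 N \<kappa> * T powr p0 * exp y * exp (V * 2 powr s * y))"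
      by (intro mult_mono[of "2 * (1/2) ^ n"]) simp_all
    then show ?thesis by (simp only: y_def s_def)
  qed
  also have "\<dots> = 4 * P0 N \<kappa> * T powr p0 * exp (- X * y + y + V * 2 powr s * y)"
    by (simp only: exp_add) simp
  also have "\<dots> \<le> 4 * P0 N \<kappa> * T powr p0 * exp (- y)"
  proof -
    have y0: "y \<ge> 0" by (simp add: y_def)
    have "(V * 2 powr s + 2) * y \<le> X * y" using X(2) y0 by (rule mult_right_mono)
    then have "- X * y + y + V * 2 powr s * y \<le> - y" by (simp add: algebra_simps)
    then show ?thesis using P0_nonneg by (intro mult_left_mono) auto
  qed
  also have "\<dots> < j0" using R(2) by (simp add: T_def y_def mult.assoc)
  finally show False by simp
qed

text \<open>If \<open>\<sigma> = \<eta>\<close>, a decay step gains only a fixed factor and has to be repeated over dyadic radii. Since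
  \<open>q\<close> changes with the radius, so does the weight; the energies of different steps are compared through
  the weight with \<open>q = 0\<close>, from which the others differ by bounded factors.\<close>

definition K :: "real \<Rightarrow> real \<Rightarrow> real \<Rightarrow> real" where
  "K \<gamma> q R = (\<integral>x. indicator {x. r x < R} x * (wt \<gamma> 0 x * bulk c q x * D x) \<partial>dV)"

lemma K_integrable:
  assumes "q \<ge> 0"
  shows "integrable dV (\<lambda>x. indicator {x. r x < R} x * (wt \<gamma> 0 x * bulk c q x * D x))"
proof (rule integrable_ball)
  show "(\<lambda>x. wt \<gamma> 0 x * bulk c q x * D x) \<in> borel_measurable borel"
    by (intro borel_measurable_times borel_measurable_continuous_onI wt_cont D_cont bulk_measurable)
  show "continuous_on UNIV (\<lambda>x. wt \<gamma> 0 x * bulk_bound c q x * D x)"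
    by (intro continuous_intros wt_cont bulk_bound_cont D_cont)
  fix x
  have "0 \<le> wt \<gamma> 0 x * bulk c q x * D x"
    using wt_nonneg bulk_nonneg[OF less_imp_le[OF c_pos] assms] D_pos[of x] by simp
  moreover have "wt \<gamma> 0 x * bulk c q x * D x \<le> wt \<gamma> 0 x * bulk_bound c q x * D x"
    using wt_nonneg bulk_le[OF less_imp_le[OF c_pos]] D_pos[of x] by (intro mult_right_mono mult_left_mono) auto
  ultimately show "\<bar>wt \<gamma> 0 x * bulk c q x * D x\<bar> \<le> wt \<gamma> 0 x * bulk_bound c q x * D x" by simp
qed

lemma integral_ball_mono:
  fixes v w :: "'a \<Rightarrow> real"
  assumes "integrable dV (\<lambda>x. indicator {x. r x < R} x * v x)" "integrable dV (\<lambda>x. indicator {x. r x < S} x * w x)"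
    and "R \<le> S" "\<And>x. r x < R \<Longrightarrow> v x \<le> w x" "\<And>x. w x \<ge> 0"
  shows "(\<integral>x. indicator {x. r x < R} x * v x \<partial>dV) \<le> (\<integral>x. indicator {x. r x < S} x * w x \<partial>dV)"
proof (rule Bochner_Integration.integral_mono[OF assms(1,2)])
  fix x show "indicator {x. r x < R} x * v x \<le> indicator {x. r x < S} x * w x"
    using assms(3) assms(4)[of x] assms(5)[of x] by (auto simp: indicator_def)
qed

lemma K_le_J: "q \<ge> 0 \<Longrightarrow> K \<gamma> q R \<le> J c \<gamma> q R"
  unfolding K_def J_def
proof (rule integral_ball_mono)
  fix x assume q: "q \<ge> 0"
  show "wt \<gamma> q x * bulk c q x * D x \<ge> 0"
    using wt_nonneg bulk_nonneg[OF less_imp_le[OF c_pos] q] D_pos[of x] by simp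
  show "wt \<gamma> 0 x * bulk c q x * D x \<le> wt \<gamma> q x * bulk c q x * D x"
    using wt_mono_q[OF q] bulk_nonneg[OF less_imp_le[OF c_pos] q] D_pos[of x]
    by (intro mult_right_mono) auto
qed (use c_pos in \<open>auto intro: K_integrable J_integrable\<close>)

lemma J_le_K:
  assumes q: "q \<ge> 0" and "\<And>x. r x < R \<Longrightarrow> u x > \<gamma> \<Longrightarrow> q * (u x - \<gamma>) \<le> 1"
  shows "J c \<gamma> q R \<le> exp 1 * K \<gamma> q R"
proof -
  have "J c \<gamma> q R \<le> (\<integral>x. indicator {x. r x < R} x * (exp 1 * (wt \<gamma> 0 x * bulk c q x * D x)) \<partial>dV)"
    unfolding J_def
  proof (rule integral_ball_mono)
    have "integrable dV (\<lambda>x. exp 1 * (indicator {x. r x < R} x * (wt \<gamma> 0 x * bulk c q x * D x)))"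
      by (intro integrable_mult_right K_integrable q)
    then show "integrable dV (\<lambda>x. indicator {x. r x < R} x * (exp 1 * (wt \<gamma> 0 x * bulk c q x * D x)))"
      by (simp add: mult_ac)
    fix x
    have bD: "0 \<le> bulk c q x * D x" using bulk_nonneg[OF less_imp_le[OF c_pos] q] D_pos[of x] by simp
    then show "exp 1 * (wt \<gamma> 0 x * bulk c q x * D x) \<ge> 0" using wt_nonneg[of \<gamma> 0 x] by (simp add: mult.assoc)
    assume x: "r x < R"
    have "wt \<gamma> q x \<le> exp 1 * wt \<gamma> 0 x"
    proof (cases "u x \<le> \<gamma>")
      case False
      then have "exp (q * (u x - \<gamma>)) \<le> exp 1" using assms(2)[OF x] by simp
      from mult_left_mono[OF this pos2_nonneg[of "u x - \<gamma>"]]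
      show ?thesis by (simp add: wt_def mult.commute)
    qed (simp add: wt_eq_0)
    from mult_right_mono[OF this bD]
    show "wt \<gamma> q x * bulk c q x * D x \<le> exp 1 * (wt \<gamma> 0 x * bulk c q x * D x)" by (simp only: mult.assoc)
  qed (use c_pos q in \<open>auto intro: J_integrable\<close>)
  also have "\<dots> = exp 1 * K \<gamma> q R"
    unfolding K_def by (subst integral_mult_right_zero[symmetric]) (simp add: mult_ac)
  finally show ?thesis .
qed

lemma K_scale:
  assumes "q \<ge> 0" "a \<ge> 1" shows "K \<gamma> (a * q) R \<le> a * K \<gamma> q R"
proof -
  have "K \<gamma> (a * q) R \<le> (\<integral>x. indicator {x. r x < R} x * (a * (wt \<gamma> 0 x * bulk c q x * D x)) \<partial>dV)"
    unfolding K_def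
  proof (rule integral_ball_mono)
    have "integrable dV (\<lambda>x. a * (indicator {x. r x < R} x * (wt \<gamma> 0 x * bulk c q x * D x)))"
      by (intro integrable_mult_right K_integrable assms)
    then show "integrable dV (\<lambda>x. indicator {x. r x < R} x * (a * (wt \<gamma> 0 x * bulk c q x * D x)))"
      by (simp add: mult_ac)
    show "integrable dV (\<lambda>x. indicator {x. r x < R} x * (wt \<gamma> 0 x * bulk c (a * q) x * D x))"
      using assms by (intro K_integrable) simp
    fix x
    show "a * (wt \<gamma> 0 x * bulk c q x * D x) \<ge> 0"
      using wt_nonneg[of \<gamma> 0 x] bulk_nonneg[OF less_imp_le[OF c_pos] assms(1)] D_pos[of x] assms(2) by simp
    have "0 \<le> c * b x * G x powr chi" using c_pos b_pos[of x] by simp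
    then have "1 * (c * b x * G x powr chi) \<le> a * (c * b x * G x powr chi)" using assms(2) by (intro mult_right_mono)
    then have "bulk c (a * q) x \<le> a * bulk c q x" by (simp add: bulk_def distrib_left mult.assoc)
    then have "wt \<gamma> 0 x * bulk c (a * q) x * D x \<le> wt \<gamma> 0 x * (a * bulk c q x) * D x"
      using wt_nonneg[of \<gamma> 0 x] D_pos[of x] by (intro mult_right_mono mult_left_mono) auto
    then show "wt \<gamma> 0 x * bulk c (a * q) x * D x \<le> a * (wt \<gamma> 0 x * bulk c q x * D x)" by (simp only: mult_ac)
  qed simp
  also have "\<dots> = a * K \<gamma> q R"
    unfolding K_def by (subst integral_mult_right_zero[symmetric]) (simp add: mult_ac)
  finally show ?thesis .
qed

lemma K_mono:
  assumes "q \<ge> 0" "R \<le> S" shows "J c \<gamma> 0 R \<le> K \<gamma> q S"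
  unfolding J_def K_def
proof (rule integral_ball_mono)
  fix x
  have "bulk c 0 x \<le> bulk c q x" by (rule bulk_mono_q[OF order_refl assms(1)])
  then show "wt \<gamma> 0 x * bulk c 0 x * D x \<le> wt \<gamma> 0 x * bulk c q x * D x"
    using wt_nonneg[of \<gamma> 0 x] D_pos[of x] by (intro mult_right_mono mult_left_mono) auto
  show "0 \<le> wt \<gamma> 0 x * bulk c q x * D x"
    using wt_nonneg bulk_nonneg[OF less_imp_le[OF c_pos] assms(1)] D_pos[of x] by simp
qed (use assms c_pos in \<open>auto intro: K_integrable J_integrable\<close>)

lemma K_nonneg: "q \<ge> 0 \<Longrightarrow> K \<gamma> q R \<ge> 0"
  unfolding K_def
  by (intro integral_nonneg_AE AE_I2 mult_nonneg_nonneg wt_nonneg bulk_nonneg less_imp_le[OF c_pos]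
      less_imp_le[OF D_pos]) (simp_all add: indicator_def)

lemma dyadic_radius:
  fixes T T0 :: real
  assumes "T0 > 0" "T \<ge> T0"
  obtains i :: nat where "T0 * 2 ^ i \<le> T" "T < T0 * 2 ^ Suc i"
proof -
  define i where "i = nat \<lfloor>log 2 (T / T0)\<rfloor>"
  have l: "log 2 (T / T0) \<ge> 0" using assms by simp
  have "2 ^ i = 2 powr (real i)" "2 ^ Suc i = 2 powr (real i + 1)"
    by (simp_all add: powr_realpow powr_add)
  moreover have "real i \<le> log 2 (T / T0)" "log 2 (T / T0) < real i + 1"
    using l unfolding i_def by linarith+
  ultimately have "2 ^ i \<le> T / T0" "T / T0 < 2 ^ Suc i"
    using assms by (simp_all add: le_log_iff log_less_iff)
  then show ?thesis using assms by (intro that[of i]) (auto simp: field_simps)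
qed

lemma no_polynomial_growth:
  assumes levels: reachable_levels and s: "\<sigma> = \<eta>"
    and V: "\<exists>\<^sub>F R in at_top. Vol R \<le> R powr V"
  shows False
proof -
  \<comment> \<open>The energy should decay with a power \<open>N'\<close> that exceeds the growth of its volume bound by one.
    The summands \<open>\<sigma> + 3\<close> of \<open>n\<close> pay for the change of \<open>q\<close>, for the factor 2 of the decay step and for
    \<open>exp 1 \<le> 2 ^ 2\<close>.\<close>
  define N' where "N' = \<bar>p0\<bar> + \<bar>V\<bar> + 1"
  define n where "n = nat \<lceil>\<sigma> + 3 + N'\<rceil>"
  have n: "real n \<ge> \<sigma> + 3 + N'" "n \<ge> 2" using sigma unfolding n_def N'_def by linarith+
  obtain \<kappa> where \<kappa>: "\<kappa> > 0" "h0 * \<kappa> powr \<theta> = 192 * real n"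
    by (rule choose_kappa[of "192 * real n"]) (use n(2) in simp, rule that)
  have e: "1 / (\<kappa> * 2 powr \<sigma>) > 0" using \<kappa>(1) by simp
  from levels[unfolded reachable_levels_def, rule_format, OF e]
  obtain \<gamma> x1 R1 where \<gamma>: "level \<gamma>" "u x1 > \<gamma>" "G x1 > 0"
    "\<And>R x. R \<ge> R1 \<Longrightarrow> r x < R \<Longrightarrow> u x - \<gamma> \<le> 1 / (\<kappa> * 2 powr \<sigma>) * R powr \<sigma>" by blast
  define R0 where "R0 = r x1 + 1"
  define j0 where "j0 = J c \<gamma> 0 R0"
  have j0: "j0 > 0" unfolding j0_def by (rule J_0_pos[OF c_pos \<gamma>(2,3)]) (simp add: R0_def)
  define N where "N = nat \<lceil>\<delta> + 2\<rceil>"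
  have N: "N \<ge> 2" "real N \<ge> \<delta> + 1" using chi by (auto simp: N_def; linarith)+
  define T0 where "T0 = Max {8, 2 * Rb, R1, R0}"
  have T0: "T0 \<ge> 8" "T0 \<ge> 2 * Rb" "T0 \<ge> R1" "T0 \<ge> R0" by (simp_all add: T0_def)
  define q where "q T = \<kappa> * T powr (- \<sigma>)" for T
  have q: "q T \<ge> 0" for T using \<kappa>(1) by (simp add: q_def)
  define \<Lambda> where "\<Lambda> = 2 powr (- N')"
  have osc1: "q T * (u x - \<gamma>) \<le> 1" if "T \<ge> T0" "r x < T" for T x
  proof -
    have "q T * (u x - \<gamma>) \<le> q T * (1 / (\<kappa> * 2 powr \<sigma>) * T powr \<sigma>)"
      using \<gamma>(4)[of T x] that T0(3) q[of T] by (intro mult_left_mono) auto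
    also have "\<dots> = 2 powr (- \<sigma>)"
      using \<kappa>(1) that(1) T0(1) by (simp add: q_def powr_minus field_simps)
    also have "\<dots> \<le> 1" using powr_mono[of "- \<sigma>" 0 "2::real"] sigma by simp
    finally show ?thesis .
  qed
  have step: "K \<gamma> (q (T / 2)) (T / 2) \<le> \<Lambda> * K \<gamma> (q T) T" if T: "T \<ge> T0" for T
  proof -
    have T8: "T \<ge> 8" "T / 2 \<ge> Rb" "T > 0" using T T0 by auto
    have q2: "q (T / 2) = 2 powr \<sigma> * q T"
      unfolding q_def powr_divide powr_minus[of 2 \<sigma>]
      by (simp only: divide_inverse inverse_inverse_eq mult_ac)
    have "K \<gamma> (q (T / 2)) (T / 2) \<le> 2 powr \<sigma> * K \<gamma> (q T) (T / 2)"
      unfolding q2 by (rule K_scale[OF q]) (use sigma in \<open>simp add: ge_one_powr_ge_zero\<close>)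
    also have "\<dots> \<le> 2 powr \<sigma> * J c \<gamma> (q T) (T / 2)" by (intro mult_left_mono K_le_J q) simp
    also have "\<dots> \<le> 2 powr \<sigma> * (2 * (1/2) ^ n * J c \<gamma> (q T) T)"
    proof (rule mult_left_mono)
      show "J c \<gamma> (q T) (T / 2) \<le> 2 * (1/2) ^ n * J c \<gamma> (q T) T"
        unfolding q_def s using T8 \<kappa> n(2) by (intro scaled_decay \<gamma>(1)) (simp_all add: s)
    qed simp
    also have "\<dots> \<le> 2 powr \<sigma> * (2 * (1/2) ^ n * (exp 1 * K \<gamma> (q T) T))"
    proof (rule mult_left_mono[OF mult_left_mono])
      show "J c \<gamma> (q T) T \<le> exp 1 * K \<gamma> (q T) T" by (rule J_le_K[OF q]) (rule osc1[OF T])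
    qed (intro mult_nonneg_nonneg zero_le_power, simp_all)
    also have "\<dots> = (2 powr \<sigma> * 2 * (1/2) ^ n * exp 1) * K \<gamma> (q T) T" by (simp only: mult_ac)
    also have "\<dots> \<le> \<Lambda> * K \<gamma> (q T) T"
    proof (rule mult_right_mono[OF _ K_nonneg[OF q]])
      have "(1/2::real) ^ n = 2 powr (- real n)" by (simp add: powr_minus powr_realpow power_one_over inverse_eq_divide)
      moreover have "exp 1 \<le> (2::real) powr 2" using exp_le by simp
      moreover have "(2::real) = 2 powr 1" by simp
      ultimately have "2 powr \<sigma> * 2 * (1/2) ^ n * exp 1 \<le> 2 powr \<sigma> * 2 powr 1 * 2 powr (- real n) * (2::real) powr 2"
        by (simp add: mult_left_mono)
      also have "\<dots> = 2 powr (\<sigma> + 1 + (- real n) + 2)" by (simp only: powr_add)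
      also have "\<dots> \<le> \<Lambda>" unfolding \<Lambda>_def using n(1) by (intro powr_mono) auto
      finally show "2 powr \<sigma> * 2 * (1/2) ^ n * exp 1 \<le> \<Lambda>" .
    qed
    finally show ?thesis .
  qed
  have iter: "K \<gamma> (q (T / 2 ^ i)) (T / 2 ^ i) \<le> \<Lambda> ^ i * K \<gamma> (q T) T" if "T \<ge> T0 * 2 ^ i" for T i
    using that
  proof (induction i)
    case (Suc i)
    have "T0 * 2 ^ i \<le> T0 * 2 ^ Suc i" using T0(1) by (intro mult_left_mono power_increasing) auto
    then have T: "T0 * 2 ^ i \<le> T" using Suc.prems by linarith
    then have "T0 \<le> T / 2 ^ i" by (simp add: field_simps)
    from step[OF this]
    have "K \<gamma> (q (T / 2 ^ Suc i)) (T / 2 ^ Suc i) \<le> \<Lambda> * K \<gamma> (q (T / 2 ^ i)) (T / 2 ^ i)" by (simp add: mult.commute)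
    also have "\<dots> \<le> \<Lambda> * (\<Lambda> ^ i * K \<gamma> (q T) T)"
      by (rule mult_left_mono[OF Suc.IH[OF T]]) (simp add: \<Lambda>_def)
    finally show ?case by (simp only: power_Suc mult.assoc)
  qed simp
  define C where "C = (2 * T0) powr N' * P0 N \<kappa> * exp 1 * 2 powr V"
  have ev: "\<forall>\<^sub>F R in at_top. R \<ge> Max {2 * T0, 2 * (C / j0 + 1)}" by (rule eventually_ge_at_top)
  obtain R where R: "Vol R \<le> R powr V" "R \<ge> 2 * T0" "R \<ge> 2 * (C / j0 + 1)"
    using frequently_ex[OF frequently_eventually_frequently[OF V ev]] by auto
  define T where "T = R / 2"
  have T: "T \<ge> T0" "T > C / j0" "Vol (2 * T) \<le> (2 * T) powr V"
  proof -
    have "2 * T = R" by (simp add: T_def)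
    then show "T \<ge> T0" "Vol (2 * T) \<le> (2 * T) powr V" using R(1,2) by simp_all
    have "2 * (C / j0 + 1) \<le> 2 * T" using R(3) unfolding \<open>2 * T = R\<close> .
    then have "C / j0 + 1 \<le> T" by (rule mult_left_le_imp_le) (rule zero_less_numeral)
    with less_add_one show "T > C / j0" by (rule less_le_trans)
  qed
  have T8: "T \<ge> 8" "T > 0" "T \<ge> 1" using T(1) T0(1) by auto
  obtain i where i: "T0 * 2 ^ i \<le> T" "T < T0 * 2 ^ Suc i"
    by (rule dyadic_radius[OF _ T(1)]) (use T0(1) in simp, rule that)
  have osc: "u x - \<gamma> \<le> 1 / (\<kappa> * 2 powr \<sigma>) * (2 * T) powr \<sigma>" if "r x < 2 * T" for x
    using \<gamma>(4)[of "2 * T" x] that T0(3) T(1) T8 by linarith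
  have Lam: "\<Lambda> ^ i \<le> (T / (2 * T0)) powr (- N')"
  proof -
    have "\<Lambda> ^ i = (2 ^ i) powr (- N')"
      by (simp add: \<Lambda>_def powr_realpow[symmetric] powr_powr mult.commute)
    also have "\<dots> \<le> (T / (2 * T0)) powr (- N')"
      using i(2) T8 T0(1) by (intro powr_mono2') (auto simp: N'_def field_simps)
    finally show ?thesis .
  qed
  have "j0 \<le> K \<gamma> (q (T / 2 ^ i)) (T / 2 ^ i)"
  proof -
    have "T0 \<le> T / 2 ^ i" using i(1) by (simp add: field_simps)
    then show ?thesis unfolding j0_def using T0(4) by (intro K_mono q) auto
  qed
  also have "\<dots> \<le> \<Lambda> ^ i * K \<gamma> (q T) T" by (rule iter[OF i(1)])
  also have "\<dots> \<le> (T / (2 * T0)) powr (- N') * (P0 N \<kappa> * T powr p0 * exp 1 * (2 * T) powr V)"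
  proof (rule mult_mono[OF Lam])
    have "K \<gamma> (q T) T \<le> J c \<gamma> (q T) T" by (rule K_le_J[OF q])
    also have "\<dots> \<le> P0 N \<kappa> * T powr p0 * exp (T powr (\<sigma> - \<eta>)) * Vol (2 * T)"
      using volume_bound[OF \<gamma>(1) \<kappa>(1) T8(1) N osc] by (simp only: q_def s)
    also have "\<dots> \<le> P0 N \<kappa> * T powr p0 * exp (T powr (\<sigma> - \<eta>)) * (2 * T) powr V"
      using T(3) P0_nonneg by (intro mult_left_mono) auto
    finally show "K \<gamma> (q T) T \<le> P0 N \<kappa> * T powr p0 * exp 1 * (2 * T) powr V" using T8 by (simp add: s)
  qed (simp_all add: K_nonneg[OF q])
  also have "\<dots> = C * T powr (- N' + p0 + V)"
  proof -
    have "(T / (2 * T0)) powr (- N') = T powr (- N') * (2 * T0) powr N'"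
      unfolding powr_divide powr_minus[of "2 * T0" N']
      by (simp only: divide_inverse inverse_inverse_eq)
    moreover have "(2 * T) powr V = 2 powr V * T powr V" by (rule powr_mult)
    moreover have "T powr (- N' + p0 + V) = T powr (- N') * T powr p0 * T powr V" by (simp only: powr_add)
    ultimately show ?thesis by (simp only: C_def mult_ac)
  qed
  also have "\<dots> \<le> C * T powr (- 1)"
  proof (rule mult_left_mono)
    show "T powr (- N' + p0 + V) \<le> T powr (- 1)"
      using T8 by (intro powr_mono) (auto simp: N'_def)
    show "C \<ge> 0" unfolding C_def using P0_nonneg by simp
  qed
  also have "\<dots> = C / T" using T8 by (simp add: powr_minus_divide)
  also have "\<dots> < j0" using T(2) T8 j0 by (simp add: field_simps)
  finally show False by simp
qed

end


section \<open>Boundedness of non-constant solutions\<close>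

lemma frequently_less_of_Liminf:
  fixes h :: "'b \<Rightarrow> real"
  assumes "Liminf F (\<lambda>x. ereal (h x)) < \<infinity>"
  obtains V where "\<exists>\<^sub>F x in F. h x \<le> V"
proof -
  obtain V where V: "Liminf F (\<lambda>x. ereal (h x)) < ereal V"
    using ereal_dense2[OF assms] by blast
  have "\<not> (\<forall>\<^sub>F x in F. ereal V \<le> ereal (h x))"
  proof
    assume "\<forall>\<^sub>F x in F. ereal V \<le> ereal (h x)"
    from Liminf_bounded[OF this] show False using V by simp
  qed
  then have "\<exists>\<^sub>F x in F. h x \<le> V"
    unfolding frequently_def by (rule contrapos_nn) (auto elim: eventually_mono)
  then show ?thesis by (rule that)
qed

context growth_solution begin

lemma exponential_growth:
  assumes "Liminf at_top (\<lambda>R. ereal (ln (Vol R) / R powr s)) < \<infinity>"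
  shows "\<exists>V. \<exists>\<^sub>F R in at_top. Vol R \<le> exp (V * R powr s)"
proof -
  obtain V where V: "\<exists>\<^sub>F R in at_top. ln (Vol R) / R powr s \<le> V"
    by (rule frequently_less_of_Liminf[OF assms])
  have "\<exists>\<^sub>F R in at_top. ln (Vol R) / R powr s \<le> V \<and> R > 0"
    by (rule frequently_eventually_frequently[OF V eventually_gt_at_top])
  then have "\<exists>\<^sub>F R in at_top. Vol R \<le> exp (V * R powr s)"
  proof (rule frequently_elim1, elim conjE)
    fix R :: real assume R: "ln (Vol R) / R powr s \<le> V" "R > 0"
    show "Vol R \<le> exp (V * R powr s)"
    proof (cases "Vol R = 0")
      case False
      then have "Vol R > 0" using Vol_nonneg[of R] by simp
      moreover have "ln (Vol R) \<le> V * R powr s" using R by (simp add: pos_divide_le_eq)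
      ultimately show ?thesis by (metis exp_le_cancel_iff exp_ln)
    qed simp
  qed
  then show ?thesis by blast
qed

lemma polynomial_growth:
  assumes "Liminf at_top (\<lambda>R. ereal (ln (Vol R) / ln R)) < \<infinity>"
  shows "\<exists>V. \<exists>\<^sub>F R in at_top. Vol R \<le> R powr V"
proof -
  obtain V where V: "\<exists>\<^sub>F R in at_top. ln (Vol R) / ln R \<le> V"
    by (rule frequently_less_of_Liminf[OF assms])
  have "\<exists>\<^sub>F R in at_top. ln (Vol R) / ln R \<le> V \<and> R > 1"
    by (rule frequently_eventually_frequently[OF V eventually_gt_at_top])
  then have "\<exists>\<^sub>F R in at_top. Vol R \<le> R powr V"
  proof (rule frequently_elim1, elim conjE)
    fix R :: real assume R: "ln (Vol R) / ln R \<le> V" "R > 1"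
    show "Vol R \<le> R powr V"
    proof (cases "Vol R = 0")
      case False
      then have "Vol R > 0" using Vol_nonneg[of R] by simp
      moreover have "ln (Vol R) \<le> V * ln R" using R by (simp add: pos_divide_le_eq)
      ultimately have "Vol R \<le> exp (V * ln R)" by (metis exp_le_cancel_iff exp_ln)
      then show ?thesis using R(2) by (simp add: powr_def)
    qed simp
  qed
  then show ?thesis by blast
qed

text \<open>The part of \<open>reachable_levels\<close> that concerns only the growth of \<open>u\<close> and the sign of \<open>f\<close>.\<close>

definition positive_levels :: "real \<Rightarrow> real \<Rightarrow> bool" where
  "positive_levels \<sigma> c \<longleftrightarrow> (\<forall>e>0. \<exists>\<gamma> R1 p. u p > \<gamma> \<and> (\<forall>x. u x > \<gamma> \<longrightarrow> f (u x) \<ge> c) \<and>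
     (\<forall>R\<ge>R1. \<forall>x. r x < R \<longrightarrow> u x - \<gamma> \<le> e * R powr \<sigma>))"

lemma no_positive_levels:
  assumes sigma: "\<sigma> \<ge> 0" "\<eta> = \<mu> - (1 + \<delta> - chi) * (1 - \<sigma>)" "\<sigma> \<ge> \<eta>"
    and b: "Cb > 0" "\<And>x. r x \<ge> Rb \<Longrightarrow> b x \<ge> Cb * r x powr (- \<mu>)"
    and nonconst: "\<not> u constant_on UNIV" and c: "c > 0" "positive_levels \<sigma> c"
    and exp_growth: "\<sigma> - \<eta> > 0 \<Longrightarrow> Liminf at_top (\<lambda>R. ereal (ln (Vol R) / R powr (\<sigma> - \<eta>))) < \<infinity>"
    and pol_growth: "\<sigma> - \<eta> = 0 \<Longrightarrow> Liminf at_top (\<lambda>R. ereal (ln (Vol R) / ln R)) < \<infinity>"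
  shows False
proof -
  have cC: "c * Cl > 0" using c(1) Cl_pos by simp
  interpret S: scaled_solution charts g dV D u b \<phi> f l x0 A \<delta> chi Cl \<sigma> \<eta> \<mu> Cb Rb "c * Cl"
    by unfold_locales (use sigma b cC in auto)
  have "S.reachable_levels"
    unfolding S.reachable_levels_def
  proof (intro allI impI)
    fix e :: real assume "e > 0"
    from c(2)[unfolded positive_levels_def, rule_format, OF this]
    obtain \<gamma> R1 p where L: "u p > \<gamma>" "\<forall>x. u x > \<gamma> \<longrightarrow> f (u x) \<ge> c"
      "\<forall>R\<ge>R1. \<forall>x. r x < R \<longrightarrow> u x - \<gamma> \<le> e * R powr \<sigma>"
      by (elim exE conjE) (rule that)
    have "S.level \<gamma>"
      unfolding S.level_def
    proof (intro allI impI)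
      fix x assume "u x > \<gamma>"
      have "c * (Cl * G x powr chi) \<le> f (u x) * l (G x)"
        using L(2)[rule_format, OF \<open>u x > \<gamma>\<close>] l_ge'[OF G_nonneg, of x] c(1) Cl_pos by (intro mult_mono) auto
      then show "c * Cl * G x powr chi \<le> f (u x) * l (G x)" by (simp add: mult.assoc)
    qed
    moreover obtain p' where "u p \<noteq> u p'" using nonconst unfolding constant_on_def by metis
    then have "\<exists>x. u x > \<gamma> \<and> G x > 0" by (rule gradient_above_level[OF L(1)])
    ultimately show "\<exists>\<gamma>. S.level \<gamma> \<and> (\<exists>x. u x > \<gamma> \<and> G x > 0) \<and>
        (\<exists>R1. \<forall>R\<ge>R1. \<forall>x. r x < R \<longrightarrow> u x - \<gamma> \<le> e * R powr \<sigma>)"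
      using L(3) by (intro exI[of _ \<gamma>] exI[of _ R1] conjI)
  qed
  note levels = this
  show False
  proof (cases "\<sigma> - \<eta> > 0")
    case True
    from exponential_growth[OF exp_growth[OF True]] show False
      using S.no_exponential_growth[OF levels True] by blast
  next
    case False
    then have eq: "\<sigma> = \<eta>" using sigma(3) by simp
    then have "\<sigma> - \<eta> = 0" by simp
    from polynomial_growth[OF pol_growth[OF this]] show False
      using S.no_polynomial_growth[OF levels eq] by blast
  qed
qed

text \<open>The supremum of \<open>u\<close> lies in the closure of the range, where \<open>f\<close> is continuous, so \<open>f\<close> keeps half of
  its value on all values of \<open>u\<close> that are close to the supremum.\<close>

lemma bounded_positive_levels:
  assumes bdd: "bdd_above (range u)" and f: "continuous_on (closure (range u)) f"
    and pos: "f (SUP x. u x) > 0" and "\<sigma> \<ge> 0"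
  shows "\<exists>c>0. positive_levels \<sigma> c"
proof -
  define s where "s = (SUP x. u x)"
  have s: "s \<in> closure (range u)" unfolding s_def by (rule closure_contains_Sup[OF _ bdd]) simp
  have le: "u x \<le> s" for x unfolding s_def by (rule cSUP_upper[OF UNIV_I bdd])
  have fs: "f s / 2 > 0" using pos by (simp add: s_def)
  obtain d where d: "d > 0" "\<And>t. t \<in> closure (range u) \<Longrightarrow> dist t s < d \<Longrightarrow> dist (f t) (f s) < f s / 2"
    using f[unfolded continuous_on_iff, rule_format, OF s fs] by blast
  have "positive_levels \<sigma> (f s / 2)"
    unfolding positive_levels_def
  proof (intro allI impI)
    fix e :: real assume "e > 0"
    define \<gamma> where "\<gamma> = s - min d e"
    have "\<gamma> < s" using d(1) \<open>e > 0\<close> by (simp add: \<gamma>_def)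
    then obtain p where p: "u p > \<gamma>"
      using less_cSUP_iff[of UNIV u \<gamma>] bdd unfolding s_def by blast
    have A: "f (u x) \<ge> f s / 2" if "u x > \<gamma>" for x
    proof -
      have "dist (u x) s < d" using that le[of x] by (simp add: \<gamma>_def dist_real_def)
      moreover have "u x \<in> closure (range u)" by (rule subsetD[OF closure_subset rangeI])
      ultimately have "dist (f (u x)) (f s) < f s / 2" by (intro d(2))
      then show ?thesis by (simp add: dist_real_def abs_if split: if_splits)
    qed
    have B: "u x - \<gamma> \<le> e * R powr \<sigma>" if "R \<ge> 1" for x R
    proof -
      have "u x - \<gamma> \<le> e * 1" using le[of x] by (simp add: \<gamma>_def)
      also have "\<dots> \<le> e * R powr \<sigma>"
        using \<open>e > 0\<close> ge_one_powr_ge_zero[OF that \<open>\<sigma> \<ge> 0\<close>] by (intro mult_left_mono) auto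
      finally show ?thesis .
    qed
    show "\<exists>\<gamma> R1 p. u p > \<gamma> \<and> (\<forall>x. u x > \<gamma> \<longrightarrow> f (u x) \<ge> f s / 2) \<and>
        (\<forall>R\<ge>R1. \<forall>x. r x < R \<longrightarrow> u x - \<gamma> \<le> e * R powr \<sigma>)"
      by (intro exI[of _ \<gamma>] exI[of _ 1] exI[of _ p] conjI allI impI p A B)
  qed
  with fs show ?thesis by blast
qed

text \<open>Outside some ball \<open>u\<close> is at most \<open>e / 2 * r x powr \<sigma>\<close>; inside it is bounded by compactness, and a
  large \<open>R1\<close> absorbs that bound.\<close>

lemma unbounded_positive_levels:
  assumes unb: "\<not> bdd_above (range u)" and "\<sigma> > 0"
    and f: "Liminf at_top (\<lambda>t. ereal (f t)) > 0"
    and o: "(\<lambda>x. max (u x) 0) \<in> o[filtercomap r at_top](\<lambda>x. r x powr \<sigma>)"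
  shows "\<exists>c>0. positive_levels \<sigma> c"
proof -
  obtain c where c: "0 < ereal c" "ereal c < Liminf at_top (\<lambda>t. ereal (f t))"
    using ereal_dense2[OF f] by auto
  obtain t0 where t0: "\<And>t. t \<ge> t0 \<Longrightarrow> f t \<ge> c"
    using less_LiminfD[OF c(2)] unfolding eventually_at_top_linorder by fastforce
  have "positive_levels \<sigma> c"
    unfolding positive_levels_def
  proof (intro allI impI)
    fix e :: real assume "e > 0"
    obtain p where p: "u p > t0" using unb unfolding bdd_above_def by (metis not_less rangeE)
    obtain Ra where Ra: "\<And>x. r x \<ge> Ra \<Longrightarrow> max (u x) 0 \<le> e / 2 * r x powr \<sigma>"
      using landau_o.smallD[OF o, of "e / 2"] \<open>e > 0\<close>
      unfolding eventually_filtercomap_at_top_linorder by auto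
    obtain M where M: "M \<ge> 0" "\<And>x. r x \<le> Ra \<Longrightarrow> u x \<le> M"
    proof -
      have "compact (u ` {x. r x \<le> Ra})"
        by (rule compact_continuous_image[OF continuous_on_subset[OF u_cont subset_UNIV] compact_rdist_le])
      from compact_imp_bounded[OF this, unfolded bounded_iff]
      obtain M where M: "\<forall>y\<in>u ` {x. r x \<le> Ra}. norm y \<le> M" by (rule exE)
      show ?thesis
      proof (rule that[of "max M 0"])
        fix x assume "r x \<le> Ra"
        then have "norm (u x) \<le> M" by (intro M[rule_format] imageI CollectI)
        then show "u x \<le> max M 0" by simp
      qed simp
    qed
    define Y where "Y = 2 * (M + \<bar>t0\<bar>) / e"
    have Y: "Y \<ge> 0" using M(1) \<open>e > 0\<close> by (simp add: Y_def)
    define R1 where "R1 = max 1 (Y powr (1 / \<sigma>))"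
    have B: "u x - t0 \<le> e * R powr \<sigma>" if "R \<ge> R1" "r x < R" for x R
    proof -
      have "Y = (Y powr (1 / \<sigma>)) powr \<sigma>" using Y \<open>\<sigma> > 0\<close> by (simp add: powr_powr)
      also have "\<dots> \<le> R powr \<sigma>" using that \<open>\<sigma> > 0\<close> by (intro powr_mono2) (auto simp: R1_def)
      finally have YR: "M + \<bar>t0\<bar> \<le> e / 2 * R powr \<sigma>" using \<open>e > 0\<close> by (simp add: Y_def field_simps)
      have rx: "r x \<ge> 0" by (rule rdist_nonneg)
      have "e / 2 * r x powr \<sigma> \<le> e / 2 * R powr \<sigma>"
        using \<open>e > 0\<close> \<open>\<sigma> > 0\<close> that rx by (intro mult_left_mono powr_mono2) auto
      then have "u x \<le> M \<or> u x \<le> e / 2 * R powr \<sigma>"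
        using M(2)[of x] Ra[of x] by linarith
      moreover have "e / 2 * R powr \<sigma> \<ge> 0" using \<open>e > 0\<close> by simp
      moreover have "e * R powr \<sigma> = e / 2 * R powr \<sigma> + e / 2 * R powr \<sigma>" by simp
      ultimately show ?thesis using YR M(1) by linarith
    qed
    show "\<exists>\<gamma> R1 p. u p > \<gamma> \<and> (\<forall>x. u x > \<gamma> \<longrightarrow> f (u x) \<ge> c) \<and>
        (\<forall>R\<ge>R1. \<forall>x. r x < R \<longrightarrow> u x - \<gamma> \<le> e * R powr \<sigma>)"
      using p t0[OF less_imp_le] B by (intro exI[of _ t0] exI[of _ R1] exI[of _ p] conjI allI impI)
  qed
  with c(1) show ?thesis by auto
qed

end

text \<open>A constant has no flux, so its source, tested with a bump function, cannot be positive.\<close>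

lemma (in weak_solution) constant_solution:
  assumes u: "\<And>x. u x = a" and b_pos: "\<And>x. b x > 0"
  shows "f a * l 0 \<le> 0"
proof (rule ccontr)
  assume neg: "\<not> f a * l 0 \<le> 0"
  have ua: "u = (\<lambda>x. a)" using u by auto
  have "grad_norm charts g (\<lambda>x. a) x = 0" for x
    by (simp add: grad_norm_def grad_inner_const[OF Ck_function_const])
  then have G0: "G x = 0" for x unfolding G_def by (subst ua)
  obtain p :: 'a where "p \<in> UNIV" by blast
  obtain h V K where h: "C1 h" "\<And>q. 0 \<le> h q" "open V" "p \<in> V" "\<And>q. q \<in> V \<Longrightarrow> h q = 1"
    "compact K" "\<And>q. q \<notin> K \<Longrightarrow> h q = 0"
    by (rule manifold_bump[OF open_UNIV \<open>p \<in> UNIV\<close>]) (rule that)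
  let ?h = "\<lambda>x. source x * h x * D x"
  have src: "source x = b x * (f a * l 0)" for x by (simp add: source_def u G0)
  have src_pos: "source x > 0" for x unfolding src using b_pos neg by simp
  have i: "integrable dV ?h" by (rule source_integrable[OF h(1,6,7)])
  have nn: "0 \<le> ?h x" for x
    using less_imp_le[OF src_pos] h(2) less_imp_le[OF D_pos] by simp
  have "admissible h" by (rule admissible_C1[OF h(1,2,6,7)])
  then have "(\<integral>x. ?h x \<partial>dV) \<le> 0" unfolding admissible_def by (simp add: flux_def[abs_def] G0)
  moreover have "(\<integral>x. ?h x \<partial>dV) \<ge> 0" by (rule integral_nonneg_AE[OF AE_I2[OF nn]])
  ultimately have "(\<integral>x. ?h x \<partial>dV) = 0" by (rule order.antisym)
  then have "AE x in dV. ?h x = 0" using integral_nonneg_eq_0_iff_AE[OF i AE_I2[OF nn]] by simp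
  then have "AE x in dV. x \<notin> V"
  proof eventually_elim
    case (elim x)
    show ?case using elim h(5)[of x] src_pos[of x] D_pos[of x] by auto
  qed
  then have "emeasure dV {x \<in> space dV. x \<in> V} = 0" using h(3) by (intro emeasure_eq_0_AE) auto
  then show False using emeasure_open_pos[OF h(3,4)] by simp
qed

theorem theoremB:
  fixes charts :: "('a::{t2_space, second_countable_topology}, 'n::finite) chart set"
    and g :: "('a, 'n) gram"
    and dV :: "'a measure"
    and orig :: 'a
    and r D b u :: "'a \<Rightarrow> real"
    and \<phi> f l :: "real \<Rightarrow> real"
    and A \<delta> chi \<mu> \<sigma> \<eta> C\<^sub>l C\<^sub>b :: real
  assumes "riemannian_manifold charts g"
    and "CARD('n) \<ge> 2"
    and "riem_complete charts g"
    and "\<not> compact (UNIV :: 'a set)"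
    and "connected (UNIV :: 'a set)"
    and "riemannian_volume charts g dV"
    and r_def: "\<And>x. r x = riem_dist charts g x orig"
    and "Ck_function 2 charts D" and "\<And>x. D x > 0"
    and "continuous_on {0..} \<phi>" and "\<phi> C1_differentiable_on {0<..}"
    and "\<And>t. t \<ge> 0 \<Longrightarrow> \<phi> t \<ge> 0" and "\<phi> 0 = 0"
    and "A > 0" and "\<delta> > 0" and "\<And>t. t > 0 \<Longrightarrow> \<phi> t \<le> A * t powr \<delta>"
    and "continuous_on {0..} f" and "continuous_on (closure (range u)) f"
    and "continuous_on {0..} l"
    and "C\<^sub>l > 0" and "\<And>t. t > 0 \<Longrightarrow> l t \<ge> C\<^sub>l * t powr chi"
    and "continuous_on UNIV b" and "\<And>x. b x > 0"
    and "C\<^sub>b > 0" and "\<forall>\<^sub>F x in filtercomap r at_top. b x \<ge> C\<^sub>b * r x powr (- \<mu>)"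
    and "\<sigma> \<ge> 0"
    and eta_def: "\<eta> = \<mu> - (1 + \<delta> - chi) * (1 - \<sigma>)"
    and "\<sigma> \<ge> \<eta>" and "0 \<le> chi" and "chi < \<delta>"
    and "entire_classical_weak_solution charts g dV D \<phi> b f l u"
    and "(\<sigma> > 0 \<and> Liminf at_top (\<lambda>t. ereal (f t)) > 0 \<and>
            (\<lambda>x. max (u x) 0) \<in> o[filtercomap r at_top](\<lambda>x. r x powr \<sigma>))
         \<or> (\<sigma> = 0 \<and> bdd_above (range u))"
    and "\<sigma> - \<eta> > 0 \<Longrightarrow>
          Liminf at_top (\<lambda>R. ereal (ln (LINT x:riem_ball charts g orig R|dV. D x)
                                    / R powr (\<sigma> - \<eta>))) < \<infinity>"
    and "\<sigma> - \<eta> = 0 \<Longrightarrow>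
          Liminf at_top (\<lambda>R. ereal (ln (LINT x:riem_ball charts g orig R|dV. D x)
                                    / ln R)) < \<infinity>"
  shows "(\<not> u constant_on UNIV \<longrightarrow> bdd_above (range u) \<and> f (SUP x. u x) \<le> 0) \<and>
         ((\<forall>t>0. f t > 0) \<and> (\<exists>x\<^sub>0. u x\<^sub>0 > 0) \<longrightarrow> u constant_on UNIV) \<and>
         ((\<forall>t>0. f t > 0) \<and> (\<exists>x\<^sub>0. u x\<^sub>0 > 0) \<and> f 0 = 0 \<and> l 0 > 0 \<longrightarrow> (\<forall>x. u x = 0)) \<and>
         ((\<forall>t>0. f t > 0) \<and> (\<forall>x. u x \<ge> 0) \<and> f 0 = 0 \<and> l 0 > 0 \<longrightarrow> (\<forall>x. u x = 0))"
proof -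
  interpret rm: riemannian_manifold charts g by fact
  have Dc: "continuous_on UNIV D" by (rule rm.Ck_function_continuous) fact
  have fc: "continuous_on (range u) f" by (rule continuous_on_subset[OF _ closure_subset]) fact
  interpret S: growth_solution charts g dV D u b \<phi> f l orig A \<delta> chi C\<^sub>l
    by unfold_locales (fact Dc fc assms)+
  have r: "r = S.r" using r_def S.rdist_sym by auto
  have Vol: "(LINT x:riem_ball charts g orig R|dV. D x) = S.Vol R" for R
    by (simp add: S.Vol_def set_lebesgue_integral_def riem_ball_def)
  obtain Rb where Rb: "\<And>x. S.r x \<ge> Rb \<Longrightarrow> b x \<ge> C\<^sub>b * S.r x powr (- \<mu>)"
    using assms(25) unfolding r eventually_filtercomap_at_top_linorder by blast
  have contra: "\<not> S.positive_levels \<sigma> c" if "\<not> u constant_on UNIV" "c > 0" for c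
    using S.no_positive_levels[OF assms(26-28,24) Rb that(1,2)] assms(33,34)[unfolded Vol] by blast
  have main: "bdd_above (range u) \<and> f (SUP x. u x) \<le> 0" if "\<not> u constant_on UNIV"
  proof -
    have bdd: "bdd_above (range u)"
    proof (rule ccontr)
      assume unb: "\<not> bdd_above (range u)"
      from assms(32)[unfolded r] show False
      proof (elim disjE conjE)
        assume *: "\<sigma> > 0" "Liminf at_top (\<lambda>t. ereal (f t)) > 0"
          "(\<lambda>x. max (u x) 0) \<in> o[filtercomap S.r at_top](\<lambda>x. S.r x powr \<sigma>)"
        show False using S.unbounded_positive_levels[OF unb *] contra[OF that] by metis
      qed (use unb in simp)
    qed
    have "f (SUP x. u x) \<le> 0"
      using S.bounded_positive_levels[OF bdd assms(18) _ assms(26)] contra[OF that] by (metis not_less)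
    with bdd show ?thesis by (rule conjI)
  qed
  have const: "u constant_on UNIV" if f: "\<forall>t>0. f t > 0" and x: "u x > 0" for x
  proof (rule ccontr)
    assume "\<not> u constant_on UNIV"
    then have *: "bdd_above (range u)" "f (SUP x. u x) \<le> 0" using main by auto
    have "0 < (SUP x. u x)" using less_le_trans[OF x cSUP_upper[OF UNIV_I *(1)]] .
    then show False using f *(2) by (meson not_less)
  qed
  have no_pos: "\<not> u x > 0" if f: "\<forall>t>0. f t > 0" and l: "l 0 > 0" for x
  proof
    assume x: "u x > 0"
    obtain a where a: "\<And>y. u y = a" using const[OF f x] unfolding constant_on_def by blast
    have "f a * l 0 \<le> 0" by (rule S.constant_solution[OF a]) fact
    moreover have "f a * l 0 > 0" using f l x a by simp
    ultimately show False by simp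
  qed
  have "u x = 0" if "\<forall>t>0. f t > 0" "l 0 > 0" "\<forall>x. u x \<ge> 0" for x
    using no_pos[OF that(1,2), of x] that(3) by (meson order.antisym not_less)
  then show ?thesis using main const no_pos by blast
qed

end
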